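(* Let $X$ be an affine curve, let $\mathcal{S}$ be a finitely generated submonoid of $\mathbb{N}^r$, let $\mathbf{F}$ be a divisor on $X$ (with rational or real coefficients) such that $\lceil\mathbf{F}\rceil\geq 0$, and let $\mathbf{m}\colon\mathcal{S}\rightarrow\mathrm{Mob}(X)$ be a superadditive map such that the system $\mathbf{m}(\mathcal{S})=\{\mathbf{m}(s)\}_{s\in\mathcal{S}}$ is bounded and $\mathbf{F}$-saturated. Let $\mathcal{C}$ be a rational polyhedral cone contained in $\mathrm{int}\,\mathcal{S}_{\mathbb{R}}$. Then the algebra $$R(X,\mathbf{m}(\mathcal{C}\cap\mathcal{S}))=\bigoplus_{s\in\mathcal{C}\cap\mathcal{S}}H^0(X,\mathcal{O}_X(\mathbf{m}(s)))$$ is finitely generated over $H^0(X,\mathcal{O}_X)$.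
   Context: All varieties are normal over an algebraically closed field $k$ of characteristic zero, so an affine curve $X$ is smooth. On a curve b-divisors are just ordinary divisors, and on an affine curve every integral divisor is mobile, so $\mathrm{Mob}(X)$ is the group of integral divisors on $X$. $\mathbb{N}$ contains $0$. Inequalities of divisors are coefficientwise, and $\lceil\cdot\rceil$ is the coefficientwise round-up. $\mathbf{m}$ is superadditive if $\mathbf{m}(s)+\mathbf{m}(t)\leq\mathbf{m}(s+t)$ for all $s,t\in\mathcal{S}$. The system $\mathbf{m}(\mathcal{S})$ is bounded if (i) there is a reduced divisor $F$ on $X$ with $\mathrm{Supp}\,\mathbf{m}(s)\subset F$ for every $s\in\mathcal{S}$, and (ii) for every $s\in\mathcal{S}$ the limit $\lim_{\kappa\to\infty}\mathbf{m}(\kappa s)/\kappa$ exists as a divisor with real coefficients. The system $\mathbf{m}(\mathcal{S})$ is $\mathbf{F}$-saturated if for all $s,s_1,\dots,s_n\in\mathcal{S}$ and all non-negative rational numbers $\xi_1,\dots,\xi_n$ with $s=\xi_1s_1+\dots+\xi_ns_n$ one has $\lceil\xi_1\mathbf{m}(s_1)+\dots+\xi_n\mathbf{m}(s_n)+\mathbf{F}\rceil\leq\mathbf{m}(s)$. (This is the specialization to affine curves of the general definition of saturation; equivalently, $\lceil(\mu/\nu)\mathbf{m}(\nu s)+\mathbf{F}\rceil\leq\mathbf{m}(\mu s)$ for all $s\in\mathcal{S}$ and all positive integers $\mu,\nu$.) If $\mathcal{S}=\sum\mathbb{N}e_i$, then $\mathcal{S}_{\mathbb{R}}=\sum\mathbb{R}_+e_i\subset\mathbb{R}^r$.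 For a cone $\mathcal{D}\subset\mathbb{R}^n$ of dimension $n$, $\mathrm{int}\,\mathcal{D}$ denotes the topological interior of $\mathcal{D}$ in $\mathbb{R}^n$ together with the origin. All cones are convex and contain no lines. The algebra $R(X,\mathbf{m}(\mathcal{C}\cap\mathcal{S}))$ is regarded as an $\mathbb{N}^r$-graded subalgebra of $k(X)[T_1,\dots,T_r]$, where $k(X)$ is the function field, the degree $s$ part is $H^0(X,\mathcal{O}_X(\mathbf{m}(s)))=\{\varphi\in k(X):\varphi=0\text{ or }\mathrm{div}\,\varphi+\mathbf{m}(s)\geq0\}$ and multiplication is induced from $k(X)$. *)

theory Defs
  imports
    "HOL-Analysis.Analysis"
    "HOL-Computational_Algebra.Computational_Algebra"
    "HOL-Library.Poly_Mapping"
begin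

section \<open>Commutative algebra\<close>

definition is_ideal :: "'a::comm_ring_1 set \<Rightarrow> bool" where
  "is_ideal I \<longleftrightarrow> 0 \<in> I \<and> (\<forall>a\<in>I. \<forall>b\<in>I. a + b \<in> I) \<and> (\<forall>r. \<forall>a\<in>I. r * a \<in> I)"

definition is_prime_ideal :: "'a::comm_ring_1 set \<Rightarrow> bool" where
  "is_prime_ideal P \<longleftrightarrow>
     is_ideal P \<and> P \<noteq> UNIV \<and> (\<forall>a b. a * b \<in> P \<longrightarrow> a \<in> P \<or> b \<in> P)"

definition is_maximal_ideal :: "'a::comm_ring_1 set \<Rightarrow> bool" where
  "is_maximal_ideal P \<longleftrightarrow>
     is_ideal P \<and> P \<noteq> UNIV \<and> (\<forall>J. is_ideal J \<and> P \<subseteq> J \<longrightarrow> J = P \<or> J = UNIV)"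

definition prime_chain :: "nat \<Rightarrow> (nat \<Rightarrow> 'a::comm_ring_1 set) \<Rightarrow> bool" where
  "prime_chain n p \<longleftrightarrow> (\<forall>i\<le>n. is_prime_ideal (p i)) \<and> (\<forall>i<n. p i \<subset> p (Suc i))"

definition krull_dim :: "'a::comm_ring_1 itself \<Rightarrow> enat" where
  "krull_dim _ = Sup {enat n | n. \<exists>p :: nat \<Rightarrow> 'a set. prime_chain n p}"

definition is_subring :: "'a::comm_ring_1 set \<Rightarrow> bool" where
  "is_subring B \<longleftrightarrow> 0 \<in> B \<and> 1 \<in> B \<and>
     (\<forall>a\<in>B. \<forall>b\<in>B. a + b \<in> B \<and> a - b \<in> B \<and> a * b \<in> B)"

text \<open>
  Here \<open>B0\<close> is the image of the base ring; \<open>is_subring hull (B0 \<union> G)\<close> is the subalgebra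
  generated by \<open>G\<close> over it.
\<close>

definition finitely_generated_algebra :: "'a::comm_ring_1 set \<Rightarrow> 'a set \<Rightarrow> bool" where
  "finitely_generated_algebra B0 R \<longleftrightarrow> (\<exists>G. finite G \<and> is_subring hull (B0 \<union> G) = R)"

definition integrally_closed_domain :: "'a::idom itself \<Rightarrow> bool" where
  "integrally_closed_domain _ \<longleftrightarrow>
     (\<forall>x :: 'a fract. (\<exists>p :: 'a poly. lead_coeff p = 1 \<and> poly (map_poly to_fract p) x = 0)
        \<longrightarrow> x \<in> range to_fract)"


section \<open>Normal affine curves\<close>

text \<open>
  The curve \<open>X\<close> is given by its coordinate ring, the type \<open>'a\<close>, with structure map
  \<open>emb\<close> from the base field \<open>'k\<close>; its function field \<open>k(X)\<close> is \<open>'a fract\<close>, and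
  \<open>H\<^sup>0(X, \<O>\<^sub>X)\<close> is the image of \<open>'a\<close> in it.
\<close>

locale affine_curve =
  fixes emb :: "'k::{alg_closed_field, field_char_0} \<Rightarrow> 'a::idom"
  assumes emb_one: "emb 1 = 1"
    and emb_add: "emb (x + y) = emb x + emb y"
    and emb_mult: "emb (x * y) = emb x * emb y"
    and finite_type: "finitely_generated_algebra (range emb) (UNIV :: 'a set)"
    and normal: "integrally_closed_domain TYPE('a)"
    and dim_one: "krull_dim TYPE('a) = 1"

text \<open>The prime divisors of an affine curve are its closed points.\<close>

definition points :: "'a::idom set set" where
  "points = {P. is_maximal_ideal P}"

definition local_ring :: "'a::idom set \<Rightarrow> 'a fract set" where
  "local_ring P = {Fract a b | a b. b \<notin> P}"

definition local_max_ideal :: "'a::idom set \<Rightarrow> 'a fract set" where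
  "local_max_ideal P = {Fract a b | a b. a \<in> P \<and> b \<notin> P}"

text \<open>
  The local ring of a normal curve at a point \<open>P\<close> is a discrete valuation ring.  If \<open>t\<close>
  generates its maximal ideal, every nonzero rational function is uniquely \<open>t\<^sup>n u\<close> with
  \<open>u\<close> a unit, and \<open>n\<close>, which does not depend on \<open>t\<close>, is its order at \<open>P\<close>.
  (Meaningful for \<open>P \<in> points\<close> and \<open>\<phi> \<noteq> 0\<close> only.)
\<close>

definition ord_at :: "'a::idom set \<Rightarrow> 'a fract \<Rightarrow> int" where
  "ord_at P \<phi> = (THE n. \<exists>t u. local_max_ideal P = (\<lambda>x. t * x) ` local_ring P \<and>
     u \<noteq> 0 \<and> u \<in> local_ring P \<and> inverse u \<in> local_ring P \<and> \<phi> = (t powi n) * u)"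


section \<open>Divisors\<close>

text \<open>
  A divisor with coefficients in \<open>'b\<close> (integers or reals) is a function on closed points with
  finite support, extended by \<open>0\<close> to sets that are not points.  The order on divisors is
  therefore the pointwise order on functions.
\<close>

definition supp_div :: "('a set \<Rightarrow> 'b::zero) \<Rightarrow> 'a set set" where
  "supp_div D = {P. D P \<noteq> 0}"

definition is_divisor :: "('a::idom set \<Rightarrow> 'b::zero) \<Rightarrow> bool" where
  "is_divisor D \<longleftrightarrow> supp_div D \<subseteq> points \<and> finite (supp_div D)"

definition is_reduced_divisor :: "('a::idom set \<Rightarrow> int) \<Rightarrow> bool" where
  "is_reduced_divisor D \<longleftrightarrow> is_divisor D \<and> (\<forall>P. D P \<in> {0, 1})"

definition ceil_div :: "('a set \<Rightarrow> real) \<Rightarrow> 'a set \<Rightarrow> int" where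
  "ceil_div D = (\<lambda>P. \<lceil>D P\<rceil>)"

definition principal_div :: "'a::idom fract \<Rightarrow> 'a set \<Rightarrow> int" where
  "principal_div \<phi> = (\<lambda>P. if P \<in> points then ord_at P \<phi> else 0)"

definition global_sections :: "('a::idom set \<Rightarrow> int) \<Rightarrow> 'a fract set" where
  "global_sections D = {\<phi>. \<phi> = 0 \<or> (\<forall>P. principal_div \<phi> P + D P \<ge> 0)}"


section \<open>Monoids and cones\<close>

definition real_vec :: "nat ^ 'r \<Rightarrow> real ^ 'r" where
  "real_vec s = (\<chi> i. real (s $ i))"

text \<open>\<open>nat_span E\<close> and \<open>cone_span V\<close> are used for finite \<open>E\<close> and \<open>V\<close> only.\<close>

definition nat_span :: "(nat ^ 'r) set \<Rightarrow> (nat ^ 'r) set" where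
  "nat_span E = {(\<Sum>e\<in>E. c e *s e) | c. True}"

definition cone_span :: "(real ^ 'r) set \<Rightarrow> (real ^ 'r) set" where
  "cone_span V = {(\<Sum>v\<in>V. c v *\<^sub>R v) | c. \<forall>v\<in>V. c v \<ge> 0}"

definition rational_polyhedral_cone :: "(real ^ 'r) set \<Rightarrow> bool" where
  "rational_polyhedral_cone C \<longleftrightarrow>
     (\<exists>V. finite V \<and> (\<forall>v\<in>V. \<forall>i. v $ i \<in> \<rat>) \<and> C = cone_span V)"

definition int_cone :: "(real ^ 'r) set \<Rightarrow> (real ^ 'r) set" where
  "int_cone D = interior D \<union> {0}"


section \<open>Systems of divisors indexed by a monoid\<close>

definition superadditive_system ::
    "(nat ^ 'r) set \<Rightarrow> (nat ^ 'r \<Rightarrow> 'a set \<Rightarrow> int) \<Rightarrow> bool" where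
  "superadditive_system S m \<longleftrightarrow> (\<forall>s\<in>S. \<forall>t\<in>S. (\<lambda>P. m s P + m t P) \<le> m (s + t))"

definition bounded_system ::
    "(nat ^ 'r) set \<Rightarrow> (nat ^ 'r \<Rightarrow> 'a::idom set \<Rightarrow> int) \<Rightarrow> bool" where
  "bounded_system S m \<longleftrightarrow>
     (\<exists>G. is_reduced_divisor G \<and> (\<forall>s\<in>S. supp_div (m s) \<subseteq> supp_div G)) \<and>
     (\<forall>s\<in>S. \<exists>D :: 'a set \<Rightarrow> real. is_divisor D \<and>
        (\<forall>P. (\<lambda>\<kappa>::nat. real_of_int (m (\<kappa> *s s) P) / real \<kappa>) \<longlonglongrightarrow> D P))"

definition saturated_system ::
    "(nat ^ 'r) set \<Rightarrow> (nat ^ 'r \<Rightarrow> 'a set \<Rightarrow> int) \<Rightarrow> ('a set \<Rightarrow> real) \<Rightarrow> bool" where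
  "saturated_system S m F \<longleftrightarrow>
     (\<forall>(n::nat) (\<xi>::nat \<Rightarrow> rat) \<sigma> s.
        s \<in> S \<and> (\<forall>i<n. \<sigma> i \<in> S \<and> \<xi> i \<ge> 0) \<and>
        real_vec s = (\<Sum>i<n. real_of_rat (\<xi> i) *\<^sub>R real_vec (\<sigma> i))
        \<longrightarrow> ceil_div (\<lambda>P. (\<Sum>i<n. real_of_rat (\<xi> i) * real_of_int (m (\<sigma> i) P)) + F P) \<le> m s)"

text \<open>
  \<open>(nat ^ 'r) \<Rightarrow>\<^sub>0 'a fract\<close> is the polynomial ring over \<open>k(X)\<close> in variables indexed by
  \<open>'r\<close>, with its grading by exponent vectors.  The set below is the direct sum, over \<open>s\<close>
  in \<open>T\<close>, of the global sections of \<open>m s\<close> placed in degree \<open>s\<close>.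
\<close>

definition section_algebra ::
    "(nat ^ 'r) set \<Rightarrow> (nat ^ 'r \<Rightarrow> 'a::idom set \<Rightarrow> int) \<Rightarrow> (nat ^ 'r \<Rightarrow>\<^sub>0 'a fract) set" where
  "section_algebra T m =
     {f. Poly_Mapping.keys f \<subseteq> T \<and>
         (\<forall>s\<in>T. Poly_Mapping.lookup f s \<in> global_sections (m s))}"

definition base_constants :: "(nat ^ 'r \<Rightarrow>\<^sub>0 'a::idom fract) set" where
  "base_constants = range (\<lambda>a. Poly_Mapping.single 0 (to_fract a))"

end

theory Submission
  imports Defs
begin

text \<open>
  Fix a point \<open>P\<close> and let \<open>D s\<close> be the limit of \<open>m (\<kappa> s) P / \<kappa>\<close>.  By superadditivity \<open>D\<close> is
  superadditive, homogeneous and at least \<open>m s P\<close>; saturation, applied to \<open>s = (1 / \<kappa>) (\<kappa> s)\<close>, gives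
  \<open>D s + F P \<le> m s P\<close>.  As \<open>F P > - 1\<close>, the integer \<open>m s P\<close> is the round-down of \<open>D s\<close>, and the
  fractional part of \<open>D s\<close> stays away from \<open>1\<close>.

  This last property makes \<open>D\<close> piecewise linear.  A lattice point \<open>x\<close> in the interior of the cone is
  an order unit of \<open>S\<close>.  Directional derivatives, first at \<open>x\<close> and then along the generators of \<open>S\<close>,
  turn \<open>D\<close> into an additive function \<open>l \<ge> D\<close> with \<open>l x = D x\<close>
  (\<open>supporting_additive_function\<close>).  On a finite set, \<open>l\<close> is up to a common shift a limit of values
  of \<open>D\<close>; hence for a generator \<open>e\<close> any initial part of the progression \<open>0, l e, 2 * l e, \<dots>\<close>,
  suitably shifted, avoids modulo \<open>1\<close> an arc of any given length below \<open>1 + F P\<close>, and this bounds the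
  denominator of \<open>l e\<close> independently of \<open>x\<close> (\<open>almost_integral_progression\<close>).  The values of all these
  \<open>l\<close> on the generators are thus rational with a common denominator and bounded below by \<open>D\<close>, so by
  Dickson's lemma finitely many minimal ones suffice: for order units \<open>s\<close> the condition \<open>n \<le> m s P\<close> is
  equivalent to finitely many rational linear inequalities in \<open>(n, s)\<close>
  (\<open>bounded_saturated_majorants\<close>).

  Hence the pairs \<open>(s, N)\<close> with \<open>s \<in> C \<inter> S\<close> and \<open>N \<le> m s\<close> an integral divisor supported on the fixed
  finite set of points form a monoid cut out by linear inequalities, and such a monoid is finitely
  generated (\<open>gordan\<close>).  Sections of divisors on a smooth affine curve are invertible fractional ideals
  of the coordinate ring, so \<open>H\<^sup>0(N + N')\<close> is spanned by the products of a finite set of generators of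
  \<open>H\<^sup>0(N)\<close> with elements of \<open>H\<^sup>0(N')\<close> (\<open>global_sections_generators\<close>).  Consequently the generators of
  \<open>H\<^sup>0(N)\<close>, placed in degree \<open>s\<close>, for the finitely many generators \<open>(s, N)\<close> of the monoid, generate the
  algebra of sections.

  The commutative algebra behind this is proved directly: the coordinate ring is Noetherian by
  Hilbert's basis theorem, and in a normal Noetherian domain of dimension one every maximal ideal is
  locally generated by one element, which yields orders of vanishing and invertibility.
\<close>

section \<open>Finitely generated monoids of lattice points\<close>

lemma monotone_subsequence_on_finite:
  fixes f :: "nat \<Rightarrow> 'i \<Rightarrow> nat"
  assumes "finite I"
  shows "\<exists>\<phi> :: nat \<Rightarrow> nat. strict_mono \<phi> \<and> (\<forall>i\<in>I. mono (\<lambda>n. f (\<phi> n) i))"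
  using assms
proof (induction I)
  case empty
  show ?case by (intro exI[of _ id]) (simp add: strict_mono_def)
next
  case (insert i I)
  then obtain \<phi> :: "nat \<Rightarrow> nat" where \<phi>: "strict_mono \<phi>" "\<forall>i\<in>I. mono (\<lambda>n. f (\<phi> n) i)" by blast
  obtain g where g: "strict_mono g" "monoseq (\<lambda>n. f (\<phi> (g n)) i)"
    using seq_monosub[of "\<lambda>n. f (\<phi> n) i"] by auto
  obtain n0 where n0: "\<And>n. f (\<phi> (g n0)) i \<le> f (\<phi> (g n)) i"
    using ex_has_least_nat[of "\<lambda>_. True" 0 "\<lambda>n. f (\<phi> (g n)) i"] by auto
  define \<psi> where "\<psi> n = \<phi> (g (n0 + n))" for n
  have g_le: "g a \<le> g b" if "a \<le> b" for a b
    using g(1) that by (simp add: strict_mono_less_eq)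
  have sm: "strict_mono \<psi>"
    using \<phi>(1) g(1) by (auto simp: strict_mono_def \<psi>_def)
  have old: "mono (\<lambda>n. f (\<psi> n) j)" if "j \<in> I" for j
  proof (rule monoI)
    fix a b :: nat assume "a \<le> b"
    then show "f (\<psi> a) j \<le> f (\<psi> b) j"
      unfolding \<psi>_def using \<phi>(2) that g_le by (simp add: mono_def)
  qed
  \<comment> \<open>A decreasing sequence of naturals is constant once it has reached its least value.\<close>
  have new: "mono (\<lambda>n. f (\<psi> n) i)"
  proof (rule monoI)
    fix a b :: nat assume ab: "a \<le> b"
    from g(2) show "f (\<psi> a) i \<le> f (\<psi> b) i"
      unfolding monoseq_def
    proof
      assume "\<forall>m. \<forall>n\<ge>m. f (\<phi> (g m)) i \<le> f (\<phi> (g n)) i"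
      then show ?thesis using ab by (simp add: \<psi>_def)
    next
      assume "\<forall>m. \<forall>n\<ge>m. f (\<phi> (g n)) i \<le> f (\<phi> (g m)) i"
      then have "f (\<phi> (g (n0 + a))) i \<le> f (\<phi> (g n0)) i" by simp
      then show ?thesis using n0[of "n0 + b"] by (simp add: \<psi>_def)
    qed
  qed
  show ?case using sm old new by blast
qed

text \<open>
  If no finite \<open>B\<close> worked, one could choose successively elements of \<open>A\<close> that lie above none of the
  earlier ones; a subsequence along which every coordinate increases contradicts this.
\<close>

lemma dickson:
  fixes val :: "'x \<Rightarrow> 'i \<Rightarrow> nat"
  assumes "finite I"
  shows "\<exists>B. finite B \<and> B \<subseteq> A \<and> (\<forall>x\<in>A. \<exists>b\<in>B. \<forall>i\<in>I. val b i \<le> val x i)"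
proof (rule ccontr)
  assume neg: "\<not> ?thesis"
  have "\<exists>x. x \<in> A \<and> (\<forall>b\<in>B. \<exists>i\<in>I. val x i < val b i)" if "finite B" "B \<subseteq> A" for B
  proof (rule ccontr)
    assume "\<not> ?thesis"
    then have "\<forall>x\<in>A. \<exists>b\<in>B. \<forall>i\<in>I. val b i \<le> val x i" by (auto simp: not_less)
    then show False using neg that by blast
  qed
  then obtain pick where pick:
    "\<And>B. finite B \<Longrightarrow> B \<subseteq> A \<Longrightarrow> pick B \<in> A \<and> (\<forall>b\<in>B. \<exists>i\<in>I. val (pick B) i < val b i)"
    by metis
  define L where "L = rec_nat {} (\<lambda>_ X. insert (pick X) X)"
  have L: "L 0 = {}" "L (Suc n) = insert (pick (L n)) (L n)" for n by (simp_all add: L_def)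
  have LA: "finite (L n) \<and> L n \<subseteq> A" for n
    by (induction n) (auto simp: L pick)
  have mem: "i < n \<Longrightarrow> pick (L i) \<in> L n" for i n
    by (induction n) (auto simp: L less_Suc_eq)
  obtain \<phi> :: "nat \<Rightarrow> nat" where \<phi>: "strict_mono \<phi>" "\<forall>i\<in>I. mono (\<lambda>n. val (pick (L (\<phi> n))) i)"
    using monotone_subsequence_on_finite[OF assms, of "\<lambda>n. val (pick (L n))"] by blast
  have "\<phi> 0 < \<phi> 1" using \<phi>(1) by (simp add: strict_mono_def)
  then have "pick (L (\<phi> 0)) \<in> L (\<phi> 1)" by (rule mem)
  then have "\<exists>i\<in>I. val (pick (L (\<phi> 1))) i < val (pick (L (\<phi> 0))) i"
    using pick[of "L (\<phi> 1)"] LA[of "\<phi> 1"] by simp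
  moreover have "\<forall>i\<in>I. val (pick (L (\<phi> 0))) i \<le> val (pick (L (\<phi> 1))) i"
    using \<phi>(2) by (simp add: mono_def)
  ultimately show False by fastforce
qed

lemma common_denominator:
  fixes Q :: "rat set"
  assumes "finite Q"
  shows "\<exists>N::nat. N > 0 \<and> (\<forall>q\<in>Q. of_nat N * q \<in> \<int>)"
  using assms
proof (induction Q)
  case empty
  show ?case by (intro exI[of _ 1]) auto
next
  case (insert q Q)
  then obtain N :: nat where N: "N > 0" "\<forall>q\<in>Q. of_nat N * q \<in> \<int>" by blast
  obtain a b where ab: "q = Rat.Fract a b" "b > 0"
    by (cases q) auto
  define k where "k = nat b"
  have k: "k > 0" "of_nat k = (of_int b :: rat)" using ab by (auto simp: k_def)
  have "of_nat (k * N) * q = of_int (int N * a)"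
    using ab k by (simp add: Fract_of_int_quotient)
  moreover have "of_nat (k * N) * q' \<in> \<int>" if "q' \<in> Q" for q'
  proof -
    have "of_nat k * (of_nat N * q') \<in> \<int>" using N that by (intro Ints_mult[of "of_nat k"]) auto
    then show ?thesis by (simp add: mult.assoc)
  qed
  ultimately have "\<forall>q\<in>insert q Q. of_nat (k * N) * q \<in> \<int>" by (metis Ints_of_int insert_iff)
  then show ?case using k N by (intro exI[of _ "k * N"]) auto
qed

inductive_set monoid_gen :: "('i \<Rightarrow> nat) set \<Rightarrow> ('i \<Rightarrow> nat) set" for B where
  zero: "(\<lambda>_. 0) \<in> monoid_gen B"
| add: "b \<in> B \<Longrightarrow> f \<in> monoid_gen B \<Longrightarrow> (\<lambda>i. b i + f i) \<in> monoid_gen B"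

text \<open>
  Solutions vanish outside \<open>I\<close>, so that two of them are equal as soon as they agree on \<open>I\<close>.
\<close>

definition nat_solutions :: "'i set \<Rightarrow> ('i \<Rightarrow> rat) set \<Rightarrow> ('i \<Rightarrow> nat) set" where
  "nat_solutions I W =
     {f. (\<forall>i. i \<notin> I \<longrightarrow> f i = 0) \<and> (\<forall>w\<in>W. 0 \<le> (\<Sum>i\<in>I. w i * of_nat (f i)))}"

text \<open>
  The slack of an inequality, scaled to be an integer, serves as one more coordinate: if \<open>b\<close> lies below
  \<open>f\<close> in all coordinates and all slacks, then \<open>f - b\<close> is again a solution.  So the solutions that are
  minimal among the nonzero ones, of which Dickson's lemma leaves finitely many, generate.
\<close>

lemma gordan:
  fixes I :: "'i set" and W :: "('i \<Rightarrow> rat) set"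
  assumes I: "finite I" and W: "finite W"
  shows "\<exists>B. finite B \<and> B \<subseteq> nat_solutions I W \<and> nat_solutions I W \<subseteq> monoid_gen B"
proof -
  obtain N :: nat where N: "N > 0" "\<forall>q\<in>(\<lambda>(w, i). w i) ` (W \<times> I). of_nat N * q \<in> \<int>"
    using common_denominator[of "(\<lambda>(w, i). w i) ` (W \<times> I)"] I W by auto
  define slack where "slack w f = (\<Sum>i\<in>I. w i * of_nat (f i))" for w :: "'i \<Rightarrow> rat" and f :: "'i \<Rightarrow> nat"
  define z where "z w f = \<lfloor>of_nat N * slack w f\<rfloor>" for w f
  have slack_int: "of_nat N * slack w f = of_int (z w f)" if "w \<in> W" for w f
  proof -
    have "of_nat N * slack w f = (\<Sum>i\<in>I. (of_nat N * w i) * of_nat (f i))"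
      by (simp add: slack_def sum_distrib_left mult.assoc)
    also have "\<dots> \<in> \<int>"
    proof (intro Ints_sum)
      fix i assume "i \<in> I"
      then have "of_nat N * w i \<in> \<int>" using N(2) that by force
      then show "of_nat N * w i * of_nat (f i) \<in> \<int>" by simp
    qed
    finally show ?thesis unfolding z_def by (metis Ints_cases floor_of_int)
  qed
  have z_pos: "0 \<le> z w f \<longleftrightarrow> 0 \<le> slack w f" if "w \<in> W" for w f
  proof -
    have "0 \<le> z w f \<longleftrightarrow> 0 \<le> of_nat N * slack w f" unfolding slack_int[OF that] by simp
    also have "\<dots> \<longleftrightarrow> 0 \<le> slack w f" using N by (simp add: zero_le_mult_iff)
    finally show ?thesis .
  qed
  define val where "val f j = (case j of Inl i \<Rightarrow> f i | Inr w \<Rightarrow> nat (z w f))"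
    for f and j :: "'i + ('i \<Rightarrow> rat)"
  obtain B where B: "finite B" "B \<subseteq> nat_solutions I W - {\<lambda>_. 0}"
    "\<forall>f\<in>nat_solutions I W - {\<lambda>_. 0}. \<exists>b\<in>B. \<forall>j\<in>I <+> W. val b j \<le> val f j"
    using dickson[OF finite_Plus[OF I W], of "nat_solutions I W - {\<lambda>_. 0}" val]
    by (elim exE conjE) (rule that)
  have "f \<in> monoid_gen B" if "f \<in> nat_solutions I W" for f
    using that
  proof (induction "\<Sum>i\<in>I. f i" arbitrary: f rule: less_induct)
    case less
    show ?case
    proof (cases "f = (\<lambda>_. 0)")
      case True
      then show ?thesis by (simp add: monoid_gen.zero)
    next
      case False
      then obtain b where b: "b \<in> B" "\<forall>j\<in>I <+> W. val b j \<le> val f j"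
        using B(3) less.prems by blast
      have bsol: "b \<in> nat_solutions I W" "b \<noteq> (\<lambda>_. 0)" using b B by auto
      have le: "b i \<le> f i" for i
      proof (cases "i \<in> I")
        case True
        then show ?thesis using b(2)[rule_format, of "Inl i"] by (simp add: val_def InlI)
      next
        case False
        then show ?thesis using bsol by (simp add: nat_solutions_def)
      qed
      define g where "g i = f i - b i" for i
      have fg: "f = (\<lambda>i. b i + g i)" using le by (intro ext) (simp add: g_def)
      have "0 \<le> slack w g" if w: "w \<in> W" for w
      proof -
        have "nat (z w b) \<le> nat (z w f)"
          using b(2)[rule_format, of "Inr w"] w by (simp add: val_def InrI)
        moreover have "0 \<le> z w f" "0 \<le> z w b"
          using z_pos[OF w] less.prems bsol w by (auto simp: nat_solutions_def slack_def)
        ultimately have "of_nat N * slack w b \<le> of_nat N * slack w f"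
          by (simp add: slack_int[OF w])
        then have "slack w b \<le> slack w f" using N by simp
        moreover have "slack w f = slack w b + slack w g"
          by (simp add: slack_def fg algebra_simps sum.distrib)
        ultimately show ?thesis by simp
      qed
      moreover have "g i = 0" if "i \<notin> I" for i
        using less.prems that by (simp add: nat_solutions_def g_def)
      ultimately have gsol: "g \<in> nat_solutions I W"
        by (simp add: nat_solutions_def slack_def)
      obtain i0 where i0: "b i0 \<noteq> 0" using bsol(2) by auto
      then have "i0 \<in> I" using bsol(1) by (auto simp: nat_solutions_def)
      then have "(\<Sum>i\<in>I. g i) < (\<Sum>i\<in>I. b i + g i)"
        using i0 I by (intro sum_strict_mono_ex1) (auto intro!: bexI[of _ i0])
      then have "(\<Sum>i\<in>I. g i) < (\<Sum>i\<in>I. f i)" by (simp add: fg)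
      then have "g \<in> monoid_gen B" using less.hyps gsol by blast
      then show ?thesis unfolding fg using b(1) by (intro monoid_gen.add)
    qed
  qed
  then have "nat_solutions I W \<subseteq> monoid_gen B" by (rule subsetI)
  moreover have "B \<subseteq> nat_solutions I W" using B(2) by (rule order_trans) (rule Diff_subset)
  ultimately show ?thesis using B(1) by (intro exI[of _ B] conjI)
qed

section \<open>Cones over ordered fields\<close>

definition rat_dot :: "('r::finite \<Rightarrow> rat) \<Rightarrow> ('r \<Rightarrow> 'f::linordered_field) \<Rightarrow> 'f" where
  "rat_dot a x = (\<Sum>i\<in>UNIV. of_rat (a i) * x i)"

text \<open>
  Membership in a finitely generated cone, split so that one generator at a time can be eliminated.
\<close>

fun in_cone :: "('r \<Rightarrow> rat) list \<Rightarrow> ('r \<Rightarrow> 'f::linordered_field) \<Rightarrow> bool" where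
  "in_cone [] x \<longleftrightarrow> (\<forall>i. x i = 0)"
| "in_cone (v # V) x \<longleftrightarrow> (\<exists>t\<ge>0. in_cone V (\<lambda>i. x i - t * of_rat (v i)))"

text \<open>
  Fourier-Motzkin elimination of the multiplier of the first generator.  The result does not mention the
  field over which the cone is taken.
\<close>

fun cone_inequalities :: "('r::finite \<Rightarrow> rat) list \<Rightarrow> ('r \<Rightarrow> rat) set" where
  "cone_inequalities [] = (\<Union>i. {(\<lambda>j. if j = i then 1 else 0), (\<lambda>j. if j = i then - 1 else 0)})"
| "cone_inequalities (v # V) =
     {a \<in> cone_inequalities V. rat_dot a v \<ge> 0} \<union>
     (\<lambda>(a, b). (\<lambda>i. rat_dot a v * b i - rat_dot b v * a i)) `
       ({a \<in> cone_inequalities V. rat_dot a v > 0} \<times> {b \<in> cone_inequalities V. rat_dot b v < 0})"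

lemma finite_cone_inequalities: "finite (cone_inequalities V)"
  by (induction V) auto

lemma rat_dot_of_rat: "rat_dot a (\<lambda>i. of_rat (v i)) = of_rat (rat_dot a v)"
  by (simp add: rat_dot_def of_rat_sum of_rat_mult)

lemma rat_dot_diff:
  "rat_dot a (\<lambda>i. x i - t * of_rat (v i)) = rat_dot a x - t * of_rat (rat_dot a v)"
  by (simp add: rat_dot_def of_rat_sum of_rat_mult algebra_simps sum_subtractf sum_distrib_left)

lemma rat_dot_combination:
  "rat_dot (\<lambda>i. c * b i - d * a i) x = of_rat c * rat_dot b x - of_rat d * rat_dot a x"
  by (simp add: rat_dot_def of_rat_diff of_rat_mult algebra_simps sum_subtractf sum_distrib_left)

text \<open>
  Because the inequalities are the same over every ordered field, a rational vector that is a real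
  nonnegative combination of \<open>V\<close> is also a rational one.
\<close>

lemma in_cone_iff:
  fixes x :: "'r::finite \<Rightarrow> 'f::linordered_field"
  shows "in_cone V x \<longleftrightarrow> (\<forall>a\<in>cone_inequalities V. 0 \<le> rat_dot a x)"
proof (induction V arbitrary: x)
  case Nil
  have "rat_dot (\<lambda>j. if j = i then 1 else 0) x = x i"
       "rat_dot (\<lambda>j. if j = i then - 1 else 0) x = - x i" for i
    by (simp_all add: rat_dot_def if_distrib[of of_rat] of_rat_minus mult_delta_left cong: if_cong)
  then show ?case by (auto simp: order.antisym)
next
  case (Cons v V)
  let ?H = "cone_inequalities V"
  define d :: "('r \<Rightarrow> rat) \<Rightarrow> 'f" where "d a = of_rat (rat_dot a v)" for a
  have dpos: "0 < d a \<longleftrightarrow> 0 < rat_dot a v" "d a < 0 \<longleftrightarrow> rat_dot a v < 0"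
    "0 \<le> d a \<longleftrightarrow> 0 \<le> rat_dot a v" for a
    by (simp_all add: d_def)
  have step: "in_cone (v # V) x \<longleftrightarrow> (\<exists>t\<ge>0. \<forall>a\<in>?H. t * d a \<le> rat_dot a x)"
    using Cons.IH by (auto simp: rat_dot_diff d_def)
  have "(\<exists>t\<ge>0. \<forall>a\<in>?H. t * d a \<le> rat_dot a x) \<longleftrightarrow>
      (\<forall>a\<in>?H. 0 \<le> d a \<longrightarrow> 0 \<le> rat_dot a x) \<and>
      (\<forall>a\<in>?H. \<forall>b\<in>?H. 0 < d a \<longrightarrow> d b < 0 \<longrightarrow> 0 \<le> d a * rat_dot b x - d b * rat_dot a x)"
    (is "?L \<longleftrightarrow> ?R")
  proof
    assume ?L
    then obtain t where t: "t \<ge> 0" "\<And>a. a \<in> ?H \<Longrightarrow> t * d a \<le> rat_dot a x" by blast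
    have "0 \<le> rat_dot a x" if "a \<in> ?H" "0 \<le> d a" for a
      using t(2)[OF that(1)] mult_nonneg_nonneg[OF t(1) that(2)] by linarith
    moreover have "0 \<le> d a * rat_dot b x - d b * rat_dot a x"
      if "a \<in> ?H" "b \<in> ?H" "0 < d a" "d b < 0" for a b
    proof -
      have "d a * (t * d b) \<le> d a * rat_dot b x"
        using t(2)[OF that(2)] that by (intro mult_left_mono) auto
      moreover have "d b * rat_dot a x \<le> d b * (t * d a)"
        using t(2)[OF that(1)] that by (intro mult_left_mono_neg) auto
      ultimately show ?thesis by (simp add: algebra_simps)
    qed
    ultimately show ?R by simp
  next
    assume R: ?R
    \<comment> \<open>The inequalities with \<open>d b < 0\<close> bound \<open>t\<close> from below, those with \<open>0 < d a\<close> from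
      above; the largest lower bound lies under every upper bound.\<close>
    define L where "L = insert 0 ((\<lambda>b. rat_dot b x / d b) ` {b \<in> ?H. d b < 0})"
    have L: "finite L" "L \<noteq> {}" by (simp_all add: L_def finite_cone_inequalities)
    define t where "t = Max L"
    have "t \<in> L" unfolding t_def using L by (rule Max_in)
    have low: "y \<le> t" if "y \<in> L" for y unfolding t_def using L(1) that by (rule Max_ge)
    have t0: "0 \<le> t" using low by (simp add: L_def)
    have "t * d a \<le> rat_dot a x" if a: "a \<in> ?H" for a
    proof (cases "d a" "0 :: 'f" rule: linorder_cases)
      case less
      then have "rat_dot a x / d a \<le> t" using low a by (auto simp: L_def)
      then show ?thesis using less by (simp add: divide_le_eq)
    next
      case equal
      then show ?thesis using R a by auto
    next
      case greater
      from \<open>t \<in> L\<close> consider "t = 0" | b where "b \<in> ?H" "d b < 0" "t = rat_dot b x / d b"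
        by (auto simp: L_def)
      then show ?thesis
      proof cases
        case 1
        then show ?thesis using R a greater by auto
      next
        case (2 b)
        then have "d b * rat_dot a x \<le> d a * rat_dot b x" using R a greater by auto
        then show ?thesis using 2 by (simp add: neg_divide_le_eq mult.commute)
      qed
    qed
    then show ?L using t0 by blast
  qed
  also have "?R \<longleftrightarrow> (\<forall>a\<in>cone_inequalities (v # V). 0 \<le> rat_dot a x)"
    unfolding dpos by (simp add: ball_Un split_beta rat_dot_combination d_def) fastforce
  finally show ?case unfolding step .
qed

lemma in_cone_iff_combination:
  fixes x :: "'r \<Rightarrow> 'f::linordered_field"
  assumes "distinct V"
  shows "in_cone V x \<longleftrightarrow>
    (\<exists>c. (\<forall>v\<in>set V. 0 \<le> c v) \<and> (\<forall>i. x i = (\<Sum>v\<in>set V. c v * of_rat (v i))))"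
  using assms
proof (induction V arbitrary: x)
  case Nil
  then show ?case by simp
next
  case (Cons v V)
  show ?case (is "_ \<longleftrightarrow> ?R")
  proof
    assume "in_cone (v # V) x"
    then obtain t c where t: "t \<ge> 0" and c: "\<forall>v\<in>set V. 0 \<le> c v"
      "\<forall>i. x i - t * of_rat (v i) = (\<Sum>v\<in>set V. c v * of_rat (v i))"
      using Cons by auto
    have "x i = (\<Sum>w\<in>set (v # V). (c(v := t)) w * of_rat (w i))" for i
    proof -
      have "(\<Sum>w\<in>set V. (c(v := t)) w * of_rat (w i)) = (\<Sum>w\<in>set V. c w * of_rat (w i))"
        using Cons.prems by (intro sum.cong) auto
      then show ?thesis using c(2)[rule_format, of i] Cons.prems by simp
    qed
    then show ?R using t c(1) by (intro exI[of _ "c(v := t)"]) auto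
  next
    assume ?R
    then obtain c where c: "\<forall>w\<in>set (v # V). 0 \<le> c w"
      "\<forall>i. x i = (\<Sum>w\<in>set (v # V). c w * of_rat (w i))" by blast
    have "in_cone V (\<lambda>i. x i - c v * of_rat (v i))"
      using Cons c by (auto intro!: exI[of _ c])
    then show "in_cone (v # V) x" using c(1) by auto
  qed
qed

section \<open>Superadditive functions with almost integral values\<close>

abbreviation near_integer :: "real \<Rightarrow> real \<Rightarrow> real \<Rightarrow> bool" where
  "near_integer \<delta> \<epsilon> y \<equiv> \<exists>n::int. of_int n - \<epsilon> \<le> y \<and> y \<le> of_int n + \<delta> + \<epsilon>"

text \<open>
  By Dirichlet some multiple \<open>k * \<theta>\<close> with \<open>k\<close> bounded in terms of \<open>\<delta>\<close> is closer to an integer than the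
  length \<open>1 - \<delta>\<close> of the gaps between the admissible intervals.  Steps that small cannot cross a gap, so
  arbitrarily many of them stay in one interval, and the step must be \<open>0\<close> modulo \<open>1\<close>.
\<close>

lemma almost_integral_progression:
  fixes \<delta> :: real
  assumes "\<delta> < 1"
  shows "\<exists>N::nat. N > 0 \<and> (\<forall>\<theta>::real.
    (\<forall>K::nat. \<forall>\<epsilon>>0. \<exists>c. \<forall>j\<le>K. near_integer \<delta> \<epsilon> (real j * \<theta> + c)) \<longrightarrow>
    real N * \<theta> \<in> \<int>)"
proof -
  obtain M :: nat where M: "M > 0" "1 / real M < 1 - \<delta>"
    using assms by (metis diff_gt_0_iff_gt nat_approx_posE zero_less_Suc)
  have "real (fact M) * \<theta> \<in> \<int>"
    if near: "\<And>K::nat. \<And>\<epsilon>. \<epsilon> > 0 \<Longrightarrow> \<exists>c. \<forall>j\<le>K. near_integer \<delta> \<epsilon> (real j * \<theta> + c)" for \<theta>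
  proof -
    obtain h k' where k': "0 < k'" "k' \<le> int M" "\<bar>of_int k' * \<theta> - of_int h\<bar> < 1 / real M"
      using Dirichlet_approx[OF M(1)] by blast
    define k where "k = nat k'"
    have k: "0 < k" "k \<le> M" "of_int k' = real k" using k' by (simp_all add: k_def)
    define \<tau> where "\<tau> = real k * \<theta> - of_int h"
    have \<tau>: "\<bar>\<tau>\<bar> < 1 - \<delta>" using k'(3) M(2) k(3) by (simp add: \<tau>_def)
    have "\<tau> = 0"
    proof (rule ccontr)
      assume "\<tau> \<noteq> 0"
      then obtain J :: nat where J: "1 < real J * \<bar>\<tau>\<bar>" using ex_less_of_nat_mult[of "\<bar>\<tau>\<bar>" 1] by auto
      define \<epsilon> where "\<epsilon> = (1 - \<delta> - \<bar>\<tau>\<bar>) / 3"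
      have \<epsilon>: "\<epsilon> > 0" "\<bar>\<tau>\<bar> = 1 - \<delta> - 3 * \<epsilon>" using \<tau> by (simp_all add: \<epsilon>_def field_simps)
      obtain c where c: "\<forall>j\<le>J * k. near_integer \<delta> \<epsilon> (real j * \<theta> + c)"
        using near[OF \<epsilon>(1)] by blast
      define y where "y j = real j * \<tau> + c" for j
      have "near_integer \<delta> \<epsilon> (y j)" if j: "j \<le> J" for j
      proof -
        obtain n :: int where n: "of_int n - \<epsilon> \<le> real (j * k) * \<theta> + c" "real (j * k) * \<theta> + c \<le> of_int n + \<delta> + \<epsilon>"
          using c[rule_format, of "j * k"] j by auto
        have "y j = real (j * k) * \<theta> + c - of_int (int j * h)"
          by (simp add: y_def \<tau>_def algebra_simps)
        then show ?thesis using n by (intro exI[of _ "n - int j * h"]) simp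
      qed
      then obtain n :: "nat \<Rightarrow> int" where
        n: "\<And>j. j \<le> J \<Longrightarrow> of_int (n j) - \<epsilon> \<le> y j \<and> y j \<le> of_int (n j) + \<delta> + \<epsilon>" by metis
      \<comment> \<open>A step of size \<open>\<bar>\<tau>\<bar>\<close> is too short to jump over the gap between two admissible
        intervals, so the progression stays in one of them.\<close>
      have "n j = n 0" if "j \<le> J" for j
        using that
      proof (induction j)
        case (Suc j)
        have "y (Suc j) = y j + \<tau>" by (simp add: y_def algebra_simps)
        moreover have "of_int (n (Suc j)) - \<epsilon> \<le> y (Suc j)" "y (Suc j) \<le> of_int (n (Suc j)) + \<delta> + \<epsilon>"
          "of_int (n j) - \<epsilon> \<le> y j" "y j \<le> of_int (n j) + \<delta> + \<epsilon>"
          using n[of j] n[of "Suc j"] Suc.prems by auto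
        ultimately have "real_of_int (n (Suc j)) < of_int (n j) + 1" "real_of_int (n j) < of_int (n (Suc j)) + 1"
          using \<epsilon> by linarith+
        then have "n (Suc j) = n j" by linarith
        then show ?case using Suc by simp
      qed simp
      then have "n J = n 0" by blast
      then have "of_int (n 0) - \<epsilon> \<le> y J" "y J \<le> of_int (n 0) + \<delta> + \<epsilon>"
          "of_int (n 0) - \<epsilon> \<le> y 0" "y 0 \<le> of_int (n 0) + \<delta> + \<epsilon>"
        using n[of J] n[of 0] by simp_all
      then have "\<bar>y J - y 0\<bar> < 1" using \<epsilon> by linarith
      moreover have "y J - y 0 = real J * \<tau>" by (simp add: y_def)
      ultimately show False using J by (simp add: abs_mult)
    qed
    then have \<theta>: "real k * \<theta> = of_int h" by (simp add: \<tau>_def)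
    obtain r where r: "fact M = k * r" using dvd_fact[of k M] k by (auto simp: dvd_def)
    have "real (fact M) * \<theta> = real r * (real k * \<theta>)" unfolding r by simp
    also have "\<dots> = of_int (int r * h)" unfolding \<theta> by simp
    finally show ?thesis by (metis Ints_of_int)
  qed
  then show ?thesis by (intro exI[of _ "fact M"]) (simp add: fact_gt_zero)
qed

definition additive_submonoid :: "(nat ^ 'r) set \<Rightarrow> bool" where
  "additive_submonoid S \<longleftrightarrow> 0 \<in> S \<and> (\<forall>s\<in>S. \<forall>t\<in>S. s + t \<in> S)"

lemma additive_submonoid_smult:
  assumes "additive_submonoid S" "s \<in> S"
  shows "(k::nat) *s s \<in> S"
proof (induction k)
  case 0
  then show ?case using assms by (simp add: additive_submonoid_def)
next
  case (Suc k)
  have "Suc k *s s = s + k *s s" by (simp add: vec_eq_iff)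
  then show ?case using Suc assms by (simp add: additive_submonoid_def)
qed

lemma additive_submonoid_nat_span: "additive_submonoid (nat_span E)"
  unfolding additive_submonoid_def
proof (intro conjI ballI)
  show "0 \<in> nat_span E"
    unfolding nat_span_def
    by (intro CollectI exI[of _ "\<lambda>_. 0"] conjI TrueI) (simp add: vec_eq_iff)
next
  fix s t assume "s \<in> nat_span E" "t \<in> nat_span E"
  then obtain c d where "s = (\<Sum>e\<in>E. c e *s e)" "t = (\<Sum>e\<in>E. d e *s e)"
    unfolding nat_span_def by blast
  then have "s + t = (\<Sum>e\<in>E. (c e + d e) *s e)"
    by (simp add: vector_sadd_rdistrib sum.distrib)
  then show "s + t \<in> nat_span E"
    unfolding nat_span_def by (intro CollectI exI[of _ "\<lambda>e. c e + d e"] conjI TrueI)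
qed

lemma generator_in_nat_span:
  assumes "finite E" "e \<in> E"
  shows "e \<in> nat_span E"
proof -
  have "(\<Sum>f\<in>E. (if f = e then 1 else 0 :: nat) *s f) = (\<Sum>f\<in>E. if f = e then e else 0)"
    by (intro sum.cong) (auto simp: vec_eq_iff)
  also have "\<dots> = e" using assms by simp
  finally have *: "(\<Sum>f\<in>E. (if f = e then 1 else 0 :: nat) *s f) = e" .
  show ?thesis unfolding nat_span_def by (intro CollectI exI conjI TrueI) (rule *[symmetric])
qed

definition superlinear_on :: "(nat ^ 'r) set \<Rightarrow> (nat ^ 'r \<Rightarrow> real) \<Rightarrow> bool" where
  "superlinear_on S h \<longleftrightarrow> (\<forall>s\<in>S. \<forall>t\<in>S. h s + h t \<le> h (s + t)) \<and>
     (\<forall>s\<in>S. \<forall>k::nat. h (k *s s) = real k * h s)"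

text \<open>
  The shift \<open>c\<close> may depend on the finite set \<open>A\<close> and on \<open>\<epsilon>\<close>; this is what lets the property pass to
  directional derivatives.
\<close>

definition almost_integral_on :: "(nat ^ 'r) set \<Rightarrow> real \<Rightarrow> (nat ^ 'r \<Rightarrow> real) \<Rightarrow> bool" where
  "almost_integral_on S \<delta> h \<longleftrightarrow> (\<forall>A \<epsilon>. finite A \<and> A \<subseteq> S \<and> \<epsilon> > 0 \<longrightarrow>
     (\<exists>c. \<forall>s\<in>A. near_integer \<delta> \<epsilon> (h s + c)))"

definition additive_along :: "(nat ^ 'r) set \<Rightarrow> (nat ^ 'r \<Rightarrow> real) \<Rightarrow> nat ^ 'r \<Rightarrow> bool" where
  "additive_along S h w \<longleftrightarrow> (\<forall>s\<in>S. h (s + w) = h s + h w)"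

text \<open>
  This is the algebraic form in which interior points of the cone are used.
\<close>

definition order_unit :: "(nat ^ 'r) set \<Rightarrow> nat ^ 'r \<Rightarrow> bool" where
  "order_unit S x \<longleftrightarrow> x \<in> S \<and> (\<forall>t\<in>S. \<exists>q::nat. \<exists>s\<in>S. q *s x = t + s)"

lemma additive_along_smult:
  assumes "additive_submonoid S" "additive_along S h w" "w \<in> S" "s \<in> S"
  shows "h (s + (k::nat) *s w) = h s + real k * h w"
proof (induction k)
  case 0
  have "s + (0::nat) *s w = s" by (simp add: vec_eq_iff)
  then show ?case by simp
next
  case (Suc k)
  have "s + Suc k *s w = (s + k *s w) + w" by (simp add: vec_eq_iff)
  moreover have "s + k *s w \<in> S"
    using assms additive_submonoid_smult[OF assms(1,3)] by (simp add: additive_submonoid_def)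
  ultimately have "h (s + Suc k *s w) = h (s + k *s w) + h w"
    using assms(2) by (simp add: additive_along_def)
  then show ?case using Suc by (simp add: algebra_simps)
qed

text \<open>
  The differences \<open>h (q w + s) - q h w\<close> increase with \<open>q\<close> by superadditivity, so being bounded they have a
  limit \<open>h' s\<close>, which is additive along \<open>w\<close>.  On a finite set \<open>h'\<close> is close to values of \<open>h\<close> moved by the
  common shift \<open>q h w\<close>, so almost integrality is inherited.
\<close>

lemma directional_derivative:
  assumes S: "additive_submonoid S" and h: "superlinear_on S h" "almost_integral_on S \<delta> h"
    and w: "w \<in> S"
    and bdd: "\<And>s. s \<in> S \<Longrightarrow> \<exists>B. \<forall>q::nat. h (q *s w + s) - real q * h w \<le> B"
  shows "\<exists>h'. superlinear_on S h' \<and> almost_integral_on S \<delta> h' \<and> (\<forall>s\<in>S. h s \<le> h' s) \<and>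
    h' w = h w \<and> additive_along S h' w \<and>
    (\<forall>u\<in>S. additive_along S h u \<longrightarrow> additive_along S h' u \<and> h' u = h u)"
proof -
  define d where "d s q = h (q *s w + s) - real q * h w" for s and q :: nat
  have add_in: "s + t \<in> S" if "s \<in> S" "t \<in> S" for s t
    using S that by (simp add: additive_submonoid_def)
  have qw: "q *s w \<in> S" for q :: nat using additive_submonoid_smult[OF S w] .
  have super: "h s + h t \<le> h (s + t)" if "s \<in> S" "t \<in> S" for s t
    using h(1) that by (simp add: superlinear_on_def)
  have homog: "h (k *s s) = real k * h s" if "s \<in> S" for k :: nat and s
    using h(1) that by (simp add: superlinear_on_def)
  have Suc_smult: "Suc q *s w + s = w + (q *s w + s)" for q s by (simp add: vec_eq_iff)
  have inc: "incseq (d s)" if s: "s \<in> S" for s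
  proof (rule incseq_SucI)
    fix q
    have "h w + h (q *s w + s) \<le> h (Suc q *s w + s)"
      unfolding Suc_smult using s w qw by (intro super add_in)
    then show "d s q \<le> d s (Suc q)" by (simp add: d_def algebra_simps)
  qed
  have "\<exists>L. d s \<longlonglongrightarrow> L \<and> (\<forall>q. d s q \<le> L)" if s: "s \<in> S" for s
    using incseq_convergent[OF inc[OF s]] bdd[OF s] unfolding d_def by blast
  then obtain h' where h': "\<And>s. s \<in> S \<Longrightarrow> d s \<longlonglongrightarrow> h' s" "\<And>s q. s \<in> S \<Longrightarrow> d s q \<le> h' s"
    by metis
  have super': "h' s + h' t \<le> h' (s + t)" if st: "s \<in> S" "t \<in> S" for s t
  proof (rule LIMSEQ_le_const2)
    show "(\<lambda>q. d s q + d t q) \<longlonglongrightarrow> h' s + h' t" using h'(1) st by (intro tendsto_add)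
    have "d s q + d t q \<le> h' (s + t)" for q
    proof -
      have eq: "(2 * q) *s w + (s + t) = (q *s w + s) + (q *s w + t)"
        by (simp add: vec_eq_iff algebra_simps)
      have "h (q *s w + s) + h (q *s w + t) \<le> h ((2 * q) *s w + (s + t))"
        unfolding eq using st qw by (intro super add_in)
      then have "d s q + d t q \<le> d (s + t) (2 * q)" by (simp add: d_def algebra_simps)
      also have "\<dots> \<le> h' (s + t)" using h'(2) st add_in by blast
      finally show ?thesis .
    qed
    then show "\<exists>N. \<forall>q\<ge>N. d s q + d t q \<le> h' (s + t)" by blast
  qed
  have homog': "h' (k *s s) = real k * h' s" if s: "s \<in> S" for k :: nat and s
  proof (cases "k = 0")
    case True
    have "d 0 = (\<lambda>_. 0)" using homog[OF w] by (intro ext) (simp add: d_def)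
    then have "d 0 \<longlonglongrightarrow> 0" by simp
    moreover have "0 *s s = 0" for s :: "nat ^ 'a" by (simp add: vec_eq_iff)
    ultimately show ?thesis using True h'(1)[of 0] S LIMSEQ_unique
      by (fastforce simp: additive_submonoid_def)
  next
    case False
    have ks: "k *s s \<in> S" using additive_submonoid_smult[OF S s] .
    have "strict_mono (\<lambda>q. k * q)" using False by (simp add: strict_mono_def)
    from LIMSEQ_subseq_LIMSEQ[OF h'(1)[OF ks] this]
    have "(\<lambda>q. d (k *s s) (k * q)) \<longlonglongrightarrow> h' (k *s s)" by (simp add: o_def)
    moreover have "d (k *s s) (k * q) = real k * d s q" for q
    proof -
      have "(k * q) *s w + k *s s = k *s (q *s w + s)" by (simp add: vec_eq_iff algebra_simps)
      then show ?thesis using homog[OF add_in[OF qw s]] by (simp add: d_def algebra_simps)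
    qed
    ultimately have "(\<lambda>q. real k * d s q) \<longlonglongrightarrow> h' (k *s s)" by simp
    moreover have "(\<lambda>q. real k * d s q) \<longlonglongrightarrow> real k * h' s"
      using h'(1)[OF s] by (intro tendsto_mult_left)
    ultimately show ?thesis by (rule LIMSEQ_unique)
  qed
  have integral': "almost_integral_on S \<delta> h'"
    unfolding almost_integral_on_def
  proof (intro allI impI, elim conjE)
    fix A and \<epsilon> :: real assume A: "finite A" "A \<subseteq> S" and \<epsilon>: "\<epsilon> > 0"
    have "\<forall>\<^sub>F q in sequentially. \<forall>s\<in>A. dist (d s q) (h' s) < \<epsilon> / 2"
    proof (intro eventually_ball_finite ballI)
      fix s assume "s \<in> A"
      then show "\<forall>\<^sub>F q in sequentially. dist (d s q) (h' s) < \<epsilon> / 2"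
        using A \<epsilon> by (intro tendstoD[OF h'(1)]) auto
    qed (rule A(1))
    then obtain q where q: "\<forall>s\<in>A. \<bar>d s q - h' s\<bar> < \<epsilon> / 2"
      by (auto simp: eventually_sequentially dist_real_def)
    have "finite ((\<lambda>s. q *s w + s) ` A) \<and> (\<lambda>s. q *s w + s) ` A \<subseteq> S \<and> \<epsilon> / 2 > 0"
      using A \<epsilon> add_in qw by auto
    then obtain c where c: "\<forall>s\<in>(\<lambda>s. q *s w + s) ` A. near_integer \<delta> (\<epsilon> / 2) (h s + c)"
      using h(2) unfolding almost_integral_on_def by meson
    show "\<exists>c. \<forall>s\<in>A. near_integer \<delta> \<epsilon> (h' s + c)"
    proof (intro exI[of _ "c + real q * h w"] ballI)
      fix s assume s: "s \<in> A"
      obtain n :: int where "of_int n - \<epsilon> / 2 \<le> h (q *s w + s) + c" "h (q *s w + s) + c \<le> of_int n + \<delta> + \<epsilon> / 2"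
        using c s by auto
      moreover have "h (q *s w + s) = d s q + real q * h w" by (simp add: d_def)
      moreover have "\<bar>d s q - h' s\<bar> < \<epsilon> / 2" using q s by blast
      ultimately show "near_integer \<delta> \<epsilon> (h' s + (c + real q * h w))"
        by (intro exI[of _ n]) linarith
    qed
  qed
  have le': "h s \<le> h' s" if s: "s \<in> S" for s
  proof -
    have "d s 0 = h s" by (simp add: d_def vec_eq_iff)
    then show ?thesis using h'(2)[OF s, of 0] by simp
  qed
  have const: "h' s = c" if "s \<in> S" "\<And>q. d s q = c" for s c
  proof -
    have "d s = (\<lambda>_. c)" using that(2) by (intro ext)
    then show ?thesis using LIMSEQ_unique[OF h'(1)[OF that(1)], of c] by simp
  qed
  have w': "h' w = h w"
  proof (rule const[OF w])
    fix q
    have "q *s w + w = Suc q *s w" by (simp add: vec_eq_iff)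
    then show "d w q = h w" using homog[OF w, of "Suc q"] by (simp add: d_def algebra_simps)
  qed
  have along_w: "h' (s + w) = h' s + h' w" if s: "s \<in> S" for s
  proof (rule LIMSEQ_unique)
    show "d (s + w) \<longlonglongrightarrow> h' (s + w)" using h'(1) s w add_in by blast
    have "(\<lambda>q. d s (Suc q) + h w) \<longlonglongrightarrow> h' s + h w"
      by (rule tendsto_add[OF LIMSEQ_Suc[OF h'(1)[OF s]] tendsto_const])
    moreover have "(\<lambda>q. d s (Suc q) + h w) = d (s + w)"
    proof
      fix q
      have "Suc q *s w + s = q *s w + (s + w)" by (simp add: vec_eq_iff)
      then show "d s (Suc q) + h w = d (s + w) q" by (simp add: d_def algebra_simps)
    qed
    ultimately show "d (s + w) \<longlonglongrightarrow> h' s + h' w" unfolding w' by simp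
  qed
  have along_u: "additive_along S h' u \<and> h' u = h u" if u: "u \<in> S" "additive_along S h u" for u
  proof -
    have hu: "h (s + u) = h s + h u" if "s \<in> S" for s using u that by (simp add: additive_along_def)
    have u': "h' u = h u"
      using u(1) by (rule const) (simp add: d_def hu[OF qw] homog[OF w])
    have "h' (s + u) = h' s + h' u" if s: "s \<in> S" for s
    proof (rule LIMSEQ_unique)
      show "d (s + u) \<longlonglongrightarrow> h' (s + u)" using h'(1) s u(1) add_in by blast
      have "d (s + u) = (\<lambda>q. d s q + h u)"
        using hu[OF add_in[OF qw s]] by (intro ext) (simp add: d_def add.assoc)
      then show "d (s + u) \<longlonglongrightarrow> h' s + h' u"
        unfolding u' using tendsto_add[OF h'(1)[OF s] tendsto_const, of "h u"] by simp
    qed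
    then show ?thesis using u' by (simp add: additive_along_def)
  qed
  show ?thesis
    using super' homog' integral' le' w' along_w along_u
    by (intro exI[of _ h']) (simp add: superlinear_on_def additive_along_def)
qed

text \<open>
  Differentiate at \<open>x\<close> and then along one generator after the other.  The order unit provides the bounds
  needed for the limits to exist: directly in the first step, and afterwards because the function is
  already additive along \<open>x\<close>.
\<close>

lemma supporting_additive_function:
  assumes S: "additive_submonoid S" and D: "superlinear_on S D" "almost_integral_on S \<delta> D"
    and x: "order_unit S x" and "finite E" "E \<subseteq> S"
  shows "\<exists>l. superlinear_on S l \<and> almost_integral_on S \<delta> l \<and> (\<forall>s\<in>S. D s \<le> l s) \<and> l x = D x \<and>
    additive_along S l x \<and> (\<forall>e\<in>E. additive_along S l e)"
  using \<open>finite E\<close> \<open>E \<subseteq> S\<close>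
proof (induction E)
  case empty
  have xS: "x \<in> S" using x by (simp add: order_unit_def)
  have "\<exists>B. \<forall>q::nat. D (q *s x + s) - real q * D x \<le> B" if s: "s \<in> S" for s
  proof -
    obtain p :: nat and t where t: "t \<in> S" "p *s x = s + t" using x s unfolding order_unit_def by blast
    have "D (q *s x + s) - real q * D x \<le> real p * D x - D t" for q :: nat
    proof -
      have "q *s x + s + t = (q + p) *s x" by (simp add: t(2) add.assoc vector_sadd_rdistrib)
      moreover have "D (q *s x + s) + D t \<le> D (q *s x + s + t)"
        using D(1) S s t(1) additive_submonoid_smult[OF S xS]
        by (simp add: superlinear_on_def additive_submonoid_def)
      moreover have "D ((q + p) *s x) = real (q + p) * D x"
        using D(1) xS unfolding superlinear_on_def by blast
      ultimately show ?thesis by (simp add: algebra_simps)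
    qed
    then show ?thesis by blast
  qed
  from directional_derivative[OF S D xS this] show ?case by auto
next
  case (insert e E)
  then obtain l where l: "superlinear_on S l" "almost_integral_on S \<delta> l" "\<forall>s\<in>S. D s \<le> l s"
    "l x = D x" "additive_along S l x" "\<forall>e\<in>E. additive_along S l e" by auto
  have xS: "x \<in> S" using x by (simp add: order_unit_def)
  have eS: "e \<in> S" "E \<subseteq> S" using insert by auto
  have "\<exists>B. \<forall>q::nat. l (q *s e + s) - real q * l e \<le> B" if s: "s \<in> S" for s
  proof -
    obtain p :: nat and t where t: "t \<in> S" "p *s x = s + t" using x s unfolding order_unit_def by blast
    have "l (q *s e + s) - real q * l e \<le> real p * l x - l t" for q :: nat
    proof -
      have qe: "q *s e \<in> S" using additive_submonoid_smult[OF S eS(1)] .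
      have "q *s e + s + t = q *s e + p *s x" by (simp add: t(2) add.assoc)
      moreover have "l (q *s e + s) + l t \<le> l (q *s e + s + t)"
        using l(1) S s t(1) qe by (simp add: superlinear_on_def additive_submonoid_def)
      moreover have "l (q *s e + p *s x) = real q * l e + real p * l x"
        using additive_along_smult[OF S l(5) xS qe] l(1) eS(1) by (simp add: superlinear_on_def)
      ultimately show ?thesis by (simp add: algebra_simps)
    qed
    then show ?thesis by blast
  qed
  from directional_derivative[OF S l(1,2) eS(1) this] obtain l' where l':
    "superlinear_on S l'" "almost_integral_on S \<delta> l'" "\<forall>s\<in>S. l s \<le> l' s" "l' e = l e"
    "additive_along S l' e" "\<forall>u\<in>S. additive_along S l u \<longrightarrow> additive_along S l' u \<and> l' u = l u"
    by auto
  have "\<forall>s\<in>S. D s \<le> l' s" using l(3) l'(3) by (meson order_trans)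
  moreover have "l' x = D x" "additive_along S l' x" using l'(6) l(4,5) xS by auto
  moreover have "\<forall>f\<in>insert e E. additive_along S l' f" using l'(5,6) l(6) eS by auto
  ultimately show ?case using l'(1,2) by blast
qed

lemma additive_on_generators:
  assumes S: "additive_submonoid S" and l: "superlinear_on S l" "\<forall>e\<in>E. additive_along S l e"
    and "finite E" "E \<subseteq> S"
  shows "(\<Sum>e\<in>E. c e *s e) \<in> S \<and> l (\<Sum>e\<in>E. c e *s e) = (\<Sum>e\<in>E. real (c e) * l e)"
  using \<open>finite E\<close> \<open>E \<subseteq> S\<close> l(2)
proof (induction E)
  case empty
  have "0 \<in> S" using S by (simp add: additive_submonoid_def)
  moreover have "(0::nat) *s 0 = (0 :: nat ^ 'a)" by (simp add: vec_eq_iff)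
  then have "l 0 = 0" using l(1) \<open>0 \<in> S\<close> unfolding superlinear_on_def
    by (metis mult_zero_left of_nat_0)
  ultimately show ?case by simp
next
  case (insert e E)
  then have IH: "(\<Sum>e\<in>E. c e *s e) \<in> S" "l (\<Sum>e\<in>E. c e *s e) = (\<Sum>e\<in>E. real (c e) * l e)" by auto
  have "l ((\<Sum>e\<in>E. c e *s e) + c e *s e) = l (\<Sum>e\<in>E. c e *s e) + real (c e) * l e"
    using insert.prems by (intro additive_along_smult[OF S _ _ IH(1)]) auto
  moreover have "c e *s e \<in> S" using insert.prems by (intro additive_submonoid_smult[OF S]) auto
  ultimately show ?case using insert.hyps IH S by (simp add: add.commute additive_submonoid_def)
qed

text \<open>
  The supporting functions have integral multiples \<open>N l\<close> with one common \<open>N\<close> and lie above \<open>D\<close> on the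
  generators, so Dickson's lemma applies to their values there.  A smaller majorant is sharp wherever a
  larger one is, so the minimal ones suffice.
\<close>

lemma finitely_many_linear_majorants:
  fixes E :: "(nat ^ 'r) set"
  assumes E: "finite E" and S: "S = nat_span E"
    and D: "superlinear_on S D" "almost_integral_on S \<delta> D" and \<delta>: "\<delta> < 1"
  shows "\<exists>\<Lambda> :: (nat ^ 'r \<Rightarrow> rat) set. finite \<Lambda> \<and>
    (\<forall>l\<in>\<Lambda>. \<forall>c. D (\<Sum>e\<in>E. c e *s e) \<le> (\<Sum>e\<in>E. real (c e) * of_rat (l e))) \<and>
    (\<forall>c. order_unit S (\<Sum>e\<in>E. c e *s e) \<longrightarrow>
       (\<exists>l\<in>\<Lambda>. D (\<Sum>e\<in>E. c e *s e) = (\<Sum>e\<in>E. real (c e) * of_rat (l e))))"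
proof -
  have Sm: "additive_submonoid S" unfolding S by (rule additive_submonoid_nat_span)
  have ES: "E \<subseteq> S" using generator_in_nat_span[OF E] S by auto
  obtain N :: nat where N: "N > 0" and integral: "\<And>\<theta>::real.
    (\<forall>K::nat. \<forall>\<epsilon>>0. \<exists>c. \<forall>j\<le>K. near_integer \<delta> \<epsilon> (real j * \<theta> + c)) \<Longrightarrow>
    real N * \<theta> \<in> \<int>"
    using almost_integral_progression[OF \<delta>] by blast
  define L :: "(nat ^ 'r \<Rightarrow> real) set" where "L = {l. (\<forall>e\<in>E. real N * l e \<in> \<int>) \<and>
    (\<forall>c. D (\<Sum>e\<in>E. c e *s e) \<le> (\<Sum>e\<in>E. real (c e) * l e))}"
  have support: "\<exists>l\<in>L. D (\<Sum>e\<in>E. c e *s e) = (\<Sum>e\<in>E. real (c e) * l e)"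
    if c: "order_unit S (\<Sum>e\<in>E. c e *s e)" for c
  proof -
    obtain l where l: "superlinear_on S l" "almost_integral_on S \<delta> l" "\<forall>s\<in>S. D s \<le> l s"
      "l (\<Sum>e\<in>E. c e *s e) = D (\<Sum>e\<in>E. c e *s e)" "\<forall>e\<in>E. additive_along S l e"
      using supporting_additive_function[OF Sm D c E ES] by blast
    note lin = additive_on_generators[OF Sm l(1,5) E ES]
    have "real N * l e \<in> \<int>" if e: "e \<in> E" for e
    proof (rule integral, intro allI impI)
      fix K :: nat and \<epsilon> :: real assume "\<epsilon> > 0"
      moreover have eS: "e \<in> S" using e ES by auto
      ultimately have "finite ((\<lambda>j. j *s e) ` {..K}) \<and> (\<lambda>j. j *s e) ` {..K} \<subseteq> S \<and> \<epsilon> > 0"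
        using additive_submonoid_smult[OF Sm eS] by auto
      then obtain a where a: "\<forall>s\<in>(\<lambda>j. j *s e) ` {..K}. near_integer \<delta> \<epsilon> (l s + a)"
        using l(2) unfolding almost_integral_on_def by meson
      moreover have "l (j *s e) = real j * l e" for j :: nat
        using l(1) eS by (simp add: superlinear_on_def)
      ultimately show "\<exists>c. \<forall>j\<le>K. near_integer \<delta> \<epsilon> (real j * l e + c)"
        by (intro exI[of _ a]) auto
    qed
    moreover have "D (\<Sum>e\<in>E. c e *s e) \<le> (\<Sum>e\<in>E. real (c e) * l e)" for c
      using lin[of c] l(3) by metis
    ultimately have "l \<in> L" by (simp add: L_def)
    then show ?thesis using lin l(4) by (intro bexI[of _ l]) auto
  qed
  define val where "val l e = nat (\<lfloor>real N * l e\<rfloor> - \<lfloor>real N * D e\<rfloor>)" for l e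
  obtain B where B: "finite B" "B \<subseteq> L" "\<forall>l\<in>L. \<exists>b\<in>B. \<forall>e\<in>E. val b e \<le> val l e"
    using dickson[OF E, of L val] by blast
  define ratl :: "(nat ^ 'r \<Rightarrow> real) \<Rightarrow> nat ^ 'r \<Rightarrow> rat" where
    "ratl l e = of_int \<lfloor>real N * l e\<rfloor> / of_nat N" for l e
  have floor_eq: "of_int \<lfloor>real N * l e\<rfloor> = real N * l e" if "l \<in> L" "e \<in> E" for l e
    using that by (auto simp: L_def elim!: Ints_cases)
  have ratl: "of_rat (ratl l e) = l e" if "l \<in> L" "e \<in> E" for l e
  proof -
    have "of_rat (ratl l e) = of_int \<lfloor>real N * l e\<rfloor> / real N" by (simp add: ratl_def of_rat_divide)
    also have "\<dots> = l e" unfolding floor_eq[OF that] using N by simp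
    finally show ?thesis .
  qed
  have below: "D e \<le> l e" if "l \<in> L" and e: "e \<in> E" for l e
  proof -
    let ?c = "\<lambda>f. if f = e then 1 else 0 :: nat"
    have "(\<Sum>f\<in>E. ?c f *s f) = (\<Sum>f\<in>E. if f = e then e else 0)"
      by (intro sum.cong) (auto simp: vec_eq_iff)
    also have "\<dots> = e" using e E by simp
    finally have *: "(\<Sum>f\<in>E. ?c f *s f) = e" .
    have "D (\<Sum>f\<in>E. ?c f *s f) \<le> (\<Sum>f\<in>E. real (?c f) * l f)" using that by (simp add: L_def)
    also have "(\<Sum>f\<in>E. real (?c f) * l f) = (\<Sum>f\<in>E. if f = e then l e else 0)"
      by (intro sum.cong) auto
    also have "\<dots> = l e" using e E by simp
    finally show ?thesis unfolding * .
  qed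
  have mono: "b e \<le> l e" if "b \<in> L" "l \<in> L" "e \<in> E" "val b e \<le> val l e" for b l e
  proof -
    have "\<lfloor>real N * D e\<rfloor> \<le> \<lfloor>real N * l e\<rfloor>" "\<lfloor>real N * D e\<rfloor> \<le> \<lfloor>real N * b e\<rfloor>"
      using below that N by (auto intro!: floor_mono mult_left_mono)
    then have "\<lfloor>real N * b e\<rfloor> \<le> \<lfloor>real N * l e\<rfloor>" using that(4) by (simp add: val_def)
    then have "real N * b e \<le> real N * l e"
      using floor_eq that by (metis of_int_le_iff)
    then show ?thesis using N by simp
  qed
  have sum_ratl: "(\<Sum>e\<in>E. real (c e) * of_rat (ratl l e)) = (\<Sum>e\<in>E. real (c e) * l e)" if "l \<in> L" for l c
    using ratl[OF that] by (intro sum.cong) auto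
  show ?thesis
  proof (intro exI[of _ "ratl ` B"] conjI ballI allI impI)
    show "finite (ratl ` B)" using B(1) by simp
  next
    fix l c assume "l \<in> ratl ` B"
    then obtain b where "b \<in> L" "l = ratl b" using B(2) by auto
    then show "D (\<Sum>e\<in>E. c e *s e) \<le> (\<Sum>e\<in>E. real (c e) * of_rat (l e))"
      using sum_ratl[of b c] by (simp add: L_def)
  next
    fix c assume "order_unit S (\<Sum>e\<in>E. c e *s e)"
    then obtain l where l: "l \<in> L" "D (\<Sum>e\<in>E. c e *s e) = (\<Sum>e\<in>E. real (c e) * l e)"
      using support by blast
    obtain b where b: "b \<in> B" "\<forall>e\<in>E. val b e \<le> val l e" using B(3) l(1) by blast
    have bL: "b \<in> L" using b(1) B(2) by auto
    have "(\<Sum>e\<in>E. real (c e) * b e) \<le> (\<Sum>e\<in>E. real (c e) * l e)"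
      using mono[OF bL l(1)] b(2) by (intro sum_mono mult_left_mono) auto
    moreover have "D (\<Sum>e\<in>E. c e *s e) \<le> (\<Sum>e\<in>E. real (c e) * b e)" using bL by (simp add: L_def)
    ultimately have "D (\<Sum>e\<in>E. c e *s e) = (\<Sum>e\<in>E. real (c e) * b e)" using l(2) by simp
    then show "\<exists>l\<in>ratl ` B. D (\<Sum>e\<in>E. c e *s e) = (\<Sum>e\<in>E. real (c e) * of_rat (l e))"
      using b(1) sum_ratl[OF bL] by (intro bexI[of _ "ratl b"]) simp_all
  qed
qed

section \<open>Interior points and rounded limits\<close>

definition rat_vec :: "('r \<Rightarrow> rat) \<Rightarrow> real ^ 'r" where
  "rat_vec v = (\<chi> i. of_rat (v i))"

definition nat_coords :: "nat ^ 'r \<Rightarrow> 'r \<Rightarrow> rat" where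
  "nat_coords s = (\<lambda>i. of_nat (s $ i))"

lemma inj_rat_vec: "inj rat_vec"
  by (auto simp: inj_def rat_vec_def vec_eq_iff fun_eq_iff)

lemma inj_nat_coords: "inj nat_coords"
  by (auto simp: inj_def nat_coords_def vec_eq_iff fun_eq_iff)

lemma real_vec_eq_rat_vec: "real_vec s = rat_vec (nat_coords s)"
  by (simp add: real_vec_def rat_vec_def nat_coords_def)

text \<open>
  The second equivalence is the rational counterpart of the first: membership of a rational vector is
  witnessed by rational coefficients.
\<close>

lemma cone_span_inequalities:
  fixes W :: "('r::finite \<Rightarrow> rat) set"
  assumes W: "finite W"
  shows "\<exists>H. finite H \<and>
    (\<forall>x. x \<in> cone_span (rat_vec ` W) \<longleftrightarrow> (\<forall>a\<in>H. 0 \<le> rat_dot a (\<lambda>i. x $ i))) \<and>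
    (\<forall>y :: 'r \<Rightarrow> rat. (\<forall>a\<in>H. 0 \<le> rat_dot a y) \<longleftrightarrow>
       (\<exists>c. (\<forall>w\<in>W. 0 \<le> c w) \<and> (\<forall>i. y i = (\<Sum>w\<in>W. c w * w i))))"
proof -
  obtain V where V: "set V = W" "distinct V" using finite_distinct_list[OF W] by blast
  have real: "x \<in> cone_span (rat_vec ` W) \<longleftrightarrow> in_cone V (\<lambda>i. x $ i)" for x
  proof -
    have sum_eq: "(\<Sum>v\<in>rat_vec ` W. c v *\<^sub>R v) = (\<Sum>w\<in>W. c (rat_vec w) *\<^sub>R rat_vec w)" for c
      using inj_rat_vec by (subst sum.reindex) (auto simp: inj_on_def inj_def)
    have "x \<in> cone_span (rat_vec ` W) \<longleftrightarrow>
        (\<exists>c. (\<forall>w\<in>W. 0 \<le> c (rat_vec w)) \<and> x = (\<Sum>w\<in>W. c (rat_vec w) *\<^sub>R rat_vec w))"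
      unfolding cone_span_def sum_eq by auto
    also have "\<dots> \<longleftrightarrow> (\<exists>c. (\<forall>w\<in>W. 0 \<le> c w) \<and> x = (\<Sum>w\<in>W. c w *\<^sub>R rat_vec w))"
    proof
      assume "\<exists>c. (\<forall>w\<in>W. 0 \<le> c w) \<and> x = (\<Sum>w\<in>W. c w *\<^sub>R rat_vec w)"
      then obtain c where "\<forall>w\<in>W. 0 \<le> c w" "x = (\<Sum>w\<in>W. c w *\<^sub>R rat_vec w)" by blast
      then show "\<exists>c. (\<forall>w\<in>W. 0 \<le> c (rat_vec w)) \<and> x = (\<Sum>w\<in>W. c (rat_vec w) *\<^sub>R rat_vec w)"
        by (intro exI[of _ "\<lambda>v. c (inv rat_vec v)"]) (simp add: inv_f_f[OF inj_rat_vec])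
    next
      assume "\<exists>c. (\<forall>w\<in>W. 0 \<le> c (rat_vec w)) \<and> x = (\<Sum>w\<in>W. c (rat_vec w) *\<^sub>R rat_vec w)"
      then obtain c where "\<forall>w\<in>W. 0 \<le> c (rat_vec w)" "x = (\<Sum>w\<in>W. c (rat_vec w) *\<^sub>R rat_vec w)"
        by (elim exE conjE)
      then show "\<exists>c. (\<forall>w\<in>W. 0 \<le> c w) \<and> x = (\<Sum>w\<in>W. c w *\<^sub>R rat_vec w)"
        by (intro exI[of _ "\<lambda>w. c (rat_vec w)"]) simp
    qed
    also have "\<dots> \<longleftrightarrow> in_cone V (\<lambda>i. x $ i)"
      unfolding in_cone_iff_combination[OF V(2)] V(1) by (simp add: vec_eq_iff rat_vec_def)
    finally show ?thesis .
  qed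
  have rat: "in_cone V y \<longleftrightarrow> (\<exists>c. (\<forall>w\<in>W. 0 \<le> c w) \<and> (\<forall>i. y i = (\<Sum>w\<in>W. c w * w i)))"
    for y :: "'r \<Rightarrow> rat"
    unfolding in_cone_iff_combination[OF V(2)] V(1) by simp
  show ?thesis
    using real rat by (intro exI[of _ "cone_inequalities V"]) (simp add: finite_cone_inequalities in_cone_iff)
qed

text \<open>
  For large \<open>j\<close> the vector \<open>x - t / j\<close> still lies in the cone, so it is a nonnegative rational combination
  of \<open>E\<close>; clearing denominators expresses a multiple of \<open>x\<close> as \<open>t\<close> plus an element of the monoid.
\<close>

lemma interior_order_unit:
  fixes E :: "(nat ^ 'r) set"
  assumes E: "finite E" and x: "x \<in> nat_span E" "real_vec x \<in> interior (cone_span (real_vec ` E))"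
  shows "order_unit (nat_span E) x"
  unfolding order_unit_def
proof (intro conjI ballI)
  note S = additive_submonoid_nat_span[of E]
  fix t assume t: "t \<in> nat_span E"
  obtain H where
    "\<forall>x. x \<in> cone_span (rat_vec ` nat_coords ` E) \<longleftrightarrow> (\<forall>a\<in>H. 0 \<le> rat_dot a (\<lambda>i. x $ i))"
    "\<forall>y :: 'r \<Rightarrow> rat. (\<forall>a\<in>H. 0 \<le> rat_dot a y) \<longleftrightarrow>
       (\<exists>c. (\<forall>w\<in>nat_coords ` E. 0 \<le> c w) \<and> (\<forall>i. y i = (\<Sum>w\<in>nat_coords ` E. c w * w i)))"
    using cone_span_inequalities[OF finite_imageI[OF E], of nat_coords] by (elim exE conjE) (rule that)
  note H = this[THEN spec]
  have "real_vec ` E = rat_vec ` nat_coords ` E" by (simp add: image_image real_vec_eq_rat_vec)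
  then obtain \<epsilon> where \<epsilon>: "\<epsilon> > 0" "ball (real_vec x) \<epsilon> \<subseteq> cone_span (rat_vec ` nat_coords ` E)"
    using x(2) unfolding mem_interior by auto
  obtain j :: nat where j: "norm (real_vec t) < real j * \<epsilon>" "j > 0"
    using ex_less_of_nat_mult[OF \<epsilon>(1), of "norm (real_vec t)"]
    by (metis mult_zero_left norm_ge_zero not_gr_zero not_le of_nat_0)
  have "real_vec x - (1 / real j) *\<^sub>R real_vec t \<in> ball (real_vec x) \<epsilon>"
    using j by (simp add: dist_norm field_simps)
  then have in_cone: "real_vec x - (1 / real j) *\<^sub>R real_vec t \<in> cone_span (rat_vec ` nat_coords ` E)"
    using \<epsilon>(2) by blast
  define y :: "'r \<Rightarrow> rat" where "y i = of_nat j * of_nat (x $ i) - of_nat (t $ i)" for i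
  have "0 \<le> rat_dot a y" if a: "a \<in> H" for a
  proof -
    have "0 \<le> rat_dot a (\<lambda>i. (real_vec x - (1 / real j) *\<^sub>R real_vec t) $ i)"
      using in_cone H(1) a by blast
    then have "0 \<le> real j * rat_dot a (\<lambda>i. (real_vec x - (1 / real j) *\<^sub>R real_vec t) $ i)" by simp
    also have "\<dots> = rat_dot a (\<lambda>i. of_rat (y i))"
      unfolding rat_dot_def sum_distrib_left
    proof (rule sum.cong[OF refl])
      fix i
      have "real j * ((real_vec x - (1 / real j) *\<^sub>R real_vec t) $ i) = real j * real (x $ i) - real (t $ i)"
        using j(2) by (simp add: real_vec_def field_simps)
      also have "\<dots> = of_rat (y i)" by (simp add: y_def of_rat_diff of_rat_mult)
      finally show "real j * (of_rat (a i) * (real_vec x - (1 / real j) *\<^sub>R real_vec t) $ i) = of_rat (a i) * of_rat (y i)"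
        by (simp add: mult.left_commute)
    qed
    also have "\<dots> = of_rat (rat_dot a y)" by (rule rat_dot_of_rat)
    finally show ?thesis by simp
  qed
  then have "\<forall>a\<in>H. 0 \<le> rat_dot a y" by (rule ballI)
  from iffD1[OF H(2) this] obtain c where c: "\<forall>w\<in>nat_coords ` E. 0 \<le> c w"
    "\<forall>i. y i = (\<Sum>w\<in>nat_coords ` E. c w * w i)" by (elim exE conjE)
  obtain k :: nat where k: "k > 0" "\<forall>q\<in>c ` nat_coords ` E. of_nat k * q \<in> \<int>"
    using common_denominator[of "c ` nat_coords ` E"] E by auto
  have "\<exists>n::nat. of_nat n = of_nat k * c (nat_coords e)" if e: "e \<in> E" for e
  proof -
    have "of_nat k * c (nat_coords e) \<in> \<int>" "0 \<le> of_nat k * c (nat_coords e)" using k(2) c(1) e by auto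
    then have "of_nat k * c (nat_coords e) \<in> \<nat>" by (simp add: Nats_altdef2)
    then show ?thesis by (metis Nats_cases)
  qed
  then obtain n :: "nat ^ 'r \<Rightarrow> nat" where n: "\<And>e. e \<in> E \<Longrightarrow> of_nat (n e) = of_nat k * c (nat_coords e)" by metis
  define s where "s = (\<Sum>e\<in>E. n e *s e)"
  have "k * j * (x $ i) = k * (t $ i) + s $ i" for i
  proof -
    have "of_nat k * y i = (\<Sum>e\<in>E. (of_nat k * c (nat_coords e)) * nat_coords e i)"
      unfolding c(2)[rule_format] using inj_nat_coords
      by (subst sum.reindex) (auto simp: inj_on_def inj_def sum_distrib_left mult.assoc)
    also have "\<dots> = (\<Sum>e\<in>E. of_nat (n e) * of_nat (e $ i))"
      using n by (intro sum.cong) (auto simp: nat_coords_def)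
    also have "\<dots> = of_nat (s $ i)" by (simp add: s_def)
    finally have "of_nat (k * j * (x $ i)) = (of_nat (k * (t $ i) + s $ i) :: rat)"
      by (simp add: y_def algebra_simps)
    then show ?thesis by (simp only: of_nat_eq_iff)
  qed
  then have "(k * j) *s x = k *s t + s" by (simp add: vec_eq_iff)
  also have "k *s t = t + (k - 1) *s t"
    using k(1) by (cases k) (simp_all add: vec_eq_iff)
  finally have "(k * j) *s x = t + ((k - 1) *s t + s)" by (simp add: add.assoc)
  moreover have "s \<in> nat_span E" unfolding s_def nat_span_def by blast
  then have "(k - 1) *s t + s \<in> nat_span E"
    using additive_submonoid_smult[OF S t] S by (simp add: additive_submonoid_def)
  ultimately show "\<exists>q::nat. \<exists>s\<in>nat_span E. q *s x = t + s" by blast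
qed (rule x(1))

lemma rational_polyhedral_cone_inequalities:
  assumes "rational_polyhedral_cone (C :: (real ^ 'r) set)"
  shows "\<exists>H. finite H \<and> (\<forall>x. x \<in> C \<longleftrightarrow> (\<forall>a\<in>H. 0 \<le> rat_dot a (\<lambda>i. x $ i)))"
proof -
  obtain V :: "(real ^ 'r) set" where V: "finite V" "\<forall>v\<in>V. \<forall>i. v $ i \<in> \<rat>" "C = cone_span V"
    using assms unfolding rational_polyhedral_cone_def by blast
  have "\<exists>w. rat_vec w = v" if "v \<in> V" for v :: "real ^ 'r"
  proof -
    have "\<forall>i. \<exists>q. v $ i = of_rat q" using V(2) that by (auto elim!: Rats_cases)
    then obtain w where "\<And>i. v $ i = of_rat (w i)" by metis
    then show ?thesis by (intro exI[of _ w]) (simp add: rat_vec_def vec_eq_iff)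
  qed
  then obtain g where g: "\<And>v. v \<in> V \<Longrightarrow> rat_vec (g v) = v" by metis
  then have "V = rat_vec ` (g ` V)" by (force simp: image_image)
  then have C: "C = cone_span (rat_vec ` g ` V)" using V(3) by simp
  show ?thesis
    unfolding C using cone_span_inequalities[OF finite_imageI[OF V(1)], of g]
    by (elim exE conjE) (intro exI conjI)
qed

text \<open>
  For the limit function \<open>D\<close> one has \<open>\<mu> \<le> D \<le> \<mu> - f\<close>, hence \<open>D < \<mu> + 1\<close>.  A majorant of \<open>D\<close> that is sharp
  at \<open>s\<close> therefore detects whether an integer is at most \<open>\<mu> s\<close>.
\<close>

lemma bounded_saturated_majorants:
  fixes E :: "(nat ^ 'r) set" and \<mu> :: "nat ^ 'r \<Rightarrow> int"
  assumes E: "finite E" and S: "S = nat_span E"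
    and super: "\<And>s t. s \<in> S \<Longrightarrow> t \<in> S \<Longrightarrow> \<mu> s + \<mu> t \<le> \<mu> (s + t)"
    and lim: "\<And>s. s \<in> S \<Longrightarrow> \<exists>d. (\<lambda>\<kappa>::nat. real_of_int (\<mu> (\<kappa> *s s)) / real \<kappa>) \<longlonglongrightarrow> d"
    and sat: "\<And>s (\<kappa>::nat). s \<in> S \<Longrightarrow> \<kappa> > 0 \<Longrightarrow> real_of_int (\<mu> (\<kappa> *s s)) / real \<kappa> + f \<le> real_of_int (\<mu> s)"
    and f: "f > - 1"
  shows "\<exists>\<Lambda> :: (nat ^ 'r \<Rightarrow> rat) set. finite \<Lambda> \<and>
    (\<forall>l\<in>\<Lambda>. \<forall>c. of_int (\<mu> (\<Sum>e\<in>E. c e *s e)) \<le> (\<Sum>e\<in>E. l e * of_nat (c e))) \<and>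
    (\<forall>c. order_unit S (\<Sum>e\<in>E. c e *s e) \<longrightarrow>
       (\<exists>l\<in>\<Lambda>. (\<Sum>e\<in>E. l e * of_nat (c e)) < of_int (\<mu> (\<Sum>e\<in>E. c e *s e)) + 1))"
proof -
  have Sm: "additive_submonoid S" unfolding S by (rule additive_submonoid_nat_span)
  obtain D where D: "\<And>s. s \<in> S \<Longrightarrow> (\<lambda>\<kappa>::nat. real_of_int (\<mu> (\<kappa> *s s)) / real \<kappa>) \<longlonglongrightarrow> D s"
    using lim by metis
  have mult: "k *s s \<in> S" if "s \<in> S" for k :: nat and s using additive_submonoid_smult[OF Sm that] .
  have mu_mult: "int k * \<mu> s \<le> \<mu> (k *s s)" if s: "s \<in> S" "k > 0" for k :: nat and s
    using s(2)
  proof (induction k rule: nat_induct_non_zero)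
    case 1
    have "1 *s s = s" by (simp add: vec_eq_iff)
    then show ?case by simp
  next
    case (Suc k)
    have "Suc k *s s = s + k *s s" by (simp add: vec_eq_iff)
    moreover have "\<mu> s + \<mu> (k *s s) \<le> \<mu> (s + k *s s)" using super s(1) mult by blast
    ultimately show ?case using Suc.IH by (simp add: algebra_simps)
  qed
  have lower: "of_int (\<mu> s) \<le> D s" if s: "s \<in> S" for s
  proof (rule LIMSEQ_le_const[OF D[OF s]], intro exI[of _ 1] allI impI)
    fix \<kappa> :: nat assume \<kappa>: "1 \<le> \<kappa>"
    then have "real_of_int (int \<kappa> * \<mu> s) \<le> of_int (\<mu> (\<kappa> *s s))"
      using mu_mult[OF s, of \<kappa>] by (simp only: of_int_le_iff)
    then show "of_int (\<mu> s) \<le> real_of_int (\<mu> (\<kappa> *s s)) / real \<kappa>"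
      using \<kappa> by (simp add: le_divide_eq mult.commute)
  qed
  have upper: "D s \<le> of_int (\<mu> s) - f" if s: "s \<in> S" for s
  proof (rule LIMSEQ_le_const2[OF D[OF s]], intro exI[of _ 1] allI impI)
    fix \<kappa> :: nat assume "1 \<le> \<kappa>"
    then show "real_of_int (\<mu> (\<kappa> *s s)) / real \<kappa> \<le> of_int (\<mu> s) - f"
      using sat[OF s, of \<kappa>] by simp
  qed
  have "D s + D t \<le> D (s + t)" if st: "s \<in> S" "t \<in> S" for s t
  proof (rule LIMSEQ_le[OF tendsto_add[OF D[OF st(1)] D[OF st(2)]] D])
    show "s + t \<in> S" using Sm st by (simp add: additive_submonoid_def)
    have "real_of_int (\<mu> (\<kappa> *s s)) / real \<kappa> + real_of_int (\<mu> (\<kappa> *s t)) / real \<kappa>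
        \<le> real_of_int (\<mu> (\<kappa> *s (s + t))) / real \<kappa>" for \<kappa> :: nat
    proof -
      have "\<kappa> *s (s + t) = \<kappa> *s s + \<kappa> *s t" by (simp add: vec_eq_iff algebra_simps)
      moreover have "\<mu> (\<kappa> *s s) + \<mu> (\<kappa> *s t) \<le> \<mu> (\<kappa> *s s + \<kappa> *s t)" using super mult st by blast
      then have "real_of_int (\<mu> (\<kappa> *s s) + \<mu> (\<kappa> *s t)) \<le> of_int (\<mu> (\<kappa> *s s + \<kappa> *s t))"
        by (simp only: of_int_le_iff)
      ultimately show ?thesis by (simp add: divide_right_mono flip: add_divide_distrib)
    qed
    then show "\<exists>N. \<forall>\<kappa>\<ge>N. real_of_int (\<mu> (\<kappa> *s s)) / real \<kappa> + real_of_int (\<mu> (\<kappa> *s t)) / real \<kappa>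
        \<le> real_of_int (\<mu> (\<kappa> *s (s + t))) / real \<kappa>" by blast
  qed
  moreover have "D (k *s s) = real k * D s" if s: "s \<in> S" for s and k :: nat
  proof (cases "k = 0")
    case True
    have "0 *s s = (0 :: nat ^ 'r)" for s :: "nat ^ 'r" by (simp add: vec_eq_iff)
    moreover have "\<kappa> *s 0 = (0 :: nat ^ 'r)" for \<kappa> :: nat by (simp add: vec_eq_iff)
    moreover have "(0 :: nat ^ 'r) \<in> S" using Sm by (simp add: additive_submonoid_def)
    moreover have "(\<lambda>\<kappa>. real_of_int (\<mu> 0) / real \<kappa>) \<longlonglongrightarrow> 0" by (rule lim_const_over_n)
    ultimately have "D 0 = 0" using D[of 0] LIMSEQ_unique by simp blast
    then show ?thesis using True \<open>\<And>s. 0 *s s = 0\<close> by simp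
  next
    case False
    have "strict_mono (\<lambda>\<kappa>. \<kappa> * k)" using False by (simp add: strict_mono_def)
    from LIMSEQ_subseq_LIMSEQ[OF D[OF s] this]
    have "(\<lambda>\<kappa>. real_of_int (\<mu> ((\<kappa> * k) *s s)) / real (\<kappa> * k)) \<longlonglongrightarrow> D s" by (simp add: o_def)
    then have "(\<lambda>\<kappa>. real k * (real_of_int (\<mu> ((\<kappa> * k) *s s)) / real (\<kappa> * k))) \<longlonglongrightarrow> real k * D s"
      by (rule tendsto_mult_left)
    moreover have "real k * (real_of_int (\<mu> ((\<kappa> * k) *s s)) / real (\<kappa> * k)) =
        real_of_int (\<mu> (\<kappa> *s (k *s s))) / real \<kappa>" for \<kappa>
      using False by (simp add: vector_smult_assoc)
    ultimately have "(\<lambda>\<kappa>. real_of_int (\<mu> (\<kappa> *s (k *s s))) / real \<kappa>) \<longlonglongrightarrow> real k * D s" by simp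
    then show ?thesis using D[OF mult[OF s]] LIMSEQ_unique by blast
  qed
  ultimately have "superlinear_on S D" by (simp add: superlinear_on_def)
  moreover have "almost_integral_on S (- f) D"
    unfolding almost_integral_on_def
  proof (intro allI impI exI[of _ "0 :: real"] ballI)
    fix A \<epsilon> s assume A: "finite A \<and> A \<subseteq> S \<and> (\<epsilon> :: real) > 0" "s \<in> A"
    then have "s \<in> S" by auto
    then show "near_integer (- f) \<epsilon> (D s + 0)"
      using lower[of s] upper[of s] A by (intro exI[of _ "\<mu> s"]) simp
  qed
  moreover have "- f < 1" using f by simp
  ultimately obtain \<Lambda> where \<Lambda>: "finite \<Lambda>"
    "\<And>l c. l \<in> \<Lambda> \<Longrightarrow> D (\<Sum>e\<in>E. c e *s e) \<le> (\<Sum>e\<in>E. real (c e) * of_rat (l e))"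
    "\<And>c. order_unit S (\<Sum>e\<in>E. c e *s e) \<Longrightarrow> \<exists>l\<in>\<Lambda>. D (\<Sum>e\<in>E. c e *s e) = (\<Sum>e\<in>E. real (c e) * of_rat (l e))"
    using finitely_many_linear_majorants[OF E S, of D "- f"] by blast
  have inS: "(\<Sum>e\<in>E. c e *s e) \<in> S" for c unfolding S nat_span_def by blast
  have of_rat_sum_eq: "(\<Sum>e\<in>E. real (c e) * of_rat (l e)) = of_rat (\<Sum>e\<in>E. l e * of_nat (c e))" for c and l :: "nat ^ 'r \<Rightarrow> rat"
    by (simp add: of_rat_sum of_rat_mult mult.commute)
  show ?thesis
  proof (intro exI[of _ \<Lambda>] conjI ballI allI impI)
    fix l c assume "l \<in> \<Lambda>"
    then have "real_of_int (\<mu> (\<Sum>e\<in>E. c e *s e)) \<le> of_rat (\<Sum>e\<in>E. l e * of_nat (c e))"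
      using \<Lambda>(2)[of l c] lower[OF inS[of c]] of_rat_sum_eq[of c l] by linarith
    then have "(of_rat (of_int (\<mu> (\<Sum>e\<in>E. c e *s e))) :: real) \<le> of_rat (\<Sum>e\<in>E. l e * of_nat (c e))" by simp
    then show "of_int (\<mu> (\<Sum>e\<in>E. c e *s e)) \<le> (\<Sum>e\<in>E. l e * of_nat (c e))" by (simp only: of_rat_less_eq)
  next
    fix c assume "order_unit S (\<Sum>e\<in>E. c e *s e)"
    then obtain l where l: "l \<in> \<Lambda>" "D (\<Sum>e\<in>E. c e *s e) = (\<Sum>e\<in>E. real (c e) * of_rat (l e))"
      using \<Lambda>(3) by blast
    then have "of_rat (\<Sum>e\<in>E. l e * of_nat (c e)) < real_of_int (\<mu> (\<Sum>e\<in>E. c e *s e)) + 1"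
      using upper[OF inS[of c]] f of_rat_sum_eq[of c l] by linarith
    then have "(of_rat (\<Sum>e\<in>E. l e * of_nat (c e)) :: real) < of_rat (of_int (\<mu> (\<Sum>e\<in>E. c e *s e)) + 1)"
      by (simp add: of_rat_add)
    then show "\<exists>l\<in>\<Lambda>. (\<Sum>e\<in>E. l e * of_nat (c e)) < of_int (\<mu> (\<Sum>e\<in>E. c e *s e)) + 1"
      using l(1) by (intro bexI[of _ l]) (simp only: of_rat_less)
  qed (rule \<Lambda>(1))
qed

section \<open>The Hilbert basis theorem\<close>

definition submodule :: "'a::comm_ring_1 set \<Rightarrow> 'a set \<Rightarrow> bool" where
  "submodule B M \<longleftrightarrow> 0 \<in> M \<and> (\<forall>a\<in>M. \<forall>b\<in>M. a + b \<in> M) \<and> (\<forall>r\<in>B. \<forall>a\<in>M. r * a \<in> M)"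

text \<open>
  Rings are subsets of one ambient type, so that generators can be adjoined one at a time by induction.
\<close>

definition noetherian_subring :: "'a::comm_ring_1 set \<Rightarrow> bool" where
  "noetherian_subring B \<longleftrightarrow>
     (\<forall>M. submodule B M \<and> M \<subseteq> B \<longrightarrow> (\<exists>G. finite G \<and> submodule B hull G = M))"

lemma submodule_UNIV: "submodule UNIV = is_ideal"
  by (auto simp: submodule_def is_ideal_def fun_eq_iff)

lemma submodule_hull: "submodule B (submodule B hull G)"
  by (rule hull_in) (auto simp: submodule_def)

lemma is_subring_hull: "is_subring (is_subring hull G)"
  by (rule hull_in) (auto simp: is_subring_def)

lemma submodule_minus:
  assumes "is_subring B" "submodule B M" "a \<in> M" "b \<in> M"
  shows "a - b \<in> M"
proof -
  have "0 - 1 \<in> B" using assms(1) unfolding is_subring_def by blast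
  then have "(0 - 1) * b \<in> M" using assms(2,4) unfolding submodule_def by blast
  then have "a + (0 - 1) * b \<in> M" using assms(2,3) unfolding submodule_def by blast
  then show ?thesis by simp
qed

lemma is_subring_sum:
  assumes "is_subring B" "\<And>i. i \<in> I \<Longrightarrow> f i \<in> B"
  shows "sum f I \<in> B"
  using assms(2)
  by (induction I rule: infinite_finite_induct) (use assms(1) in \<open>auto simp: is_subring_def\<close>)

definition polys_over :: "'a::comm_ring_1 set \<Rightarrow> 'a poly set" where
  "polys_over B = {p. \<forall>i. coeff p i \<in> B}"

lemma is_subring_polys_over:
  assumes B: "is_subring B"
  shows "is_subring (polys_over B)"
proof -
  have "coeff (p * q) i \<in> B" if "p \<in> polys_over B" "q \<in> polys_over B" for p q i
    unfolding coeff_mult using that B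
    by (intro is_subring_sum[OF B]) (simp add: polys_over_def is_subring_def)
  moreover have "coeff 1 i \<in> B" for i using B by (simp add: is_subring_def coeff_1)
  ultimately show ?thesis using B by (simp add: is_subring_def polys_over_def)
qed

lemma adjoin_eq_poly_values:
  assumes B: "is_subring B"
  shows "is_subring hull (insert x B) = (\<lambda>p. poly p x) ` polys_over B"
proof (rule hull_unique)
  note P = is_subring_polys_over[OF B]
  show "insert x B \<subseteq> (\<lambda>p. poly p x) ` polys_over B"
  proof
    fix y assume "y \<in> insert x B"
    then show "y \<in> (\<lambda>p. poly p x) ` polys_over B"
    proof
      assume "y = x"
      then show ?thesis using B
        by (intro image_eqI[of _ _ "monom 1 1"])
          (auto simp: polys_over_def is_subring_def poly_monom coeff_monom)
    next
      assume "y \<in> B"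
      then show ?thesis using B
        by (intro image_eqI[of _ _ "[:y:]"])
          (auto simp: polys_over_def is_subring_def coeff_pCons split: nat.split)
    qed
  qed
  have "0 \<in> polys_over B" "1 \<in> polys_over B" using P by (simp_all add: is_subring_def)
  then have 01: "0 \<in> (\<lambda>p. poly p x) ` polys_over B" "1 \<in> (\<lambda>p. poly p x) ` polys_over B"
    using imageI[of 0 "polys_over B" "\<lambda>p. poly p x"] imageI[of 1 "polys_over B" "\<lambda>p. poly p x"]
    by simp_all
  have "poly p x + poly q x \<in> (\<lambda>p. poly p x) ` polys_over B \<and>
      poly p x - poly q x \<in> (\<lambda>p. poly p x) ` polys_over B \<and>
      poly p x * poly q x \<in> (\<lambda>p. poly p x) ` polys_over B"
    if "p \<in> polys_over B" "q \<in> polys_over B" for p q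
  proof -
    have "p + q \<in> polys_over B" "p - q \<in> polys_over B" "p * q \<in> polys_over B"
      using P that unfolding is_subring_def by blast+
    then show ?thesis by (metis image_eqI poly_add poly_diff poly_mult)
  qed
  then show "is_subring ((\<lambda>p. poly p x) ` polys_over B)"
    using 01 by (simp add: is_subring_def)
next
  fix T assume T: "insert x B \<subseteq> T" "is_subring T"
  have "x ^ i \<in> T" for i using T by (induction i) (auto simp: is_subring_def)
  then have "poly p x \<in> T" if "p \<in> polys_over B" for p
    unfolding poly_altdef using that T
    by (intro is_subring_sum[OF T(2)]) (simp add: polys_over_def is_subring_def subset_iff)
  then show "(\<lambda>p. poly p x) ` polys_over B \<subseteq> T" by auto
qed

text \<open>
  The coefficients of \<open>x ^ n\<close> in the elements of \<open>M\<close> of degree at most \<open>n\<close> form an increasing chain of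
  ideals \<open>L n\<close> of \<open>B\<close>, which is stationary from some \<open>N\<close> on.  Elements of \<open>M\<close> lifting generators of
  \<open>L 0, \<dots>, L N\<close> generate \<open>M\<close>: subtracting a combination of them lowers the degree.
\<close>

lemma hilbert_basis_adjoin:
  assumes B: "is_subring B" and noeth: "noetherian_subring B"
  shows "noetherian_subring (is_subring hull (insert x B))"
  unfolding noetherian_subring_def
proof (intro allI impI, elim conjE)
  let ?R = "is_subring hull (insert x B)"
  note P = is_subring_polys_over[OF B]
  have R: "is_subring ?R" by (rule is_subring_hull)
  have polyR: "poly p x \<in> ?R" if "p \<in> polys_over B" for p
    unfolding adjoin_eq_poly_values[OF B] using that by blast
  have BR: "B \<subseteq> ?R" "x \<in> ?R" using hull_subset[of "insert x B" is_subring] by auto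
  fix M assume M: "submodule ?R M" "M \<subseteq> ?R"
  define L where "L n = {coeff p n | p. p \<in> polys_over B \<and> degree p \<le> n \<and> poly p x \<in> M}" for n
  have L_sub: "submodule B (L n)" for n
    unfolding submodule_def
  proof (intro conjI ballI)
    show "0 \<in> L n" using P M(1) unfolding L_def
      by (intro CollectI exI[of _ 0]) (simp add: is_subring_def submodule_def)
  next
    fix a b assume "a \<in> L n" "b \<in> L n"
    then obtain p q where p: "a = coeff p n" "p \<in> polys_over B" "degree p \<le> n" "poly p x \<in> M"
      and q: "b = coeff q n" "q \<in> polys_over B" "degree q \<le> n" "poly q x \<in> M"
      unfolding L_def by blast
    then show "a + b \<in> L n" using P M(1) unfolding L_def
      by (intro CollectI exI[of _ "p + q"]) (simp add: is_subring_def submodule_def degree_add_le)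
  next
    fix r a assume r: "r \<in> B" and "a \<in> L n"
    then obtain p where p: "a = coeff p n" "p \<in> polys_over B" "degree p \<le> n" "poly p x \<in> M"
      unfolding L_def by blast
    have "smult r p \<in> polys_over B" using p(2) r B by (simp add: polys_over_def is_subring_def)
    moreover have "degree (smult r p) \<le> n" using p(3) degree_smult_le[of r p] by linarith
    moreover have "r * poly p x \<in> M" using M(1) r BR p(4) unfolding submodule_def by blast
    ultimately show "r * a \<in> L n" unfolding L_def
      by (intro CollectI exI[of _ "smult r p"]) (simp add: p(1))
  qed
  have LB: "L n \<subseteq> B" for n by (auto simp: L_def polys_over_def)
  have L_Suc: "L n \<subseteq> L (Suc n)" for n
  proof
    fix a assume "a \<in> L n"
    then obtain p where p: "a = coeff p n" "p \<in> polys_over B" "degree p \<le> n" "poly p x \<in> M"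
      unfolding L_def by blast
    have "pCons 0 p \<in> polys_over B"
      using p(2) B by (auto simp: polys_over_def is_subring_def coeff_pCons split: nat.split)
    moreover have "x * poly p x \<in> M" using M(1) BR(2) p(4) unfolding submodule_def by blast
    moreover have "degree (pCons 0 p) \<le> Suc n" using p(3) degree_pCons_le[of 0 p] by linarith
    ultimately show "a \<in> L (Suc n)" unfolding L_def
      by (intro CollectI exI[of _ "pCons 0 p"]) (simp add: p(1))
  qed
  have L_mono: "L i \<subseteq> L j" if "i \<le> j" for i j using lift_Suc_mono_le[of L, OF L_Suc that] .
  have "submodule B (\<Union>n. L n)"
    unfolding submodule_def
  proof (intro conjI ballI)
    show "0 \<in> (\<Union>n. L n)" using L_sub by (auto simp: submodule_def)
  next
    fix a b assume "a \<in> (\<Union>n. L n)" "b \<in> (\<Union>n. L n)"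
    then obtain i j where "a \<in> L i" "b \<in> L j" by blast
    then have "a \<in> L (max i j)" "b \<in> L (max i j)" using L_mono by (meson max.cobounded1 max.cobounded2 subsetD)+
    then show "a + b \<in> (\<Union>n. L n)" using L_sub by (auto simp: submodule_def)
  next
    fix r a assume "r \<in> B" "a \<in> (\<Union>n. L n)"
    then show "r * a \<in> (\<Union>n. L n)" using L_sub unfolding submodule_def by blast
  qed
  then obtain G0 where G0: "finite G0" "submodule B hull G0 = (\<Union>n. L n)"
    using noeth LB unfolding noetherian_subring_def by (metis UN_least)
  have "\<forall>g\<in>G0. \<exists>n. g \<in> L n" using hull_subset[of G0 "submodule B"] G0(2) by auto
  then obtain lev where lev: "\<And>g. g \<in> G0 \<Longrightarrow> g \<in> L (lev g)" by metis
  define N where "N = Max (insert 0 (lev ` G0))"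
  have "G0 \<subseteq> L N"
  proof
    fix g assume g: "g \<in> G0"
    then have "lev g \<le> N" unfolding N_def using G0(1) by (intro Max_ge) auto
    then show "g \<in> L N" using lev[OF g] L_mono by blast
  qed
  then have stable: "L n \<subseteq> L N" for n
    using hull_minimal[of G0 "L N" "submodule B"] L_sub G0(2) by blast
  have "\<exists>G. finite G \<and> submodule B hull G = L n" for n
    using noeth L_sub LB unfolding noetherian_subring_def by blast
  then obtain G where G: "\<And>n. finite (G n)" "\<And>n. submodule B hull (G n) = L n" by metis
  have "\<forall>g\<in>L n. \<exists>p. g = coeff p n \<and> p \<in> polys_over B \<and> degree p \<le> n \<and> poly p x \<in> M" for n
    unfolding L_def by blast
  then obtain W where W: "\<And>n g. g \<in> L n \<Longrightarrow> coeff (W n g) n = g \<and> W n g \<in> polys_over B \<and>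
      degree (W n g) \<le> n \<and> poly (W n g) x \<in> M" by metis
  define H where "H = (\<Union>n\<le>N. (\<lambda>g. poly (W n g) x) ` G n)"
  let ?K = "submodule ?R hull H"
  have GL: "G n \<subseteq> L n" for n using hull_subset[of "G n" "submodule B"] G(2) by auto
  have "H \<subseteq> M" using GL W by (auto simp: H_def)
  then have KM: "?K \<subseteq> M" using M(1) by (intro hull_minimal)
  have K: "submodule ?R ?K" by (rule submodule_hull)
  have lift: "\<exists>q. q \<in> polys_over B \<and> degree q \<le> n \<and> coeff q n = b \<and> poly q x \<in> ?K"
    if n: "n \<le> N" and b: "b \<in> L n" for n b
  proof -
    have "b \<in> submodule B hull (G n)" using b G(2) by simp
    then show ?thesis
    proof (rule hull_induct)
      fix g assume g: "g \<in> G n"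
      then have "poly (W n g) x \<in> ?K" using n by (intro hull_inc) (auto simp: H_def)
      then show "\<exists>q. q \<in> polys_over B \<and> degree q \<le> n \<and> coeff q n = g \<and> poly q x \<in> ?K"
        using W[of g n] g GL by blast
    next
      let ?S = "{b. \<exists>q. q \<in> polys_over B \<and> degree q \<le> n \<and> coeff q n = b \<and> poly q x \<in> ?K}"
      show "submodule B ?S"
        unfolding submodule_def[of B ?S]
      proof (intro conjI ballI)
        show "0 \<in> ?S" using P K
          by (intro CollectI exI[of _ 0]) (simp add: is_subring_def submodule_def)
      next
        fix a b assume "a \<in> ?S" "b \<in> ?S"
        then obtain p q where p: "p \<in> polys_over B" "degree p \<le> n" "coeff p n = a" "poly p x \<in> ?K"
          and q: "q \<in> polys_over B" "degree q \<le> n" "coeff q n = b" "poly q x \<in> ?K" by blast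
        have "poly p x + poly q x \<in> ?K" using K p q unfolding submodule_def by blast
        moreover have "p + q \<in> polys_over B" using P p q unfolding is_subring_def by blast
        ultimately show "a + b \<in> ?S" using p q
          by (intro CollectI exI[of _ "p + q"]) (simp add: degree_add_le)
      next
        fix r a assume r: "r \<in> B" and "a \<in> ?S"
        then obtain p where p: "p \<in> polys_over B" "degree p \<le> n" "coeff p n = a" "poly p x \<in> ?K"
          by blast
        have "smult r p \<in> polys_over B" using p(1) r B by (simp add: polys_over_def is_subring_def)
        moreover have "degree (smult r p) \<le> n" using p(2) degree_smult_le[of r p] by linarith
        moreover have "r * poly p x \<in> ?K" using K r BR p(4) unfolding submodule_def by blast
        ultimately show "r * a \<in> ?S" using p(3)
          by (intro CollectI exI[of _ "smult r p"]) simp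
      qed
    qed
  qed
  have "poly p x \<in> ?K" if "p \<in> polys_over B" "degree p \<le> n" "poly p x \<in> M" for p n
    using that
  proof (induction n arbitrary: p)
    case 0
    then have "coeff p 0 \<in> L 0" unfolding L_def by blast
    then obtain q where q: "degree q \<le> 0" "coeff q 0 = coeff p 0" "poly q x \<in> ?K"
      using lift[of 0 "coeff p 0"] by auto
    have "p = q" using 0 q by (intro poly_eqI) (metis coeff_eq_0 le_0_eq neq0_conv)
    then show ?case using q by simp
  next
    case (Suc n)
    define k where "k = min (Suc n) N"
    have "coeff p (Suc n) \<in> L (Suc n)" unfolding L_def using Suc.prems by blast
    then have "coeff p (Suc n) \<in> L k" unfolding k_def min_def using stable by auto
    then obtain q where q: "q \<in> polys_over B" "degree q \<le> k" "coeff q k = coeff p (Suc n)" "poly q x \<in> ?K"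
      using lift[of k] by (auto simp: k_def)
    define d where "d = Suc n - k"
    have kd: "Suc n = d + k" by (simp add: d_def k_def)
    let ?q = "monom 1 d * q"
    have mono: "monom 1 d \<in> polys_over B" using B by (auto simp: polys_over_def coeff_monom is_subring_def)
    then have qB: "?q \<in> polys_over B" using P q(1) unfolding is_subring_def by blast
    have "poly (monom 1 d) x \<in> ?R" using polyR mono by blast
    then have qK: "poly ?q x \<in> ?K" using K q(4) unfolding submodule_def poly_mult by blast
    have deg_q: "degree ?q \<le> Suc n"
      using degree_mult_le[of "monom 1 d" q] degree_monom_le[of "1 :: 'a" d] q(2) kd by linarith
    have coeff_q: "coeff ?q (Suc n) = coeff p (Suc n)"
      unfolding kd using q(3) by (simp add: coeff_monom_mult kd)
    have "degree (p - ?q) \<le> n"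
    proof (rule degree_le, intro allI impI)
      fix i assume "n < i"
      then consider "i = Suc n" | "Suc n < i" by linarith
      then show "coeff (p - ?q) i = 0"
      proof cases
        case 1
        then show ?thesis using coeff_q by simp
      next
        case 2
        then have "coeff p i = 0" "coeff ?q i = 0"
          using Suc.prems(2) deg_q by (auto intro!: coeff_eq_0)
        then show ?thesis by simp
      qed
    qed
    moreover have "p - ?q \<in> polys_over B" using P Suc.prems(1) qB unfolding is_subring_def by blast
    moreover have "poly (p - ?q) x \<in> M"
      using submodule_minus[OF R M(1) Suc.prems(3)] qK KM by auto
    ultimately have "poly (p - ?q) x \<in> ?K" by (intro Suc.IH)
    then have "poly (p - ?q) x + poly ?q x \<in> ?K" using K qK unfolding submodule_def by blast
    then show ?case by simp
  qed
  note reach = this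
  have "M \<subseteq> ?K"
  proof
    fix a assume a: "a \<in> M"
    then obtain p where "p \<in> polys_over B" "a = poly p x"
      using M(2) unfolding adjoin_eq_poly_values[OF B] by blast
    then show "a \<in> ?K" using reach[of p "degree p"] a by simp
  qed
  then have "?K = M" using KM by blast
  moreover have "finite H" using G(1) by (simp add: H_def)
  ultimately show "\<exists>G. finite G \<and> submodule ?R hull G = M" by blast
qed

lemma noetherian_finite_type:
  assumes B: "is_subring B" "noetherian_subring B" and "finite G"
  shows "noetherian_subring (is_subring hull (B \<union> G))"
  using \<open>finite G\<close>
proof (induction G)
  case empty
  have "is_subring hull B = B" using B(1) by (rule hull_same)
  then show ?case using B(2) by simp
next
  case (insert g G)
  have "is_subring hull (B \<union> insert g G) = is_subring hull (insert g (is_subring hull (B \<union> G)))"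
    using hull_insert[of is_subring g "B \<union> G"] by simp
  then show ?case using hilbert_basis_adjoin[OF is_subring_hull insert.IH] by simp
qed

lemma noetherian_range_field_hom:
  fixes f :: "'k::field \<Rightarrow> 'a::comm_ring_1"
  assumes one: "f 1 = 1" and add: "\<And>x y. f (x + y) = f x + f y" and mult: "\<And>x y. f (x * y) = f x * f y"
  shows "is_subring (range f)" "noetherian_subring (range f)"
proof -
  have zero: "f 0 = 0" using add[of 0 0] by simp
  have diff: "f (x - y) = f x - f y" for x y using add[of "x - y" y] by simp
  show sub: "is_subring (range f)"
    unfolding is_subring_def using zero one by (auto simp flip: add diff mult)
  show "noetherian_subring (range f)"
    unfolding noetherian_subring_def
  proof (intro allI impI, elim conjE)
    fix M assume M: "submodule (range f) M" "M \<subseteq> range f"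
    show "\<exists>G. finite G \<and> submodule (range f) hull G = M"
    proof (cases "M \<subseteq> {0}")
      case True
      then have "M = {0}" using M(1) by (auto simp: submodule_def)
      then have "submodule (range f) hull {} = M"
        using M(1) by (intro hull_unique) (auto simp: submodule_def)
      then show ?thesis by blast
    next
      case False
      then obtain x where x: "f x \<in> M" "f x \<noteq> 0" using M(2) by auto
      then have "x \<noteq> 0" using zero by auto
      then have "f (inverse x) * f x = 1" by (simp add: one flip: mult)
      then have 1: "1 \<in> M" using M(1) x(1) unfolding submodule_def by (metis rangeI)
      have "submodule (range f) hull {1} = M"
      proof (rule hull_unique)
        fix T assume T: "{1} \<subseteq> T" "submodule (range f) T"
        then have "range f \<subseteq> T" unfolding submodule_def by (metis insert_subset mult.right_neutral subsetI)
        then show "M \<subseteq> T" using M(2) by simp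
      qed (use 1 M(1) in auto)
      then show ?thesis by blast
    qed
  qed
qed

lemma affine_curve_ideal_fg:
  fixes emb :: "'k::{alg_closed_field, field_char_0} \<Rightarrow> 'a::idom"
  assumes "affine_curve emb" "is_ideal (I :: 'a set)"
  shows "\<exists>G. finite G \<and> is_ideal hull G = I"
proof -
  interpret affine_curve emb by fact
  obtain G where G: "finite G" "is_subring hull (range emb \<union> G) = (UNIV :: 'a set)"
    using finite_type unfolding finitely_generated_algebra_def by blast
  have "noetherian_subring (UNIV :: 'a set)"
    using noetherian_finite_type[OF noetherian_range_field_hom[OF emb_one emb_add emb_mult] G(1)] G(2)
    by simp
  then show ?thesis using assms(2) by (simp add: noetherian_subring_def submodule_UNIV)
qed

section \<open>Normal Noetherian domains of dimension one\<close>

lemma is_ideal_hull: "is_ideal (is_ideal hull G)"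
  by (rule hull_in) (auto simp: is_ideal_def)

lemma is_ideal_dvd:
  assumes "is_ideal I" "a \<in> I" "a dvd b"
  shows "b \<in> I"
  using assms by (auto simp: is_ideal_def dvd_def mult.commute)

lemma is_ideal_eq_UNIV:
  assumes "is_ideal I" "1 \<in> I"
  shows "I = UNIV"
proof -
  have "r * 1 \<in> I" for r using assms unfolding is_ideal_def by blast
  then show ?thesis by auto
qed

abbreviation ideal_plus :: "'a::comm_ring_1 set \<Rightarrow> 'a \<Rightarrow> 'a set" where
  "ideal_plus I a \<equiv> {x + r * a | x r. x \<in> I}"

lemma is_ideal_ideal_plus:
  assumes "is_ideal I"
  shows "is_ideal (ideal_plus I a)"
  unfolding is_ideal_def
proof (intro conjI ballI allI)
  show "0 \<in> ideal_plus I a"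
    using assms by (intro CollectI exI[of _ 0]) (simp add: is_ideal_def)
next
  fix y z assume "y \<in> ideal_plus I a" "z \<in> ideal_plus I a"
  then obtain x r x' r' where "y = x + r * a" "x \<in> I" "z = x' + r' * a" "x' \<in> I" by blast
  then show "y + z \<in> ideal_plus I a" using assms
    by (intro CollectI exI[of _ "x + x'"] exI[of _ "r + r'"]) (auto simp: is_ideal_def algebra_simps)
next
  fix s y assume "y \<in> ideal_plus I a"
  then obtain x r where "y = x + r * a" "x \<in> I" by blast
  then show "s * y \<in> ideal_plus I a" using assms
    by (intro CollectI exI[of _ "s * x"] exI[of _ "s * r"]) (auto simp: is_ideal_def algebra_simps)
qed

lemma subset_ideal_plus:
  fixes I :: "'a::comm_ring_1 set"
  shows "I \<subseteq> ideal_plus I a"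
proof
  fix x assume "x \<in> I"
  then have "x = x + 0 * a \<and> x \<in> I" by simp
  then show "x \<in> ideal_plus I a" by blast
qed

lemma generator_in_ideal_plus:
  assumes "is_ideal I"
  shows "a \<in> ideal_plus I a"
proof -
  have "a = 0 + 1 * a \<and> 0 \<in> I" using assms by (simp add: is_ideal_def)
  then show ?thesis by blast
qed

lemma maximal_imp_prime_ideal:
  assumes P: "is_maximal_ideal P"
  shows "is_prime_ideal P"
  unfolding is_prime_ideal_def
proof (intro conjI allI impI)
  show I: "is_ideal P" and "P \<noteq> UNIV" using P by (simp_all add: is_maximal_ideal_def)
  fix a b assume ab: "a * b \<in> P"
  show "a \<in> P \<or> b \<in> P"
  proof (rule disj_imp[THEN iffD2], rule impI)
    assume "a \<notin> P"
    let ?J = "ideal_plus P a"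
    have "?J \<noteq> P" using generator_in_ideal_plus[OF I, of a] \<open>a \<notin> P\<close> by auto
    then have "?J = UNIV"
      using P is_ideal_ideal_plus[OF I, of a] subset_ideal_plus[of P a]
      unfolding is_maximal_ideal_def by blast
    then have "1 \<in> ?J" by simp
    then obtain x r where x: "x \<in> P" "1 = x + r * a" by blast
    have "b = b * x + r * (a * b)" using arg_cong[OF x(2), of "\<lambda>y. b * y"] by (simp add: algebra_simps)
    moreover have "b * x \<in> P" "r * (a * b) \<in> P" using I x(1) ab unfolding is_ideal_def by blast+
    ultimately show "b \<in> P" using I unfolding is_ideal_def by metis
  qed
qed

locale noetherian_domain =
  fixes ring_type :: "'a::idom itself"
  assumes ideal_fg: "is_ideal (I :: 'a set) \<Longrightarrow> \<exists>G. finite G \<and> is_ideal hull G = I"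
begin

text \<open>
  A finitely generated union of a chain of ideals is already a member of the chain, so Zorn's lemma
  applies.
\<close>

lemma ideal_maximal_member:
  fixes \<I> :: "'a set set"
  assumes "\<I> \<noteq> {}" and ideals: "\<And>I. I \<in> \<I> \<Longrightarrow> is_ideal I"
  shows "\<exists>M\<in>\<I>. \<forall>J\<in>\<I>. M \<subseteq> J \<longrightarrow> J = M"
proof (rule subset_Zorn_nonempty[OF assms(1)])
  fix \<C> assume ne: "\<C> \<noteq> {}" and ch: "subset.chain \<I> \<C>"
  have sub: "\<C> \<subseteq> \<I>" and tot: "\<And>I J. I \<in> \<C> \<Longrightarrow> J \<in> \<C> \<Longrightarrow> I \<subseteq> J \<or> J \<subseteq> I"
    using ch by (auto simp: subset.chain_def)
  have "is_ideal (\<Union>\<C>)"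
    unfolding is_ideal_def
  proof (intro conjI ballI allI)
    obtain I where "I \<in> \<C>" using ne by blast
    moreover have "0 \<in> I" using calculation sub ideals unfolding is_ideal_def by blast
    ultimately show "0 \<in> \<Union>\<C>" by blast
  next
    fix a b assume "a \<in> \<Union>\<C>" "b \<in> \<Union>\<C>"
    then obtain I J where IJ: "I \<in> \<C>" "J \<in> \<C>" "a \<in> I" "b \<in> J" by blast
    have "is_ideal I" "is_ideal J" using IJ sub ideals by auto
    then have "a + b \<in> I \<or> a + b \<in> J" using tot[OF IJ(1,2)] IJ unfolding is_ideal_def by blast
    then show "a + b \<in> \<Union>\<C>" using IJ by blast
  next
    fix r a assume "a \<in> \<Union>\<C>"
    then obtain I where I: "I \<in> \<C>" "a \<in> I" by blast
    then have "r * a \<in> I" using sub ideals unfolding is_ideal_def by blast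
    then show "r * a \<in> \<Union>\<C>" using I by blast
  qed
  then obtain G where G: "finite G" "is_ideal hull G = \<Union>\<C>" using ideal_fg by blast
  have "G \<subseteq> \<Union>\<C>" using hull_subset[of G is_ideal] G(2) by simp
  then obtain I where I: "I \<in> \<C>" "G \<subseteq> I" using finite_subset_Union_chain[OF G(1) _ ne ch] by metis
  have "is_ideal hull G \<subseteq> I" using I sub ideals by (intro hull_minimal) auto
  then have "\<Union>\<C> = I" using G(2) I(1) by auto
  then show "\<Union>\<C> \<in> \<I>" using I(1) sub by auto
qed

lemma points_prime:
  assumes "P \<in> points"
  shows "is_ideal P" "(1::'a) \<notin> P" "a * b \<in> P \<Longrightarrow> a \<in> P \<or> b \<in> P"
proof -
  have "is_prime_ideal P" using assms maximal_imp_prime_ideal by (simp add: points_def)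
  then show "is_ideal P" "(1::'a) \<notin> P" "a * b \<in> P \<Longrightarrow> a \<in> P \<or> b \<in> P"
    using is_ideal_eq_UNIV by (auto simp: is_prime_ideal_def)
qed

lemma ideal_in_point:
  assumes "is_ideal (I :: 'a set)" "1 \<notin> I"
  shows "\<exists>P\<in>points. I \<subseteq> P"
proof -
  let ?\<I> = "{J. is_ideal J \<and> I \<subseteq> J \<and> J \<noteq> UNIV}"
  have "I \<in> ?\<I>" using assms by auto
  then have "\<exists>M\<in>?\<I>. \<forall>J\<in>?\<I>. M \<subseteq> J \<longrightarrow> J = M"
    by (intro ideal_maximal_member) auto
  then obtain M where M: "M \<in> ?\<I>" and max: "\<And>J. J \<in> ?\<I> \<Longrightarrow> M \<subseteq> J \<Longrightarrow> J = M"
    by (elim bexE) simp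
  have "J = M \<or> J = UNIV" if "is_ideal J" "M \<subseteq> J" for J
    using max[of J] that M by auto
  then have "is_maximal_ideal M" using M by (simp add: is_maximal_ideal_def)
  then show ?thesis using M by (auto simp: points_def)
qed

end

locale dedekind_ring = noetherian_domain ring_type for ring_type :: "'a::idom itself" +
  assumes nonzero_prime_maximal: "is_prime_ideal (P :: 'a set) \<Longrightarrow> P \<noteq> {0} \<Longrightarrow> is_maximal_ideal P"
    and zero_not_maximal: "\<not> is_maximal_ideal ({0} :: 'a set)"
    and integrally_closed: "integrally_closed_domain TYPE('a)"
begin

lemma points_contain_nonzero:
  assumes "(P :: 'a set) \<in> points"
  obtains a where "a \<in> P" "a \<noteq> 0"
proof -
  have "P \<noteq> {0}" using assms zero_not_maximal by (auto simp: points_def)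
  moreover have "0 \<in> P" using points_prime(1)[OF assms] by (simp add: is_ideal_def)
  ultimately show ?thesis using that by blast
qed

lemma points_not_subset:
  assumes "(P :: 'a set) \<in> points" "Q \<in> points" "P \<noteq> Q"
  obtains u where "u \<in> Q" "u \<notin> P"
  using assms unfolding points_def is_maximal_ideal_def by blast

lemma points_mult_notin:
  assumes "(P :: 'a set) \<in> points" "a \<notin> P" "b \<notin> P"
  shows "a * b \<notin> P"
  using points_prime(3)[OF assms(1)] assms by blast

lemma points_prod_notin:
  assumes "(P :: 'a set) \<in> points" "finite X" "\<And>i. i \<in> X \<Longrightarrow> f i \<notin> P"
  shows "prod f X \<notin> P"
  using assms(2,3)
  by (induction X rule: finite_induct) (simp_all add: points_prime(2)[OF assms(1)] points_mult_notin[OF assms(1)])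

text \<open>
  Noetherian induction: a largest ideal \<open>M\<close> lying in infinitely many points is not prime, and if
  \<open>a * b \<in> M\<close>, every point over \<open>M\<close> lies over \<open>M + (a)\<close> or over \<open>M + (b)\<close>.
\<close>

lemma finite_points_over:
  assumes "is_ideal (I :: 'a set)" "I \<noteq> {0}"
  shows "finite {P\<in>points. I \<subseteq> P}"
proof (rule ccontr)
  assume inf: "infinite {P\<in>points. I \<subseteq> P}"
  let ?\<I> = "{J :: 'a set. is_ideal J \<and> J \<noteq> {0} \<and> infinite {P\<in>points. J \<subseteq> P}}"
  have "\<exists>M\<in>?\<I>. \<forall>J\<in>?\<I>. M \<subseteq> J \<longrightarrow> J = M"
  proof (rule ideal_maximal_member)
    have "I \<in> ?\<I>" using assms inf by auto
    then show "?\<I> \<noteq> {}" by (metis empty_iff)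
  qed auto
  then obtain M where M: "M \<in> ?\<I>" "\<And>J. J \<in> ?\<I> \<Longrightarrow> M \<subseteq> J \<Longrightarrow> J = M"
    by (elim bexE) simp
  have Mi: "is_ideal M" "M \<noteq> {0}" using M(1) by auto
  have infM: "infinite {P\<in>points. M \<subseteq> P}" using M(1) by simp
  obtain P where "P \<in> points" "M \<subseteq> P" using infinite_imp_nonempty[OF infM] by blast
  then have "M \<noteq> UNIV" using points_prime(2)[of P] by blast
  have "\<not> is_maximal_ideal M"
  proof
    assume "is_maximal_ideal M"
    then have "{P\<in>points. M \<subseteq> P} \<subseteq> {M}" by (auto simp: points_def is_maximal_ideal_def)
    from finite_subset[OF this] show False using infM by simp
  qed
  then have "\<not> is_prime_ideal M" using nonzero_prime_maximal Mi(2) by blast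
  then obtain a b where ab: "a * b \<in> M" "a \<notin> M" "b \<notin> M"
    using Mi \<open>M \<noteq> UNIV\<close> unfolding is_prime_ideal_def by blast
  have fin: "finite {P\<in>points. ideal_plus M c \<subseteq> P}" if c: "c \<notin> M" for c
  proof (rule ccontr)
    assume inf: "infinite {P\<in>points. ideal_plus M c \<subseteq> P}"
    have "ideal_plus M c \<noteq> {0}" using subset_ideal_plus[of M c] Mi
      by (auto simp: is_ideal_def)
    then have "ideal_plus M c \<in> ?\<I>" using inf is_ideal_ideal_plus[OF Mi(1)] by blast
    from M(2)[OF this subset_ideal_plus] show False
      using c generator_in_ideal_plus[OF Mi(1), of c] by blast
  qed
  have "{P\<in>points. M \<subseteq> P} \<subseteq> {P\<in>points. ideal_plus M a \<subseteq> P} \<union> {P\<in>points. ideal_plus M b \<subseteq> P}"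
  proof
    fix P assume "P \<in> {P\<in>points. M \<subseteq> P}"
    then have P: "P \<in> points" "M \<subseteq> P" by auto
    have "ideal_plus M c \<subseteq> P" if "c \<in> P" for c
      using points_prime(1)[OF P(1)] P(2) that unfolding is_ideal_def by blast
    moreover have "a \<in> P \<or> b \<in> P" using points_prime(3)[OF P(1)] ab(1) P(2) by blast
    ultimately show "P \<in> {P\<in>points. ideal_plus M a \<subseteq> P} \<union> {P\<in>points. ideal_plus M b \<subseteq> P}"
      using P(1) by blast
  qed
  from finite_subset[OF this] show False using infM fin[OF ab(2)] fin[OF ab(3)] by simp
qed

text \<open>
  All products \<open>z 0 * (b / a) ^ n\<close> lie in the ring.  The ideals generated by the first of them become
  stationary, which gives a monic equation for \<open>b / a\<close>.
\<close>

lemma integral_quotient: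
  fixes a b :: 'a and z :: "nat \<Rightarrow> 'a"
  assumes a: "a \<noteq> 0" and z0: "z 0 \<noteq> 0" and z: "\<And>n. a * z (Suc n) = b * z n"
  shows "a dvd b"
proof -
  let ?\<I> = "range (\<lambda>n. is_ideal hull (z ` {..n}))"
  have "\<exists>M\<in>?\<I>. \<forall>J\<in>?\<I>. M \<subseteq> J \<longrightarrow> J = M"
    using is_ideal_hull by (intro ideal_maximal_member) auto
  then obtain n where n: "\<And>m. is_ideal hull (z ` {..n}) \<subseteq> is_ideal hull (z ` {..m}) \<Longrightarrow>
      is_ideal hull (z ` {..m}) = is_ideal hull (z ` {..n})" by auto
  have "z (Suc n) \<in> is_ideal hull (z ` {..Suc n})" by (intro hull_inc) auto
  also have "\<dots> = is_ideal hull (z ` {..n})" by (intro n hull_mono) auto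
  finally have "\<exists>r. z (Suc n) = (\<Sum>i\<le>n. r i * z i)"
  proof (rule hull_induct)
    fix y assume "y \<in> z ` {..n}"
    then obtain j where j: "j \<le> n" "y = z j" by auto
    have "(\<Sum>i\<le>n. (if i = j then 1 else 0) * z i) = y"
      using j by (simp add: mult_delta_left)
    then show "\<exists>r. y = (\<Sum>i\<le>n. r i * z i)" by (intro exI[of _ "\<lambda>i. if i = j then 1 else 0"]) simp
  next
    let ?S = "{y. \<exists>r. y = (\<Sum>i\<le>n. r i * z i)}"
    show "is_ideal ?S"
      unfolding is_ideal_def
    proof (intro conjI ballI allI)
      show "0 \<in> ?S" by (intro CollectI exI[of _ "\<lambda>_. 0"]) simp
    next
      fix x y assume "x \<in> ?S" "y \<in> ?S"
      then obtain r s where "x = (\<Sum>i\<le>n. r i * z i)" "y = (\<Sum>i\<le>n. s i * z i)" by blast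
      then show "x + y \<in> ?S"
        by (intro CollectI exI[of _ "\<lambda>i. r i + s i"]) (simp add: algebra_simps sum.distrib)
    next
      fix c x assume "x \<in> ?S"
      then obtain r where "x = (\<Sum>i\<le>n. r i * z i)" by blast
      then show "c * x \<in> ?S"
        by (intro CollectI exI[of _ "\<lambda>i. c * r i"]) (simp add: algebra_simps sum_distrib_left)
    qed
  qed
  then obtain r where r: "z (Suc n) = (\<Sum>i\<le>n. r i * z i)" by blast
  define x where "x = to_fract b / to_fract a"
  have a': "to_fract a \<noteq> 0" using a by simp
  have zx: "to_fract (z i) = to_fract (z 0) * x ^ i" for i
  proof (induction i)
    case (Suc i)
    have "to_fract a * to_fract (z (Suc i)) = to_fract b * to_fract (z i)"
      using arg_cong[OF z[of i], of to_fract] by simp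
    then show ?case using a' Suc by (simp add: x_def field_simps)
  qed simp
  have "to_fract (z (Suc n)) = (\<Sum>i\<le>n. to_fract (r i) * to_fract (z i))"
    using arg_cong[OF r, of to_fract] by simp
  also have "\<dots> = (\<Sum>i\<le>n. to_fract (z 0) * (to_fract (r i) * x ^ i))"
  proof (rule sum.cong[OF refl])
    fix i
    show "to_fract (r i) * to_fract (z i) = to_fract (z 0) * (to_fract (r i) * x ^ i)"
      unfolding zx[of i] by (rule mult.left_commute)
  qed
  finally have "to_fract (z 0) * x ^ Suc n = to_fract (z 0) * (\<Sum>i\<le>n. to_fract (r i) * x ^ i)"
    unfolding zx[of "Suc n"] sum_distrib_left .
  then have x: "x ^ Suc n = (\<Sum>i\<le>n. to_fract (r i) * x ^ i)" using z0 by simp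
  define p where "p = monom 1 (Suc n) - (\<Sum>i\<le>n. monom (r i) i)"
  have coeff_p: "coeff p i = (if i = Suc n then 1 else if i \<le> n then - r i else 0)" for i
    by (auto simp: p_def coeff_sum coeff_monom)
  have deg: "degree p = Suc n"
    by (intro antisym degree_le le_degree) (auto simp: coeff_p)
  have "poly (map_poly to_fract p) x = (\<Sum>i\<le>Suc n. to_fract (coeff p i) * x ^ i)"
    using deg by (simp add: poly_altdef degree_map_poly coeff_map_poly)
  also have "\<dots> = x ^ Suc n - (\<Sum>i\<le>n. to_fract (r i) * x ^ i)"
    by (simp add: coeff_p sum_negf)
  finally have "poly (map_poly to_fract p) x = 0" using x by simp
  moreover have "lead_coeff p = 1" using deg by (simp add: coeff_p)
  ultimately have "x \<in> range to_fract"
    using integrally_closed unfolding integrally_closed_domain_def by blast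
  then obtain c where "x = to_fract c" by blast
  then have "to_fract b = to_fract (a * c)" using a' by (simp add: x_def field_simps)
  then have "b = a * c" by (simp only: to_fract_eq_iff)
  then show ?thesis by simp
qed

text \<open>
  Take \<open>a \<noteq> 0\<close> in \<open>P\<close>.  A largest proper colon ideal of \<open>a\<close> in the local ring is prime, hence equal to \<open>P\<close>;
  this yields \<open>b'\<close> such that \<open>x = b' / a\<close> is not in the local ring although \<open>x P\<close> consists of elements of
  the ring.  If \<open>x P \<subseteq> P\<close>, then \<open>x\<close> would be integral; so some \<open>t \<in> P\<close> has \<open>x t \<notin> P\<close>, and
  \<open>(x t) q = (x q) t\<close> shows that \<open>t\<close> generates \<open>P\<close> locally.
\<close>

lemma ex_uniformizer:
  assumes P: "(P :: 'a set) \<in> points"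
  shows "\<exists>t\<in>P. t \<noteq> 0 \<and> (\<forall>q\<in>P. \<exists>s c. s \<notin> P \<and> s * q = c * t)"
proof -
  note Pi = points_prime(1)[OF P] and P1 = points_prime(2)[OF P]
  note notin = points_mult_notin[OF P]
  have P_mult: "r * x \<in> P" "x * r \<in> P" if "x \<in> P" for r x
    using Pi that by (auto simp: is_ideal_def mult.commute)
  obtain a where a: "a \<in> P" "a \<noteq> 0" using points_contain_nonzero[OF P] .
  define Q where "Q b = {r. \<exists>s. s \<notin> P \<and> a dvd s * r * b}" for b
  have Qi: "is_ideal (Q b)" for b
    unfolding is_ideal_def
  proof (intro conjI ballI allI)
    show "0 \<in> Q b" using P1 by (auto simp: Q_def)
  next
    fix x y assume "x \<in> Q b" "y \<in> Q b"
    then obtain s s' where s: "s \<notin> P" "a dvd s * x * b" "s' \<notin> P" "a dvd s' * y * b"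
      unfolding Q_def by blast
    have "a dvd s' * (s * x * b) + s * (s' * y * b)" by (rule dvd_add[OF dvd_mult[OF s(2)] dvd_mult[OF s(4)]])
    also have "s' * (s * x * b) + s * (s' * y * b) = (s * s') * (x + y) * b" by (simp add: algebra_simps)
    finally show "x + y \<in> Q b" using notin[OF s(1,3)] unfolding Q_def by blast
  next
    fix r x assume "x \<in> Q b"
    then obtain s where s: "s \<notin> P" "a dvd s * x * b" unfolding Q_def by blast
    have "a dvd r * (s * x * b)" using s(2) by (rule dvd_mult)
    also have "r * (s * x * b) = s * (r * x) * b" by (simp add: algebra_simps)
    finally show "r * x \<in> Q b" using s(1) unfolding Q_def by blast
  qed
  have Q_mult: "r' \<in> Q (r * b) \<longleftrightarrow> r * r' \<in> Q b" for r r' b by (simp add: Q_def mult.assoc mult.left_commute)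
  let ?\<I> = "{Q b | b. 1 \<notin> Q b}"
  have "1 \<notin> Q 1" using is_ideal_dvd[OF Pi a(1)] by (auto simp: Q_def)
  then have "?\<I> \<noteq> {}" by blast
  then have "\<exists>M\<in>?\<I>. \<forall>J\<in>?\<I>. M \<subseteq> J \<longrightarrow> J = M"
    using Qi by (intro ideal_maximal_member) auto
  then obtain b where b: "1 \<notin> Q b" and b_max: "\<And>b'. 1 \<notin> Q b' \<Longrightarrow> Q b \<subseteq> Q b' \<Longrightarrow> Q b' = Q b"
    by auto
  have "is_prime_ideal (Q b)"
    unfolding is_prime_ideal_def
  proof (intro conjI allI impI)
    show "is_ideal (Q b)" by (rule Qi)
    show "Q b \<noteq> UNIV" using b by auto
    fix r r' assume rr: "r * r' \<in> Q b"
    show "r \<in> Q b \<or> r' \<in> Q b"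
    proof (rule disj_imp[THEN iffD2], rule impI)
      assume r: "r \<notin> Q b"
      have "1 \<notin> Q (r * b)" using r by (simp add: Q_mult)
      moreover have "Q b \<subseteq> Q (r * b)" using Qi[of b] by (auto simp: Q_mult is_ideal_def)
      ultimately have "Q (r * b) = Q b" by (rule b_max)
      then show "r' \<in> Q b" using rr Q_mult by blast
    qed
  qed
  moreover have "a \<in> Q b" unfolding Q_def by (intro CollectI exI[of _ 1]) (simp add: P1)
  then have "Q b \<noteq> {0}" using a(2) by auto
  ultimately have "is_maximal_ideal (Q b)" by (rule nonzero_prime_maximal)
  moreover have "Q b \<subseteq> P"
  proof (rule subsetI, rule ccontr)
    fix r assume "r \<in> Q b" "r \<notin> P"
    then obtain s where s: "s \<notin> P" "a dvd s * r * b" unfolding Q_def by blast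
    then have "1 \<in> Q b" using notin[OF s(1) \<open>r \<notin> P\<close>] unfolding Q_def by (intro CollectI exI[of _ "s * r"]) simp
    then show False using b by blast
  qed
  ultimately have QP: "Q b = P" using Pi P1 unfolding is_maximal_ideal_def by blast
  obtain G where G: "finite G" "is_ideal hull G = P" using ideal_fg[OF Pi] by blast
  have "\<forall>g\<in>G. \<exists>s. s \<notin> P \<and> a dvd s * g * b"
    using hull_subset[of G is_ideal] G(2) QP unfolding Q_def by blast
  then obtain s where s: "\<And>g. g \<in> G \<Longrightarrow> s g \<notin> P \<and> a dvd s g * g * b" by metis
  define b' where "b' = prod s G * b"
  have prod_s: "prod s G \<notin> P" using points_prod_notin[OF P G(1)] s by blast
  have "a dvd q * b'" if "q \<in> P" for q
  proof -
    have "q \<in> is_ideal hull G" using that G(2) by simp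
    then show ?thesis
    proof (rule hull_induct)
      fix g assume g: "g \<in> G"
      have "prod s G = s g * prod s (G - {g})" using prod.remove[OF G(1) g] .
      then have "g * b' = (s g * g * b) * prod s (G - {g})" by (simp add: b'_def algebra_simps)
      then show "a dvd g * b'" using s[OF g] by (metis dvd_mult2)
    next
      show "is_ideal {q. a dvd q * b'}" by (auto simp: is_ideal_def distrib_right mult.assoc)
    qed
  qed
  then obtain y where y: "\<And>q. q \<in> P \<Longrightarrow> q * b' = a * y q" unfolding dvd_def by metis
  have "\<exists>t\<in>P. y t \<notin> P"
  proof (rule ccontr)
    assume "\<not> (\<exists>t\<in>P. y t \<notin> P)"
    then have yP: "\<And>q. q \<in> P \<Longrightarrow> y q \<in> P" by blast
    define z where "z n = (y ^^ n) a" for n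
    have zP: "z n \<in> P" for n by (induction n) (simp_all add: z_def a(1) yP)
    have "a dvd b'"
    proof (rule integral_quotient[of a z])
      show "a * z (Suc n) = b' * z n" for n using y[OF zP[of n]] by (simp add: z_def mult.commute)
    qed (simp_all add: z_def a)
    then have "1 \<in> Q b" using prod_s unfolding Q_def b'_def by (intro CollectI exI[of _ "prod s G"]) simp
    then show False using b by blast
  qed
  then obtain t where t: "t \<in> P" "y t \<notin> P" by blast
  have "t \<noteq> 0"
  proof
    assume "t = 0"
    then have "y t = 0" using y[OF t(1)] a(2) by simp
    then show False using t(2) Pi by (simp add: is_ideal_def)
  qed
  moreover have "\<exists>s c. s \<notin> P \<and> s * q = c * t" if q: "q \<in> P" for q
  proof -
    have "a * (y t * q) = q * (t * b')" using y[OF t(1)] by (simp add: algebra_simps)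
    also have "\<dots> = t * (q * b')" by (simp add: algebra_simps)
    also have "\<dots> = a * (y q * t)" using y[OF q] by (simp add: algebra_simps)
    finally have "y t * q = y q * t" using a(2) by simp
    then show ?thesis using t(2) by blast
  qed
  ultimately show ?thesis using t(1) by blast
qed

end

section \<open>Orders and sections at the points of a normal curve\<close>

definition local_units :: "'a::idom set \<Rightarrow> 'a fract set" where
  "local_units P = {u. u \<noteq> 0 \<and> u \<in> local_ring P \<and> inverse u \<in> local_ring P}"

context dedekind_ring
begin

lemma local_ring_iff: "\<phi> \<in> local_ring P \<longleftrightarrow> (\<exists>a b. b \<notin> P \<and> \<phi> = to_fract a / to_fract (b :: 'a))"
  by (auto simp: local_ring_def Fract_conv_to_fract)

lemma to_fract_notin_point: "P \<in> points \<Longrightarrow> (b :: 'a) \<notin> P \<Longrightarrow> to_fract b \<noteq> 0"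
  using points_prime(1) by (auto simp: is_ideal_def)

lemma local_ring_to_fract: "(P :: 'a set) \<in> points \<Longrightarrow> to_fract a \<in> local_ring P"
  unfolding local_ring_iff using points_prime(2) by (intro exI[of _ a] exI[of _ 1]) auto

lemma local_ring_closed:
  assumes P: "(P :: 'a set) \<in> points" and "\<phi> \<in> local_ring P" "\<psi> \<in> local_ring P"
  shows "\<phi> + \<psi> \<in> local_ring P" "\<phi> * \<psi> \<in> local_ring P"
proof -
  obtain a b where b: "b \<notin> P" "\<phi> = to_fract a / to_fract b" using assms(2) unfolding local_ring_iff by blast
  obtain c d where d: "d \<notin> P" "\<psi> = to_fract c / to_fract d" using assms(3) unfolding local_ring_iff by blast
  note bd = points_mult_notin[OF P b(1) d(1)]
  have nz: "to_fract b \<noteq> 0" "to_fract d \<noteq> 0" using to_fract_notin_point[OF P] b d by auto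
  have "\<phi> + \<psi> = to_fract (a * d + c * b) / to_fract (b * d)"
    unfolding b(2) d(2) using nz by (simp add: add_frac_eq)
  then show "\<phi> + \<psi> \<in> local_ring P" unfolding local_ring_iff using bd by blast
  have "\<phi> * \<psi> = to_fract (a * c) / to_fract (b * d)"
    unfolding b(2) d(2) by simp
  then show "\<phi> * \<psi> \<in> local_ring P" unfolding local_ring_iff using bd by blast
qed

lemma local_ring_power:
  assumes "(P :: 'a set) \<in> points" "\<phi> \<in> local_ring P"
  shows "\<phi> ^ n \<in> local_ring P"
proof (induction n)
  case 0
  then show ?case using local_ring_to_fract[OF assms(1), of 1] by simp
next
  case (Suc n)
  then show ?case using local_ring_closed(2)[OF assms(1,2)] by simp
qed

lemma local_unit_to_fract:
  assumes "(P :: 'a set) \<in> points" "b \<notin> P"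
  shows "to_fract b \<in> local_units P"
proof -
  have "inverse (to_fract b) \<in> local_ring P"
    unfolding local_ring_iff using assms(2) by (intro exI[of _ 1] exI[of _ b]) (simp add: inverse_eq_divide)
  then show ?thesis using local_ring_to_fract[OF assms(1)] to_fract_notin_point[OF assms]
    by (simp add: local_units_def)
qed

lemma local_units_inverse: "u \<in> local_units P \<Longrightarrow> inverse u \<in> local_units P"
  by (simp add: local_units_def)

lemma local_units_mult:
  assumes "(P :: 'a set) \<in> points" "u \<in> local_units P" "v \<in> local_units P"
  shows "u * v \<in> local_units P"
  using assms by (simp add: local_units_def local_ring_closed)

lemma local_units_power_int:
  assumes "(P :: 'a set) \<in> points" "u \<in> local_units P"
  shows "u powi n \<in> local_units P"
proof -
  have "v ^ k \<in> local_units P" if "v \<in> local_units P" for v k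
    using local_ring_power[OF assms(1)] that by (simp add: local_units_def flip: power_inverse)
  then show ?thesis
    using assms(2) local_units_inverse unfolding power_int_def by metis
qed

lemma local_max_ideal_iff:
  "\<phi> \<in> local_max_ideal P \<longleftrightarrow> (\<exists>a b. a \<in> P \<and> b \<notin> P \<and> \<phi> = to_fract a / to_fract (b :: 'a))"
  by (auto simp: local_max_ideal_def Fract_conv_to_fract)

definition uniformizes :: "'a fract \<Rightarrow> 'a set \<Rightarrow> bool" where
  "uniformizes t P \<longleftrightarrow> local_max_ideal P = (\<lambda>x. t * x) ` local_ring P"

lemma ex_uniformizes:
  assumes P: "(P :: 'a set) \<in> points"
  shows "\<exists>t\<in>P. t \<noteq> 0 \<and> uniformizes (to_fract t) P"
proof -
  obtain t where t: "t \<in> P" "t \<noteq> 0" and gen: "\<And>q. q \<in> P \<Longrightarrow> \<exists>s c. s \<notin> P \<and> s * q = c * t"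
    using ex_uniformizer[OF P] by blast
  have "local_max_ideal P = (\<lambda>x. to_fract t * x) ` local_ring P"
  proof
    show "local_max_ideal P \<subseteq> (\<lambda>x. to_fract t * x) ` local_ring P"
    proof
      fix \<phi> assume "\<phi> \<in> local_max_ideal P"
      then obtain q b where q: "q \<in> P" "b \<notin> P" "\<phi> = to_fract q / to_fract b"
        unfolding local_max_ideal_iff by blast
      obtain s c where s: "s \<notin> P" "s * q = c * t" using gen[OF q(1)] by blast
      have nz: "to_fract b \<noteq> 0" "to_fract s \<noteq> 0" using to_fract_notin_point[OF P] q s by auto
      have "to_fract s * to_fract q = to_fract c * to_fract t" using arg_cong[OF s(2), of to_fract] by simp
      then have "\<phi> = to_fract t * (to_fract c / to_fract (s * b))"
        unfolding q(3) using nz by (simp add: field_simps)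
      moreover have "to_fract c / to_fract (s * b) \<in> local_ring P"
        unfolding local_ring_iff using points_mult_notin[OF P s(1) q(2)] by blast
      ultimately show "\<phi> \<in> (\<lambda>x. to_fract t * x) ` local_ring P" by blast
    qed
    show "(\<lambda>x. to_fract t * x) ` local_ring P \<subseteq> local_max_ideal P"
    proof
      fix \<phi> assume "\<phi> \<in> (\<lambda>x. to_fract t * x) ` local_ring P"
      then obtain x where x: "x \<in> local_ring P" "\<phi> = to_fract t * x" by blast
      obtain a b where b: "b \<notin> P" "x = to_fract a / to_fract b"
        using x(1) unfolding local_ring_iff by blast
      have "a * t \<in> P" using points_prime(1)[OF P] t(1) by (simp add: is_ideal_def)
      moreover have "\<phi> = to_fract (a * t) / to_fract b" using b(2) x(2) by simp
      ultimately show "\<phi> \<in> local_max_ideal P" unfolding local_max_ideal_iff using b(1) by blast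
    qed
  qed
  then show ?thesis using t unfolding uniformizes_def by blast
qed

lemma one_notin_local_max_ideal:
  assumes P: "(P :: 'a set) \<in> points"
  shows "1 \<notin> local_max_ideal P"
proof
  assume "1 \<in> local_max_ideal P"
  then obtain a b where ab: "a \<in> P" "b \<notin> P" "1 = to_fract a / to_fract b"
    unfolding local_max_ideal_iff by blast
  then have "to_fract a = to_fract b" using to_fract_notin_point[OF P ab(2)] by (simp add: field_simps)
  then show False using ab by simp
qed

lemma uniformizes_props:
  assumes P: "(P :: 'a set) \<in> points" and t: "uniformizes t P"
  shows "t \<in> local_max_ideal P" "t \<in> local_ring P" "t \<noteq> 0" "inverse t \<notin> local_ring P"
proof -
  have "1 \<in> local_ring P" using local_ring_to_fract[OF P, of 1] by simp
  then show *: "t \<in> local_max_ideal P" using t unfolding uniformizes_def by force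
  then show "t \<in> local_ring P" unfolding local_max_ideal_iff local_ring_iff by blast
  obtain t' where t': "t' \<in> P" "t' \<noteq> 0" using points_contain_nonzero[OF P] .
  have "to_fract t' = to_fract t' / to_fract 1" by simp
  then have "to_fract t' \<in> local_max_ideal P"
    unfolding local_max_ideal_iff using t'(1) points_prime(2)[OF P] by blast
  then show nz: "t \<noteq> 0" using t t'(2) unfolding uniformizes_def by auto
  show "inverse t \<notin> local_ring P"
  proof
    assume "inverse t \<in> local_ring P"
    then have "t * inverse t \<in> local_max_ideal P" using t unfolding uniformizes_def by blast
    then show False using nz one_notin_local_max_ideal[OF P] by simp
  qed
qed

lemma uniformizer_power_not_unit:
  assumes P: "(P :: 'a set) \<in> points" and t: "uniformizes t P" and k: "k > 0"
  shows "t powi k \<notin> local_units P" "t powi (- k) * u \<in> local_ring P \<Longrightarrow> u \<notin> local_units P"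
proof -
  note tp = uniformizes_props[OF P t]
  have pow: "t powi (k - 1) \<in> local_ring P"
    using local_ring_power[OF P tp(2)] k by (simp add: power_int_def)
  have inv: "inverse t = t powi (- k) * t powi (k - 1)"
    using tp(3) by (simp flip: power_int_add)
  show *: "u \<notin> local_units P" if "t powi (- k) * u \<in> local_ring P" for u
  proof
    assume u: "u \<in> local_units P"
    then have "(t powi (- k) * u) * inverse u \<in> local_ring P"
      using local_ring_closed(2)[OF P that] by (simp add: local_units_def)
    then have "t powi (- k) \<in> local_ring P" using u by (simp add: local_units_def mult.assoc)
    then have "inverse t \<in> local_ring P" unfolding inv using pow by (intro local_ring_closed(2)[OF P])
    then show False using tp(4) by blast
  qed
  show "t powi k \<notin> local_units P"
  proof (rule *)
    have "t powi (- k) * t powi k = 1" using tp(3) by (simp flip: power_int_add)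
    then show "t powi (- k) * t powi k \<in> local_ring P" using local_ring_to_fract[OF P, of 1] by simp
  qed
qed

lemma uniformizers_associated:
  assumes P: "(P :: 'a set) \<in> points" and t: "uniformizes t P" "uniformizes t' P"
  shows "\<exists>w\<in>local_units P. t' = t * w"
proof -
  obtain w where w: "w \<in> local_ring P" "t' = t * w"
    using uniformizes_props(1)[OF P t(2)] t(1) unfolding uniformizes_def by blast
  obtain w' where w': "w' \<in> local_ring P" "t = t' * w'"
    using uniformizes_props(1)[OF P t(1)] t(2) unfolding uniformizes_def by blast
  have nz: "t' \<noteq> 0" using uniformizes_props(3)[OF P t(2)] .
  then have "w \<noteq> 0" using w(2) by auto
  moreover have "t' * 1 = t' * (w' * w)" using w(2) unfolding w'(2) by (simp add: mult.assoc)
  then have "1 = w' * w" using nz by (metis mult_left_cancel)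
  then have "inverse w = w'" using \<open>w \<noteq> 0\<close> by (simp add: field_simps)
  ultimately show ?thesis using w w' by (auto simp: local_units_def)
qed

lemma ord_at_eqI:
  assumes P: "(P :: 'a set) \<in> points" and t: "uniformizes t P" and u: "u \<in> local_units P"
    and \<phi>: "\<phi> = t powi n * u"
  shows "ord_at P \<phi> = n"
  unfolding ord_at_def
proof (rule the_equality)
  show "\<exists>t u. local_max_ideal P = (\<lambda>x. t * x) ` local_ring P \<and>
      u \<noteq> 0 \<and> u \<in> local_ring P \<and> inverse u \<in> local_ring P \<and> \<phi> = t powi n * u"
    using t u \<phi> unfolding uniformizes_def local_units_def by blast
next
  fix m assume "\<exists>t u. local_max_ideal P = (\<lambda>x. t * x) ` local_ring P \<and>
      u \<noteq> 0 \<and> u \<in> local_ring P \<and> inverse u \<in> local_ring P \<and> \<phi> = t powi m * u"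
  then obtain t' u' where t': "uniformizes t' P" and u': "u' \<in> local_units P" and \<phi>': "\<phi> = t' powi m * u'"
    unfolding uniformizes_def local_units_def by blast
  obtain w where w: "w \<in> local_units P" "t' = t * w" using uniformizers_associated[OF P t t'] by blast
  have nz: "t \<noteq> 0" "u \<noteq> 0" "u' \<noteq> 0" using uniformizes_props(3)[OF P t] u u' by (auto simp: local_units_def)
  have wm: "w powi m * u' \<in> local_units P" using local_units_mult[OF P local_units_power_int[OF P w(1)] u'] .
  have eq: "t powi n * u = t powi m * (w powi m * u')"
    using \<phi> \<phi>' w(2) by (simp add: power_int_mult_distrib mult.assoc)
  have unit: "t powi (n - m) \<in> local_units P"
  proof -
    have "t powi n = t powi m * (w powi m * u') * inverse u" using eq nz by (simp add: field_simps)
    then have "t powi (n - m) = (w powi m * u') * inverse u"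
      using nz by (simp add: power_int_diff field_simps)
    then show ?thesis using local_units_mult[OF P wm local_units_inverse[OF u]] by simp
  qed
  have "\<not> n - m > 0" using uniformizer_power_not_unit(1)[OF P t] unit by blast
  moreover have "\<not> m - n > 0"
  proof
    assume mn: "m - n > 0"
    have "t powi (m - n) = inverse (t powi (n - m))" by (simp flip: power_int_minus)
    then show False using uniformizer_power_not_unit(1)[OF P t mn] local_units_inverse[OF unit] by simp
  qed
  ultimately show "m = n" by simp
qed

text \<open>
  Split off factors \<open>t\<close> from a ring element as long as the cofactor lies in \<open>P\<close>.  The ideals generated by
  the cofactors in the local ring grow strictly, so this stops.
\<close>

lemma uniformizer_factorization:
  assumes P: "(P :: 'a set) \<in> points" and t: "t \<in> P" "t \<noteq> 0" "uniformizes (to_fract t) P" and \<phi>: "\<phi> \<noteq> 0"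
  shows "\<exists>n. \<exists>u\<in>local_units P. \<phi> = to_fract t powi n * u"
proof -
  have regular: "\<exists>n. \<exists>u\<in>local_units P. to_fract a = to_fract t powi n * u" if a: "a \<noteq> 0" for a
  proof -
    define Z where "Z = {c. c \<noteq> 0 \<and> (\<exists>n s. s \<notin> P \<and> s * a = t ^ n * c)}"
    define J where "J c = {r. \<exists>s. s \<notin> P \<and> c dvd s * r}" for c
    have J: "is_ideal (J c)" for c
      unfolding is_ideal_def
    proof (intro conjI ballI allI)
      show "0 \<in> J c" using points_prime(2)[OF P] by (auto simp: J_def)
    next
      fix x y assume "x \<in> J c" "y \<in> J c"
      then obtain s s' where s: "s \<notin> P" "c dvd s * x" "s' \<notin> P" "c dvd s' * y"
        unfolding J_def by blast
      have "c dvd s' * (s * x) + s * (s' * y)" by (rule dvd_add[OF dvd_mult[OF s(2)] dvd_mult[OF s(4)]])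
      also have "s' * (s * x) + s * (s' * y) = (s * s') * (x + y)" by (simp add: algebra_simps)
      finally show "x + y \<in> J c" using points_mult_notin[OF P s(1,3)] unfolding J_def by blast
    next
      fix r x assume "x \<in> J c"
      then obtain s where s: "s \<notin> P" "c dvd s * x" unfolding J_def by blast
      have "c dvd r * (s * x)" using s(2) by (rule dvd_mult)
      also have "r * (s * x) = s * (r * x)" by (simp add: algebra_simps)
      finally show "r * x \<in> J c" using s(1) unfolding J_def by blast
    qed
    have "1 * a = t ^ 0 * a" by simp
    then have "a \<in> Z" using a points_prime(2)[OF P] unfolding Z_def by blast
    then have "\<exists>M\<in>J ` Z. \<forall>I\<in>J ` Z. M \<subseteq> I \<longrightarrow> I = M" using J by (intro ideal_maximal_member) auto
    then obtain c where c: "c \<in> Z" and c_max: "\<And>c'. c' \<in> Z \<Longrightarrow> J c \<subseteq> J c' \<Longrightarrow> J c' = J c" by auto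
    obtain n s where s: "s \<notin> P" "s * a = t ^ n * c" and c0: "c \<noteq> 0" using c unfolding Z_def by blast
    have "c \<notin> P"
    proof
      assume "c \<in> P"
      have "to_fract c \<in> local_max_ideal P"
      proof -
        have "to_fract c = to_fract c / to_fract 1" by simp
        then show ?thesis unfolding local_max_ideal_iff using \<open>c \<in> P\<close> points_prime(2)[OF P] by blast
      qed
      then obtain x where x: "x \<in> local_ring P" "to_fract c = to_fract t * x"
        using t(3) unfolding uniformizes_def by blast
      obtain c' s' where s': "s' \<notin> P" "x = to_fract c' / to_fract s'"
        using x(1) unfolding local_ring_iff by blast
      note c' = s'(1) x(2)[unfolded s'(2)]
      have "to_fract (s' * c) = to_fract (t * c')"
        using c'(2) to_fract_notin_point[OF P c'(1)] by (simp add: field_simps)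
      then have sc: "s' * c = t * c'" by (simp only: to_fract_eq_iff)
      have "s' \<noteq> 0" using to_fract_notin_point[OF P c'(1)] by auto
      then have "c' \<noteq> 0" using sc c0 by auto
      moreover have "(s' * s) * a = t ^ Suc n * c'"
      proof -
        have "(s' * s) * a = s' * (s * a)" by (rule mult.assoc)
        also have "\<dots> = t ^ n * (s' * c)" unfolding s(2) by (rule mult.left_commute)
        also have "\<dots> = t ^ Suc n * c'" unfolding sc by simp
        finally show ?thesis .
      qed
      ultimately have "c' \<in> Z" using points_mult_notin[OF P c'(1) s(1)] unfolding Z_def by blast
      moreover have "J c \<subseteq> J c'"
      proof
        fix r assume "r \<in> J c"
        then obtain s1 where s1: "s1 \<notin> P" "c dvd s1 * r" unfolding J_def by blast
        have "s' * c dvd s' * (s1 * r)" using s1(2) by (rule mult_dvd_mono[OF dvd_refl])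
        then have "c' dvd (s' * s1) * r" unfolding sc mult.assoc by (rule dvd_mult_right)
        then show "r \<in> J c'" using points_mult_notin[OF P c'(1) s1(1)] unfolding J_def by blast
      qed
      \<comment> \<open>If \<open>c'\<close> generated the same ideal as \<open>c = (t / s') c'\<close> in the local ring, \<open>t\<close> would be a unit.\<close>
      ultimately have "J c' = J c" by (rule c_max)
      moreover have "c' \<in> J c'" using points_prime(2)[OF P] unfolding J_def
        by (intro CollectI exI[of _ 1]) simp
      ultimately obtain s2 where s2: "s2 \<notin> P" "c dvd s2 * c'" unfolding J_def by blast
      then obtain k where k: "s2 * c' = c * k" by blast
      have "c * (s2 * s') = s2 * (s' * c)" by (simp add: algebra_simps)
      also have "\<dots> = t * (s2 * c')" unfolding sc by (rule mult.left_commute)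
      also have "\<dots> = c * (t * k)" unfolding k by (rule mult.left_commute)
      finally have "s2 * s' = t * k" using c0 by simp
      moreover have "k * t \<in> P" using points_prime(1)[OF P] t(1) by (simp add: is_ideal_def)
      ultimately show False using points_mult_notin[OF P s2(1) c'(1)] by (simp add: mult.commute)
    qed
    have "to_fract c * inverse (to_fract s) \<in> local_units P"
      by (intro local_units_mult[OF P] local_units_inverse local_unit_to_fract[OF P] s(1) \<open>c \<notin> P\<close>)
    moreover have "to_fract (t ^ k) = to_fract t ^ k" for k by (induction k) simp_all
    then have "to_fract s * to_fract a = to_fract t ^ n * to_fract c"
      using arg_cong[OF s(2), of to_fract] by simp
    then have "to_fract a = to_fract t powi int n * (to_fract c * inverse (to_fract s))"
      using to_fract_notin_point[OF P s(1)] by (simp add: field_simps)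
    ultimately show ?thesis by blast
  qed
  obtain a b where ab: "\<phi> = to_fract a / to_fract b" "b \<noteq> 0" "a \<noteq> 0"
    using \<phi> by (cases \<phi> rule: Fract_cases_nonzero) (auto simp: Fract_conv_to_fract)
  obtain n u where u: "u \<in> local_units P" "to_fract a = to_fract t powi n * u" using regular[OF ab(3)] by blast
  obtain m v where v: "v \<in> local_units P" "to_fract b = to_fract t powi m * v" using regular[OF ab(2)] by blast
  have "\<phi> = to_fract t powi (n - m) * (u * inverse v)"
    unfolding ab(1) u(2) v(2) using t(2) by (simp add: power_int_diff divide_inverse)
  moreover have "u * inverse v \<in> local_units P"
    using local_units_mult[OF P u(1) local_units_inverse[OF v(1)]] .
  ultimately show ?thesis by blast
qed

definition uniformizer :: "'a set \<Rightarrow> 'a" where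
  "uniformizer P = (SOME t. t \<in> P \<and> t \<noteq> 0 \<and> uniformizes (to_fract t) P)"

lemma uniformizer:
  assumes "P \<in> points"
  shows "uniformizer P \<in> P" "uniformizer P \<noteq> 0" "uniformizes (to_fract (uniformizer P)) P"
proof -
  have "\<exists>t. t \<in> P \<and> t \<noteq> 0 \<and> uniformizes (to_fract t) P" using ex_uniformizes[OF assms] by blast
  from someI_ex[OF this] show "uniformizer P \<in> P" "uniformizer P \<noteq> 0" "uniformizes (to_fract (uniformizer P)) P"
    unfolding uniformizer_def by blast+
qed

lemma ord_at_factorization:
  assumes P: "(P :: 'a set) \<in> points" and "\<phi> \<noteq> 0"
  obtains u where "u \<in> local_units P" "\<phi> = to_fract (uniformizer P) powi ord_at P \<phi> * u"
proof -
  obtain n u where u: "u \<in> local_units P" "\<phi> = to_fract (uniformizer P) powi n * u"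
    using uniformizer_factorization[OF P uniformizer[OF P] assms(2)] by blast
  then have "ord_at P \<phi> = n" using ord_at_eqI[OF P uniformizer(3)[OF P]] by blast
  then show ?thesis using u that by blast
qed

lemma ord_at_mult:
  assumes P: "(P :: 'a set) \<in> points" and nz: "\<phi> \<noteq> 0" "\<psi> \<noteq> 0"
  shows "ord_at P (\<phi> * \<psi>) = ord_at P \<phi> + ord_at P \<psi>"
proof -
  obtain u where u: "u \<in> local_units P" "\<phi> = to_fract (uniformizer P) powi ord_at P \<phi> * u"
    using ord_at_factorization[OF P nz(1)] .
  obtain v where v: "v \<in> local_units P" "\<psi> = to_fract (uniformizer P) powi ord_at P \<psi> * v"
    using ord_at_factorization[OF P nz(2)] .
  have t: "to_fract (uniformizer P) \<noteq> 0" using uniformizer(2)[OF P] by simp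
  have "\<phi> * \<psi> = (to_fract (uniformizer P) powi ord_at P \<phi> * u) * (to_fract (uniformizer P) powi ord_at P \<psi> * v)"
    using u(2) v(2) by simp
  also have "\<dots> = to_fract (uniformizer P) powi (ord_at P \<phi> + ord_at P \<psi>) * (u * v)"
    using t by (simp add: power_int_add)
  finally show ?thesis using ord_at_eqI[OF P uniformizer(3)[OF P] local_units_mult[OF P u(1) v(1)]] by blast
qed

lemma ord_at_power_int:
  assumes P: "(P :: 'a set) \<in> points" and nz: "\<phi> \<noteq> 0"
  shows "ord_at P (\<phi> powi k) = k * ord_at P \<phi>"
proof -
  obtain u where u: "u \<in> local_units P" "\<phi> = to_fract (uniformizer P) powi ord_at P \<phi> * u"
    using ord_at_factorization[OF P nz] .
  have "\<phi> powi k = (to_fract (uniformizer P) powi ord_at P \<phi> * u) powi k" using u(2) by simp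
  also have "\<dots> = to_fract (uniformizer P) powi (k * ord_at P \<phi>) * (u powi k)"
    by (simp add: power_int_mult_distrib mult.commute[of k] power_int_mult)
  finally show ?thesis
    using ord_at_eqI[OF P uniformizer(3)[OF P] local_units_power_int[OF P u(1)]] by blast
qed

lemma ord_at_nonneg_iff:
  assumes P: "(P :: 'a set) \<in> points" and nz: "\<phi> \<noteq> 0"
  shows "0 \<le> ord_at P \<phi> \<longleftrightarrow> \<phi> \<in> local_ring P"
proof -
  note t = uniformizer[OF P]
  obtain u where u: "u \<in> local_units P" "\<phi> = to_fract (uniformizer P) powi ord_at P \<phi> * u"
    using ord_at_factorization[OF P nz] .
  show ?thesis
  proof
    assume "0 \<le> ord_at P \<phi>"
    then have "to_fract (uniformizer P) powi ord_at P \<phi> \<in> local_ring P"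
      using local_ring_power[OF P local_ring_to_fract[OF P]] by (simp add: power_int_def)
    then show "\<phi> \<in> local_ring P" using u local_ring_closed(2)[OF P] unfolding local_units_def
      by (metis (no_types, lifting) mem_Collect_eq)
  next
    assume \<phi>: "\<phi> \<in> local_ring P"
    show "0 \<le> ord_at P \<phi>"
    proof (rule ccontr)
      assume "\<not> 0 \<le> ord_at P \<phi>"
      then have "- ord_at P \<phi> > 0" by simp
      from uniformizer_power_not_unit(2)[OF P t(3) this, of u] show False
        using u \<phi> by simp
    qed
  qed
qed

lemma ord_at_ge_iff:
  assumes P: "(P :: 'a set) \<in> points" and nz: "\<phi> \<noteq> 0"
  shows "n \<le> ord_at P \<phi> \<longleftrightarrow> \<phi> * to_fract (uniformizer P) powi (- n) \<in> local_ring P"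
proof -
  have t: "to_fract (uniformizer P) \<noteq> 0" using uniformizer(2)[OF P] by simp
  have 1: "1 \<in> local_units P" using local_unit_to_fract[OF P points_prime(2)[OF P]] by simp
  have "ord_at P (to_fract (uniformizer P) powi (- n)) = - n"
    by (rule ord_at_eqI[OF P uniformizer(3)[OF P] 1]) simp
  then have "ord_at P (\<phi> * to_fract (uniformizer P) powi (- n)) = ord_at P \<phi> - n"
    using ord_at_mult[OF P nz] t by simp
  then show ?thesis using ord_at_nonneg_iff[OF P, of "\<phi> * to_fract (uniformizer P) powi (- n)"] nz t by simp
qed

lemma ord_at_add:
  assumes P: "(P :: 'a set) \<in> points" and "\<phi> \<noteq> 0" "\<psi> \<noteq> 0" "\<phi> + \<psi> \<noteq> 0" "n \<le> ord_at P \<phi>" "n \<le> ord_at P \<psi>"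
  shows "n \<le> ord_at P (\<phi> + \<psi>)"
  using assms local_ring_closed(1)[OF P] by (simp add: ord_at_ge_iff distrib_right)

lemma ord_at_to_fract:
  assumes P: "(P :: 'a set) \<in> points" and a: "a \<noteq> 0"
  shows "0 \<le> ord_at P (to_fract a)" "0 < ord_at P (to_fract a) \<longleftrightarrow> a \<in> P"
proof -
  show ge: "0 \<le> ord_at P (to_fract a)"
    using ord_at_nonneg_iff[OF P] local_ring_to_fract[OF P] a by simp
  show "0 < ord_at P (to_fract a) \<longleftrightarrow> a \<in> P"
  proof
    assume pos: "0 < ord_at P (to_fract a)"
    show "a \<in> P"
    proof (rule ccontr)
      assume "a \<notin> P"
      then have "ord_at P (to_fract a) = 0"
        using ord_at_eqI[OF P uniformizer(3)[OF P] local_unit_to_fract[OF P], of a _ 0] by simp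
      then show False using pos by simp
    qed
  next
    assume aP: "a \<in> P"
    have "to_fract a = to_fract a / to_fract 1" by simp
    then have "to_fract a \<in> local_max_ideal P"
      unfolding local_max_ideal_iff using aP points_prime(2)[OF P] by blast
    then obtain x where x: "x \<in> local_ring P" "to_fract a = to_fract (uniformizer P) * x"
      using uniformizer(3)[OF P] unfolding uniformizes_def by blast
    have "to_fract a * to_fract (uniformizer P) powi (- 1) = x"
      unfolding x(2) using uniformizer(2)[OF P] by simp
    then have "1 \<le> ord_at P (to_fract a)" using ord_at_ge_iff[OF P] a x(1) by simp
    then show "0 < ord_at P (to_fract a)" by simp
  qed
qed

lemma ord_at_uniformizer:
  assumes P: "(P :: 'a set) \<in> points"
  shows "ord_at P (to_fract (uniformizer P)) = 1"
proof -
  have 1: "1 \<in> local_units P" using local_unit_to_fract[OF P points_prime(2)[OF P]] by simp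
  show ?thesis by (rule ord_at_eqI[OF P uniformizer(3)[OF P] 1]) simp
qed

lemma global_sections_iff:
  fixes D :: "'a set \<Rightarrow> int"
  assumes "supp_div D \<subseteq> points"
  shows "\<phi> \<in> global_sections D \<longleftrightarrow> \<phi> = 0 \<or> (\<forall>P\<in>points. - D P \<le> ord_at P \<phi>)"
proof -
  have "D P = 0" if "P \<notin> points" for P using assms that by (auto simp: supp_div_def)
  then show ?thesis unfolding global_sections_def principal_div_def by force
qed

lemma global_sections_zero: "0 \<in> global_sections D"
  by (simp add: global_sections_def)

lemma global_sections_mono:
  assumes "D \<le> D'"
  shows "global_sections D \<subseteq> global_sections D'"
proof
  fix \<phi> assume \<phi>: "\<phi> \<in> global_sections D"
  have "0 \<le> principal_div \<phi> P + D' P" if "0 \<le> principal_div \<phi> P + D P" for P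
    using that assms[unfolded le_fun_def, rule_format, of P] by linarith
  then show "\<phi> \<in> global_sections D'" using \<phi> unfolding global_sections_def by blast
qed

lemma global_sections_add:
  fixes D :: "'a set \<Rightarrow> int"
  assumes "\<phi> \<in> global_sections D" "\<psi> \<in> global_sections D"
  shows "\<phi> + \<psi> \<in> global_sections D"
proof (cases "\<phi> = 0 \<or> \<psi> = 0 \<or> \<phi> + \<psi> = 0")
  case True
  then show ?thesis using assms by (auto simp: global_sections_zero)
next
  case False
  have "0 \<le> principal_div (\<phi> + \<psi>) P + D P" for P
  proof (cases "P \<in> points")
    case True
    have "- D P \<le> ord_at P \<phi>" "- D P \<le> ord_at P \<psi>"
      using assms False True by (auto simp: global_sections_def principal_div_def dest!: spec[of _ P])
    then have "- D P \<le> ord_at P (\<phi> + \<psi>)" using ord_at_add[OF True] False by blast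
    then show ?thesis using True by (simp add: principal_div_def)
  next
    case False
    then show ?thesis using assms \<open>\<not> (\<phi> = 0 \<or> \<psi> = 0 \<or> \<phi> + \<psi> = 0)\<close>
      by (auto simp: global_sections_def principal_div_def dest!: spec[of _ P])
  qed
  then show ?thesis by (simp add: global_sections_def)
qed

lemma global_sections_mult:
  fixes D D' :: "'a set \<Rightarrow> int"
  assumes "\<phi> \<in> global_sections D" "\<psi> \<in> global_sections D'"
  shows "\<phi> * \<psi> \<in> global_sections (\<lambda>P. D P + D' P)"
proof (cases "\<phi> = 0 \<or> \<psi> = 0")
  case True
  then show ?thesis by (auto simp: global_sections_zero)
next
  case False
  have "0 \<le> principal_div (\<phi> * \<psi>) P + (D P + D' P)" for P
  proof -
    have "principal_div (\<phi> * \<psi>) P = principal_div \<phi> P + principal_div \<psi> P"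
      using ord_at_mult False by (simp add: principal_div_def)
    moreover have "0 \<le> principal_div \<phi> P + D P" "0 \<le> principal_div \<psi> P + D' P"
      using assms False by (auto simp: global_sections_def)
    ultimately show ?thesis by linarith
  qed
  then show ?thesis by (simp add: global_sections_def)
qed

text \<open>
  The denominators of a function that is regular at every point form an ideal contained in no point.
\<close>

lemma global_sections_0: "global_sections (\<lambda>_. 0) = range (to_fract :: 'a \<Rightarrow> _)"
proof
  show "range to_fract \<subseteq> global_sections (\<lambda>_ :: 'a set. 0)"
    using ord_at_to_fract(1) by (auto simp: global_sections_def principal_div_def)
  show "global_sections (\<lambda>_ :: 'a set. 0) \<subseteq> range to_fract"
  proof
    fix \<phi> :: "'a fract" assume \<phi>: "\<phi> \<in> global_sections (\<lambda>_. 0)"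
    define I where "I = {r. r = 0 \<or> to_fract r * \<phi> \<in> range to_fract}"
    have I_iff: "r \<in> I \<longleftrightarrow> to_fract r * \<phi> \<in> range to_fract" for r
      by (auto simp: I_def intro: image_eqI[of _ _ 0])
    have "is_ideal I"
      unfolding is_ideal_def I_iff
    proof (intro conjI ballI allI)
      show "to_fract 0 * \<phi> \<in> range to_fract" by (auto intro: image_eqI[of _ _ 0])
    next
      fix a b assume "a \<in> I" "b \<in> I"
      then obtain x y where "to_fract a * \<phi> = to_fract x" "to_fract b * \<phi> = to_fract y" by (auto simp: I_iff)
      then have "to_fract (a + b) * \<phi> = to_fract (x + y)" by (simp add: distrib_right)
      then show "to_fract (a + b) * \<phi> \<in> range to_fract" by (metis rangeI)
    next
      fix r a assume "a \<in> I"
      then obtain x where "to_fract a * \<phi> = to_fract x" by (auto simp: I_iff)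
      then have "to_fract (r * a) * \<phi> = to_fract (r * x)" by (simp add: mult.assoc)
      then show "to_fract (r * a) * \<phi> \<in> range to_fract" by (metis rangeI)
    qed
    moreover have "\<not> I \<subseteq> P" if P: "P \<in> points" for P
    proof (cases "\<phi> = 0")
      case True
      then have "1 \<in> I" by (auto simp: I_iff intro: image_eqI[of _ _ 0])
      then show ?thesis using points_prime(2)[OF P] by blast
    next
      case False
      then have "\<phi> \<in> local_ring P" using \<phi> ord_at_nonneg_iff[OF P False] P
        by (auto simp: global_sections_def principal_div_def dest!: spec[of _ P])
      then obtain a b where b: "b \<notin> P" "\<phi> = to_fract a / to_fract b" unfolding local_ring_iff by blast
      have "to_fract b * \<phi> = to_fract a" unfolding b(2) using to_fract_notin_point[OF P b(1)] by simp
      then have "b \<in> I" by (simp add: I_iff)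
      then show ?thesis using b(1) by blast
    qed
    ultimately have "1 \<in> I" using ideal_in_point[of I] by blast
    then show "\<phi> \<in> range to_fract" by (simp add: I_iff)
  qed
qed

text \<open>
  A power of a uniformizer at \<open>P\<close> has the right order at \<open>P\<close>.  It can fail to be a section at finitely
  many other points only, and a high power of an element vanishing at those but not at \<open>P\<close> repairs this.
\<close>

lemma ex_section_of_exact_order:
  assumes D: "is_divisor (D :: 'a set \<Rightarrow> int)" and P: "P \<in> points"
  shows "\<exists>\<phi>. \<phi> \<noteq> 0 \<and> \<phi> \<in> global_sections D \<and> ord_at P \<phi> = - D P"
proof -
  define t where "t = uniformizer P"
  have t: "t \<in> P" "t \<noteq> 0" "ord_at P (to_fract t) = 1"
    unfolding t_def using uniformizer[OF P] ord_at_uniformizer[OF P] by auto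
  define X where "X = {Q\<in>points. t \<in> Q} \<union> supp_div D - {P}"
  have fin_t: "finite {Q\<in>points. t \<in> Q}"
  proof -
    have "is_ideal (ideal_plus {0} t)" by (rule is_ideal_ideal_plus) (simp add: is_ideal_def)
    moreover have tin: "t \<in> ideal_plus {0} t"
      by (rule generator_in_ideal_plus) (simp add: is_ideal_def)
    then have "ideal_plus {0} t \<noteq> {0}" using t(2) by blast
    ultimately have "finite {Q\<in>points. ideal_plus {0} t \<subseteq> Q}" by (rule finite_points_over)
    moreover have "{Q\<in>points. t \<in> Q} \<subseteq> {Q\<in>points. ideal_plus {0} t \<subseteq> Q}"
      using points_prime(1) by (auto simp: is_ideal_def)
    ultimately show ?thesis by (rule finite_subset[rotated])
  qed
  have X: "finite X" "X \<subseteq> points" "P \<notin> X"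
    using fin_t D by (auto simp: X_def is_divisor_def)
  have "\<forall>Q\<in>X. \<exists>u. u \<in> Q \<and> u \<notin> P" using points_not_subset[OF P] X by (metis subsetD)
  then obtain u where u: "\<And>Q. Q \<in> X \<Longrightarrow> u Q \<in> Q \<and> u Q \<notin> P" by metis
  define v where "v = prod u X"
  have vP: "v \<notin> P" unfolding v_def using u by (intro points_prod_notin[OF P X(1)]) blast
  then have v0: "v \<noteq> 0" using to_fract_notin_point[OF P] by fastforce
  have vQ: "v \<in> Q" if Q: "Q \<in> X" for Q
  proof (rule is_ideal_dvd)
    show "is_ideal Q" using points_prime(1) Q X(2) by blast
    show "u Q \<in> Q" using u[OF Q] by simp
    show "u Q dvd v" unfolding v_def using Q X(1) by (rule dvd_prodI[rotated])
  qed
  \<comment> \<open>Large enough to outweigh, at every point of \<open>X\<close>, the order of the first factor of \<open>\<phi>\<close> and the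
    coefficient of \<open>D\<close>.\<close>
  define N where "N = (\<Sum>Q\<in>X. \<bar>D P\<bar> * ord_at Q (to_fract t) + \<bar>D Q\<bar>)"
  define \<phi> where "\<phi> = to_fract t powi (- D P) * to_fract v powi N"
  have nz: "to_fract t \<noteq> 0" "to_fract v \<noteq> 0" "\<phi> \<noteq> 0" using t(2) v0 by (simp_all add: \<phi>_def)
  have ord: "ord_at Q \<phi> = - D P * ord_at Q (to_fract t) + N * ord_at Q (to_fract v)" if "Q \<in> points" for Q
    unfolding \<phi>_def using that nz by (simp add: ord_at_mult ord_at_power_int)
  have t_nonneg: "0 \<le> ord_at Q (to_fract t)" if "Q \<in> points" for Q
    using ord_at_to_fract(1)[OF that t(2)] .
  have N_ge: "\<bar>D P\<bar> * ord_at Q (to_fract t) + \<bar>D Q\<bar> \<le> N" if "Q \<in> X" for Q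
    unfolding N_def using that X t_nonneg
    by (intro member_le_sum) (auto intro!: add_nonneg_nonneg mult_nonneg_nonneg)
  have N0: "0 \<le> N" unfolding N_def using X t_nonneg
    by (intro sum_nonneg add_nonneg_nonneg mult_nonneg_nonneg) auto
  have "ord_at P (to_fract v) = 0" using ord_at_to_fract[OF P v0] vP by simp
  then have "ord_at P \<phi> = - D P" using ord[OF P] t(3) by simp
  moreover have "- D Q \<le> ord_at Q \<phi>" if Q: "Q \<in> points" for Q
  proof -
    consider "Q = P" | "Q \<in> X" | "Q \<notin> X" "Q \<noteq> P" by blast
    then show ?thesis
    proof cases
      case 1
      then show ?thesis using \<open>ord_at P \<phi> = - D P\<close> by simp
    next
      case 2
      have "N * 1 \<le> N * ord_at Q (to_fract v)"
        using N0 ord_at_to_fract(2)[OF Q v0] vQ[OF 2] by (intro mult_left_mono) auto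
      moreover have "- \<bar>D P\<bar> * ord_at Q (to_fract t) \<le> - D P * ord_at Q (to_fract t)"
        using t_nonneg[OF Q] by (intro mult_right_mono) auto
      ultimately show ?thesis unfolding ord[OF Q] using N_ge[OF 2] by simp
    next
      case 3
      then have "t \<notin> Q" "D Q = 0" using Q by (auto simp: X_def supp_div_def)
      then have "ord_at Q (to_fract t) = 0" using ord_at_to_fract[OF Q t(2)] by simp
      moreover have "0 \<le> N * ord_at Q (to_fract v)"
        using N0 ord_at_to_fract(1)[OF Q v0] by (rule mult_nonneg_nonneg)
      ultimately show ?thesis unfolding ord[OF Q] using \<open>D Q = 0\<close> by simp
    qed
  qed
  ultimately show ?thesis using nz(3) global_sections_iff[of D] D by (auto simp: is_divisor_def)
qed

text \<open>
  The functions that are sums of products of a section of \<open>D\<close> and a section of \<open>- D\<close> form an ideal of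
  the coordinate ring.  Sections of exact order at a point \<open>P\<close> provide an element of it outside \<open>P\<close>.
\<close>

lemma global_sections_invertible:
  assumes D: "is_divisor (D :: 'a set \<Rightarrow> int)"
  shows "\<exists>\<Gamma> b. finite \<Gamma> \<and> \<Gamma> \<subseteq> global_sections D \<and> (\<forall>\<alpha>\<in>\<Gamma>. b \<alpha> \<in> global_sections (\<lambda>P. - D P)) \<and>
    (\<Sum>\<alpha>\<in>\<Gamma>. \<alpha> * b \<alpha>) = 1"
proof -
  define dual where "dual \<Gamma> b \<longleftrightarrow> finite \<Gamma> \<and> \<Gamma> \<subseteq> global_sections D \<and>
    (\<forall>\<alpha>\<in>\<Gamma>. b \<alpha> \<in> global_sections (\<lambda>P. - D P))" for \<Gamma> :: "'a fract set" and b
  define I where "I = {r. \<exists>\<Gamma> b. dual \<Gamma> b \<and> to_fract r = (\<Sum>\<alpha>\<in>\<Gamma>. \<alpha> * b \<alpha>)}"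
  have "is_ideal I"
    unfolding is_ideal_def
  proof (intro conjI ballI allI)
    have "dual {} (\<lambda>_. 0)" by (simp add: dual_def)
    then show "0 \<in> I" unfolding I_def by force
  next
    fix r s assume "r \<in> I" "s \<in> I"
    then obtain \<Gamma> b \<Delta> c where r: "dual \<Gamma> b" "to_fract r = (\<Sum>\<alpha>\<in>\<Gamma>. \<alpha> * b \<alpha>)"
      and s: "dual \<Delta> c" "to_fract s = (\<Sum>\<alpha>\<in>\<Delta>. \<alpha> * c \<alpha>)" unfolding I_def by blast
    define b' where "b' \<alpha> = (if \<alpha> \<in> \<Gamma> then b \<alpha> else 0)" for \<alpha>
    define c' where "c' \<alpha> = (if \<alpha> \<in> \<Delta> then c \<alpha> else 0)" for \<alpha>
    have "b' \<alpha> \<in> global_sections (\<lambda>P. - D P)" "c' \<alpha> \<in> global_sections (\<lambda>P. - D P)" for \<alpha>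
      using r(1) s(1) by (auto simp: b'_def c'_def dual_def global_sections_zero)
    then have "dual (\<Gamma> \<union> \<Delta>) (\<lambda>\<alpha>. b' \<alpha> + c' \<alpha>)"
      using r(1) s(1) by (simp add: dual_def global_sections_add)
    moreover have "(\<Sum>\<alpha>\<in>\<Gamma> \<union> \<Delta>. \<alpha> * b' \<alpha>) = (\<Sum>\<alpha>\<in>\<Gamma>. \<alpha> * b \<alpha>)"
      using r(1) s(1) by (intro sum.mono_neutral_cong_right) (auto simp: b'_def dual_def)
    moreover have "(\<Sum>\<alpha>\<in>\<Gamma> \<union> \<Delta>. \<alpha> * c' \<alpha>) = (\<Sum>\<alpha>\<in>\<Delta>. \<alpha> * c \<alpha>)"
      using r(1) s(1) by (intro sum.mono_neutral_cong_right) (auto simp: c'_def dual_def)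
    ultimately show "r + s \<in> I" unfolding I_def using r(2) s(2)
      by (intro CollectI exI[of _ "\<Gamma> \<union> \<Delta>"] exI[of _ "\<lambda>\<alpha>. b' \<alpha> + c' \<alpha>"])
        (simp add: distrib_left sum.distrib)
  next
    fix x r assume "r \<in> I"
    then obtain \<Gamma> b where r: "dual \<Gamma> b" "to_fract r = (\<Sum>\<alpha>\<in>\<Gamma>. \<alpha> * b \<alpha>)" unfolding I_def by blast
    have "to_fract x * \<psi> \<in> global_sections (\<lambda>P. - D P)" if "\<psi> \<in> global_sections (\<lambda>P. - D P)" for \<psi>
      using global_sections_mult[of "to_fract x" "\<lambda>_. 0" \<psi> "\<lambda>P. - D P"] that global_sections_0 by simp
    then have "dual \<Gamma> (\<lambda>\<alpha>. to_fract x * b \<alpha>)" using r(1) by (simp add: dual_def)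
    moreover have "to_fract (x * r) = (\<Sum>\<alpha>\<in>\<Gamma>. \<alpha> * (to_fract x * b \<alpha>))"
      by (simp add: r(2) sum_distrib_left mult.left_commute)
    ultimately show "x * r \<in> I" unfolding I_def by blast
  qed
  moreover have "\<not> I \<subseteq> P" if P: "P \<in> points" for P
  proof -
    obtain \<phi> where \<phi>: "\<phi> \<noteq> 0" "\<phi> \<in> global_sections D" "ord_at P \<phi> = - D P"
      using ex_section_of_exact_order[OF D P] by blast
    have "is_divisor (\<lambda>P. - D P)" using D by (simp add: is_divisor_def supp_div_def)
    then obtain \<psi> where \<psi>: "\<psi> \<noteq> 0" "\<psi> \<in> global_sections (\<lambda>P. - D P)" "ord_at P \<psi> = D P"
      using ex_section_of_exact_order[OF _ P, of "\<lambda>P. - D P"] by auto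
    have "\<phi> * \<psi> \<in> global_sections (\<lambda>_. 0)" using global_sections_mult[OF \<phi>(2) \<psi>(2)] by simp
    then obtain r where r: "\<phi> * \<psi> = to_fract r" unfolding global_sections_0 by blast
    have "dual {\<phi>} (\<lambda>_. \<psi>)" using \<phi> \<psi> by (simp add: dual_def)
    then have "r \<in> I" unfolding I_def using r by force
    moreover have "ord_at P (to_fract r) = 0" using ord_at_mult[OF P \<phi>(1) \<psi>(1)] \<phi>(3) \<psi>(3) r by simp
    moreover have "r \<noteq> 0" using r \<phi>(1) \<psi>(1) by auto
    ultimately show ?thesis using ord_at_to_fract(2)[OF P, of r] by auto
  qed
  ultimately have "1 \<in> I" using ideal_in_point[of I] by blast
  then show ?thesis unfolding I_def dual_def by force
qed

text \<open>
  Multiply the relation \<open>\<Sum>\<alpha> * b \<alpha> = 1\<close> by \<open>\<phi>\<close>.  For \<open>D' = 0\<close> this says that the sections of \<open>D\<close> form a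
  finitely generated module.
\<close>

lemma global_sections_generators:
  assumes D: "is_divisor (D :: 'a set \<Rightarrow> int)"
  shows "\<exists>\<Gamma>. finite \<Gamma> \<and> \<Gamma> \<subseteq> global_sections D \<and>
    (\<forall>D'. \<forall>\<phi>\<in>global_sections (\<lambda>P. D P + D' P).
       \<exists>\<psi>. (\<forall>\<alpha>\<in>\<Gamma>. \<psi> \<alpha> \<in> global_sections D') \<and> \<phi> = (\<Sum>\<alpha>\<in>\<Gamma>. \<alpha> * \<psi> \<alpha>))"
proof -
  obtain \<Gamma> b where \<Gamma>: "finite \<Gamma>" "\<Gamma> \<subseteq> global_sections D"
    "\<And>\<alpha>. \<alpha> \<in> \<Gamma> \<Longrightarrow> b \<alpha> \<in> global_sections (\<lambda>P. - D P)" "(\<Sum>\<alpha>\<in>\<Gamma>. \<alpha> * b \<alpha>) = 1"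
    using global_sections_invertible[OF D] by blast
  have "\<exists>\<psi>. (\<forall>\<alpha>\<in>\<Gamma>. \<psi> \<alpha> \<in> global_sections D') \<and> \<phi> = (\<Sum>\<alpha>\<in>\<Gamma>. \<alpha> * \<psi> \<alpha>)"
    if \<phi>: "\<phi> \<in> global_sections (\<lambda>P. D P + D' P)" for D' \<phi>
  proof (intro exI[of _ "\<lambda>\<alpha>. b \<alpha> * \<phi>"] conjI ballI)
    fix \<alpha> assume "\<alpha> \<in> \<Gamma>"
    from global_sections_mult[OF \<Gamma>(3)[OF this] \<phi>] show "b \<alpha> * \<phi> \<in> global_sections D'" by simp
  next
    have "\<phi> = (\<Sum>\<alpha>\<in>\<Gamma>. \<alpha> * b \<alpha>) * \<phi>" using \<Gamma>(4) by simp
    also have "\<dots> = (\<Sum>\<alpha>\<in>\<Gamma>. \<alpha> * (b \<alpha> * \<phi>))" by (simp add: sum_distrib_right mult.assoc)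
    finally show "\<phi> = (\<Sum>\<alpha>\<in>\<Gamma>. \<alpha> * (b \<alpha> * \<phi>))" .
  qed
  then show ?thesis using \<Gamma>(1,2) by blast
qed

end

section \<open>The coordinate ring of a normal affine curve\<close>

lemma zero_prime_ideal: "is_prime_ideal ({0} :: 'a::idom set)"
proof -
  have "({0} :: 'a set) \<noteq> UNIV" by (metis UNIV_I one_neq_zero singletonD)
  then show ?thesis by (simp add: is_prime_ideal_def is_ideal_def)
qed

text \<open>
  A nonzero prime that is not maximal would sit in a chain of primes of length two, whereas a maximal
  zero ideal would leave no chain of length one.
\<close>

lemma affine_curve_dedekind_ring:
  fixes emb :: "'k::{alg_closed_field, field_char_0} \<Rightarrow> 'a::idom"
  assumes "affine_curve emb"
  shows "dedekind_ring TYPE('a)"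
proof -
  interpret affine_curve emb by fact
  interpret noetherian_domain "TYPE('a)"
    by standard (rule affine_curve_ideal_fg[OF assms])
  have chain_le: "n \<le> 1" if "prime_chain n (p :: nat \<Rightarrow> 'a set)" for n p
  proof -
    have "enat n \<le> krull_dim TYPE('a)" unfolding krull_dim_def
      using that by (intro Sup_upper) blast
    then show ?thesis using dim_one by (simp add: one_enat_def)
  qed
  have "\<exists>n p. prime_chain n (p :: nat \<Rightarrow> 'a set) \<and> n \<noteq> 0"
  proof (rule ccontr)
    assume "\<not> ?thesis"
    then have "krull_dim TYPE('a) \<le> 0" unfolding krull_dim_def
      by (intro Sup_least) (auto simp: zero_enat_def)
    then show False using dim_one by simp
  qed
  then obtain n and p :: "nat \<Rightarrow> 'a set" where p: "prime_chain n p" "n \<noteq> 0" by blast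
  show ?thesis
  proof
    fix P :: "'a set" assume P: "is_prime_ideal P" "P \<noteq> {0}"
    then have "1 \<notin> P" using is_ideal_eq_UNIV by (auto simp: is_prime_ideal_def)
    moreover have "is_ideal P" using P(1) by (simp add: is_prime_ideal_def)
    ultimately obtain Q where Q: "Q \<in> points" "P \<subseteq> Q" using ideal_in_point[of P] by blast
    have "P = Q"
    proof (rule ccontr)
      assume "P \<noteq> Q"
      have "is_prime_ideal Q" using Q(1) maximal_imp_prime_ideal by (simp add: points_def)
      moreover have "{0} \<subset> P" using P by (auto simp: is_prime_ideal_def is_ideal_def)
      ultimately have "prime_chain 2 (\<lambda>i. if i = 0 then {0} else if i = 1 then P else Q)"
        using P(1) Q(2) \<open>P \<noteq> Q\<close> zero_prime_ideal by (auto simp: prime_chain_def less_2_cases_iff)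
      from chain_le[OF this] show False by simp
    qed
    then show "is_maximal_ideal P" using Q(1) by (simp add: points_def)
  next
    show "\<not> is_maximal_ideal ({0} :: 'a set)"
    proof
      assume max: "is_maximal_ideal ({0} :: 'a set)"
      have p01: "is_prime_ideal (p 0)" "is_prime_ideal (p (Suc 0))" "p 0 \<subset> p (Suc 0)"
        using p unfolding prime_chain_def by auto
      then have "is_ideal (p (Suc 0))" "p (Suc 0) \<noteq> UNIV" "is_ideal (p 0)" by (simp_all add: is_prime_ideal_def)
      moreover have "{0} \<subseteq> p (Suc 0)" using calculation(1) by (simp add: is_ideal_def)
      ultimately have "p (Suc 0) = {0}" using max unfolding is_maximal_ideal_def by blast
      moreover have "0 \<in> p 0" using \<open>is_ideal (p 0)\<close> by (simp add: is_ideal_def)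
      ultimately have "p 0 \<subset> {0}" "0 \<in> p 0" using p01(3) by simp_all
      then show False by auto
    qed
  qed (rule normal)
qed

section \<open>Algebras of sections\<close>

abbreviation (input) "monomial \<equiv> Poly_Mapping.single"
abbreviation (input) "coefficient \<equiv> Poly_Mapping.lookup"
abbreviation (input) "support \<equiv> Poly_Mapping.keys"

lemma poly_mapping_eq_sum_single:
  "f = (\<Sum>k\<in>support f. monomial k (coefficient f k))"
proof (rule poly_mapping_eqI)
  fix k
  have "coefficient (\<Sum>k\<in>support f. monomial k (coefficient f k)) k
      = (\<Sum>l\<in>support f. if l = k then coefficient f k else 0)"
    unfolding lookup_sum by (intro sum.cong) (auto simp: lookup_single when_def)
  also have "\<dots> = coefficient f k" by (simp add: in_keys_iff)
  finally show "coefficient f k =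
      coefficient (\<Sum>k\<in>support f. monomial k (coefficient f k)) k" by simp
qed

lemma single_sum: "monomial k (\<Sum>i\<in>I. g i) = (\<Sum>i\<in>I. monomial k (g i))"
  by (induction I rule: infinite_finite_induct) (simp_all add: single_add)

text \<open>
  A vector \<open>f\<close> of natural numbers encodes a degree, through its coordinates in \<open>E\<close>, and a divisor
  supported on \<open>X\<close>, whose integral coefficients are differences of two coordinates.
\<close>

definition exponent :: "(nat ^ 'r) set \<Rightarrow> (nat ^ 'r + 'p + 'p \<Rightarrow> nat) \<Rightarrow> nat ^ 'r" where
  "exponent E f = (\<Sum>e\<in>E. f (Inl e) *s e)"

definition point_coeffs :: "'p set \<Rightarrow> (nat ^ 'r + 'p + 'p \<Rightarrow> nat) \<Rightarrow> 'p \<Rightarrow> int" where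
  "point_coeffs X f P = (if P \<in> X then int (f (Inr (Inl P))) - int (f (Inr (Inr P))) else 0)"

lemma exponent_zero: "exponent E (\<lambda>_. 0) = 0"
  by (simp add: exponent_def vec_eq_iff)

lemma exponent_add: "exponent E (\<lambda>i. f i + g i) = exponent E f + exponent E g"
  by (simp add: exponent_def vector_sadd_rdistrib sum.distrib)

lemma point_coeffs_zero: "point_coeffs X (\<lambda>_. 0) = (\<lambda>_. 0)"
  by (simp add: point_coeffs_def fun_eq_iff)

lemma point_coeffs_add: "point_coeffs X (\<lambda>i. f i + g i) = (\<lambda>P. point_coeffs X f P + point_coeffs X g P)"
  by (auto simp: point_coeffs_def fun_eq_iff)

text \<open>
  Coefficients of the linear form that evaluates \<open>a\<close> on the degree encoded by a vector.
\<close>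

definition degree_weight :: "('r::finite \<Rightarrow> rat) \<Rightarrow> nat ^ 'r + 'p + 'p \<Rightarrow> rat" where
  "degree_weight a i = (case i of Inl e \<Rightarrow> rat_dot a (nat_coords e) | Inr _ \<Rightarrow> 0)"

text \<open>
  Coefficients of the linear form that takes the value of \<open>l\<close> on the encoded degree and subtracts the
  encoded coefficient at \<open>P\<close>.
\<close>

definition coeff_weight :: "'p \<Rightarrow> (nat ^ 'r \<Rightarrow> rat) \<Rightarrow> nat ^ 'r + 'p + 'p \<Rightarrow> rat" where
  "coeff_weight P l i = (case i of Inl e \<Rightarrow> l e
     | Inr (Inl Q) \<Rightarrow> if Q = P then - 1 else 0 | Inr (Inr Q) \<Rightarrow> if Q = P then 1 else 0)"

lemma degree_weight_sum:
  assumes "finite E" "finite X"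
  shows "(\<Sum>i\<in>E <+> X <+> X. degree_weight a i * of_nat (f i)) = rat_dot a (nat_coords (exponent E f))"
proof -
  have "(\<Sum>i\<in>E <+> X <+> X. degree_weight a i * of_nat (f i)) =
      (\<Sum>e\<in>E. rat_dot a (nat_coords e) * of_nat (f (Inl e)))"
    using assms by (simp add: sum.Plus degree_weight_def)
  also have "\<dots> = (\<Sum>e\<in>E. \<Sum>i\<in>UNIV. a i * (of_nat (f (Inl e)) * of_nat (e $ i)))"
    by (simp add: rat_dot_def nat_coords_def sum_distrib_left sum_distrib_right algebra_simps)
  also have "\<dots> = (\<Sum>i\<in>UNIV. \<Sum>e\<in>E. a i * (of_nat (f (Inl e)) * of_nat (e $ i)))"
    by (rule sum.swap)
  also have "\<dots> = rat_dot a (nat_coords (exponent E f))"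
    by (simp add: rat_dot_def nat_coords_def exponent_def sum_distrib_left)
  finally show ?thesis .
qed

lemma coeff_weight_sum:
  assumes "finite E" "finite X" "P \<in> X"
  shows "(\<Sum>i\<in>E <+> X <+> X. coeff_weight P l i * of_nat (f i)) =
    (\<Sum>e\<in>E. l e * of_nat (f (Inl e))) - of_int (point_coeffs X f P)"
  using assms by (simp add: sum.Plus coeff_weight_def point_coeffs_def mult_delta_left)

context dedekind_ring
begin

lemma section_algebra_single:
  assumes "s \<in> T" "\<phi> \<in> global_sections (m s)"
  shows "monomial s \<phi> \<in> section_algebra T m"
  using assms by (auto simp: section_algebra_def lookup_single when_def global_sections_zero split: if_splits)

lemma section_algebra_add:
  fixes m :: "nat ^ 'r \<Rightarrow> 'a set \<Rightarrow> int"
  assumes "f \<in> section_algebra T m" "g \<in> section_algebra T m"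
  shows "f + g \<in> section_algebra T m"
  using assms keys_add[of f g] by (auto simp: section_algebra_def lookup_add global_sections_add)

lemma section_algebra_sum:
  fixes m :: "nat ^ 'r \<Rightarrow> 'a set \<Rightarrow> int"
  assumes "\<And>i. i \<in> I \<Longrightarrow> f i \<in> section_algebra T m"
  shows "sum f I \<in> section_algebra T m"
  using assms
  by (induction I rule: infinite_finite_induct)
    (simp_all add: section_algebra_add, simp_all add: section_algebra_def global_sections_zero)

lemma global_sections_uminus:
  fixes D :: "'a set \<Rightarrow> int"
  assumes "\<phi> \<in> global_sections D"
  shows "- \<phi> \<in> global_sections D"
proof -
  have "to_fract (- 1 :: 'a) \<in> global_sections (\<lambda>_. 0)" unfolding global_sections_0 by blast
  from global_sections_mult[OF this assms] show ?thesis by simp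
qed

lemma is_subring_section_algebra:
  fixes m :: "nat ^ 'r \<Rightarrow> 'a set \<Rightarrow> int"
  assumes T: "additive_submonoid T" and m0: "m 0 = (\<lambda>_. 0)"
    and super: "\<And>s t. s \<in> T \<Longrightarrow> t \<in> T \<Longrightarrow> (\<lambda>P. m s P + m t P) \<le> m (s + t)"
  shows "is_subring (section_algebra T m)"
proof -
  have const: "monomial 0 (to_fract a) \<in> section_algebra T m" for a
    using T m0 global_sections_0 by (intro section_algebra_single) (auto simp: additive_submonoid_def)
  have zero: "0 \<in> section_algebra T m" using const[of 0] by simp
  have one: "1 \<in> section_algebra T m" using const[of 1] by simp
  have mult: "f * g \<in> section_algebra T m" if fg: "f \<in> section_algebra T m" "g \<in> section_algebra T m" for f g
  proof -
    let ?f = "coefficient f" and ?g = "coefficient g"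
    have "f * g = (\<Sum>k\<in>support f. monomial k (?f k)) *
        (\<Sum>l\<in>support g. monomial l (?g l))"
      using poly_mapping_eq_sum_single[of f] poly_mapping_eq_sum_single[of g] by simp
    also have "\<dots> = (\<Sum>k\<in>support f. \<Sum>l\<in>support g. monomial (k + l) (?f k * ?g l))"
      by (simp add: sum_product mult_single)
    also have "\<dots> \<in> section_algebra T m"
    proof (intro section_algebra_sum section_algebra_single)
      fix k l assume "k \<in> support f" "l \<in> support g"
      then have k: "k \<in> T" "?f k \<in> global_sections (m k)" and l: "l \<in> T" "?g l \<in> global_sections (m l)"
        using fg by (auto simp: section_algebra_def)
      show "k + l \<in> T" using T k l by (simp add: additive_submonoid_def)
      show "?f k * ?g l \<in> global_sections (m (k + l))"
        using global_sections_mult[OF k(2) l(2)] global_sections_mono[OF super[OF k(1) l(1)]] by blast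
    qed
    finally show ?thesis .
  qed
  have diff: "f - g \<in> section_algebra T m" if fg: "f \<in> section_algebra T m" "g \<in> section_algebra T m" for f g
  proof -
    have "- g \<in> section_algebra T m"
      using fg(2) by (auto simp: section_algebra_def global_sections_uminus)
    then have "f + - g \<in> section_algebra T m" using fg(1) by (rule section_algebra_add[rotated])
    then show ?thesis by simp
  qed
  have "f + g \<in> section_algebra T m" if "f \<in> section_algebra T m" "g \<in> section_algebra T m" for f g
    using that by (rule section_algebra_add)
  then show ?thesis using zero one mult diff by (simp add: is_subring_def)
qed

text \<open>
  Let \<open>B\<close> generate the monoid of all pairs of a degree \<open>s \<in> T\<close> and a divisor \<open>N \<le> m s\<close> supported on \<open>X\<close>.
  Writing the pair \<open>(s, m s)\<close> as a sum of elements of \<open>B\<close>, a section of \<open>m s\<close> is decomposed into products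
  of the module generators belonging to the elements of \<open>B\<close>, one summand at a time.
\<close>

lemma section_algebra_finitely_generated:
  fixes m :: "nat ^ 'r \<Rightarrow> 'a set \<Rightarrow> int" and E T :: "(nat ^ 'r) set"
  assumes E: "finite E" and X: "finite X" "X \<subseteq> points" and W: "finite W"
    and T: "additive_submonoid T" "T \<subseteq> nat_span E"
    and m0: "m 0 = (\<lambda>_. 0)"
    and super: "\<And>s t. s \<in> T \<Longrightarrow> t \<in> T \<Longrightarrow> (\<lambda>P. m s P + m t P) \<le> m (s + t)"
    and supp: "\<And>s. s \<in> T \<Longrightarrow> supp_div (m s) \<subseteq> X"
    and sol: "\<And>f. f \<in> nat_solutions (E <+> X <+> X) W \<longleftrightarrow>
        (\<forall>i. i \<notin> E <+> X <+> X \<longrightarrow> f i = 0) \<and> exponent E f \<in> T \<and> point_coeffs X f \<le> m (exponent E f)"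
  shows "finitely_generated_algebra base_constants (section_algebra T m)"
proof -
  let ?I = "E <+> X <+> X"
  obtain B where B: "finite B" "B \<subseteq> nat_solutions ?I W" "nat_solutions ?I W \<subseteq> monoid_gen B"
    using gordan[of ?I W] E X W by auto
  have div: "is_divisor (point_coeffs X f)" for f :: "nat ^ 'r + 'a set + 'a set \<Rightarrow> nat"
    using X finite_subset[of "supp_div (point_coeffs X f)" X]
    by (auto simp: is_divisor_def supp_div_def point_coeffs_def split: if_splits)
  define gens where "gens b \<Gamma> \<longleftrightarrow> finite \<Gamma> \<and> \<Gamma> \<subseteq> global_sections (point_coeffs X b) \<and>
    (\<forall>D'. \<forall>\<phi>\<in>global_sections (\<lambda>P. point_coeffs X b P + D' P).
       \<exists>\<psi>. (\<forall>\<alpha>\<in>\<Gamma>. \<psi> \<alpha> \<in> global_sections D') \<and> \<phi> = (\<Sum>\<alpha>\<in>\<Gamma>. \<alpha> * \<psi> \<alpha>))"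
    for b :: "nat ^ 'r + 'a set + 'a set \<Rightarrow> nat" and \<Gamma>
  have "\<forall>b. \<exists>\<Gamma>. gens b \<Gamma>"
    unfolding gens_def by (intro allI global_sections_generators div)
  from choice[OF this] obtain \<Gamma> where gens: "\<forall>b. gens b (\<Gamma> b)" ..
  have \<Gamma>: "finite (\<Gamma> b)" "\<Gamma> b \<subseteq> global_sections (point_coeffs X b)"
    "\<phi> \<in> global_sections (\<lambda>P. point_coeffs X b P + D P) \<Longrightarrow>
       \<exists>\<psi>. (\<forall>\<alpha>\<in>\<Gamma> b. \<psi> \<alpha> \<in> global_sections D) \<and> \<phi> = (\<Sum>\<alpha>\<in>\<Gamma> b. \<alpha> * \<psi> \<alpha>)" for b D \<phi>
    using gens[rule_format, of b] unfolding gens_def by blast+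
  define G where "G = (\<Union>b\<in>B. monomial (exponent E b) ` \<Gamma> b)"
  let ?R = "is_subring hull (base_constants \<union> G)"
  have R: "is_subring ?R" by (rule is_subring_hull)
  have sub: "?R \<subseteq> section_algebra T m"
  proof (rule hull_minimal)
    show "is_subring (section_algebra T m)" by (rule is_subring_section_algebra[OF T(1) m0 super])
    have "base_constants \<subseteq> section_algebra T m"
      using T(1) m0 global_sections_0
      by (auto simp: base_constants_def additive_submonoid_def intro!: section_algebra_single)
    moreover have "G \<subseteq> section_algebra T m"
    proof
      fix y assume "y \<in> G"
      then obtain b \<alpha> where b: "b \<in> B" "\<alpha> \<in> \<Gamma> b" "y = monomial (exponent E b) \<alpha>"
        unfolding G_def by blast
      then have "exponent E b \<in> T" "point_coeffs X b \<le> m (exponent E b)" using B(2) sol by auto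
      then show "y \<in> section_algebra T m"
        unfolding b(3) using \<Gamma>(2)[of b] b(2) global_sections_mono by (intro section_algebra_single) blast+
    qed
    ultimately show "base_constants \<union> G \<subseteq> section_algebra T m" by blast
  qed
  have monomial_in: "monomial (exponent E f) \<phi> \<in> ?R"
    if "f \<in> monoid_gen B" "\<phi> \<in> global_sections (point_coeffs X f)" for f \<phi>
    using that
  proof (induction arbitrary: \<phi>)
    case zero
    then obtain a where "\<phi> = to_fract a" unfolding point_coeffs_zero global_sections_0 by blast
    then show ?case unfolding exponent_zero by (intro hull_inc) (simp add: base_constants_def)
  next
    case (add b f)
    obtain \<psi> where \<psi>: "\<And>\<alpha>. \<alpha> \<in> \<Gamma> b \<Longrightarrow> \<psi> \<alpha> \<in> global_sections (point_coeffs X f)"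
      "\<phi> = (\<Sum>\<alpha>\<in>\<Gamma> b. \<alpha> * \<psi> \<alpha>)"
      using \<Gamma>(3)[of \<phi> b "point_coeffs X f"] add.prems unfolding point_coeffs_add by blast
    have "monomial (exponent E b + exponent E f) \<phi> =
        (\<Sum>\<alpha>\<in>\<Gamma> b. monomial (exponent E b) \<alpha> * monomial (exponent E f) (\<psi> \<alpha>))"
      unfolding \<psi>(2) single_sum mult_single ..
    also have "\<dots> \<in> ?R"
    proof (rule is_subring_sum[OF R])
      fix \<alpha> assume \<alpha>: "\<alpha> \<in> \<Gamma> b"
      have "monomial (exponent E b) \<alpha> \<in> ?R"
        using \<alpha> add.hyps(1) by (intro hull_inc) (auto simp: G_def)
      moreover have "monomial (exponent E f) (\<psi> \<alpha>) \<in> ?R" using add.IH \<psi>(1)[OF \<alpha>] .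
      ultimately show "monomial (exponent E b) \<alpha> * monomial (exponent E f) (\<psi> \<alpha>) \<in> ?R"
        using R unfolding is_subring_def by blast
    qed
    finally show ?case unfolding exponent_add .
  qed
  have "section_algebra T m \<subseteq> ?R"
  proof
    fix y assume y: "y \<in> section_algebra T m"
    have "(\<Sum>k\<in>support y. monomial k (coefficient y k)) \<in> ?R"
    proof (rule is_subring_sum[OF R])
      fix k assume "k \<in> support y"
      then have k: "k \<in> T" "coefficient y k \<in> global_sections (m k)"
        using y by (auto simp: section_algebra_def)
      obtain c where c: "k = (\<Sum>e\<in>E. c e *s e)" using T(2) k(1) unfolding nat_span_def by blast
      define f where "f i = (case i of Inl e \<Rightarrow> if e \<in> E then c e else 0
        | Inr (Inl P) \<Rightarrow> if P \<in> X then nat (m k P) else 0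
        | Inr (Inr P) \<Rightarrow> if P \<in> X then nat (- m k P) else 0)" for i
      have f_exp: "exponent E f = k" unfolding exponent_def c f_def by (intro sum.cong) simp_all
      have "m k P = 0" if "P \<notin> X" for P using supp[OF k(1)] that by (auto simp: supp_div_def)
      then have f_coeffs: "point_coeffs X f = m k" by (auto simp: point_coeffs_def f_def)
      have "f \<in> nat_solutions ?I W"
        unfolding sol f_exp f_coeffs using k(1) by (auto simp: f_def split: sum.splits)
      then show "monomial k (coefficient y k) \<in> ?R"
        using monomial_in[of f] B(3) k(2) f_exp f_coeffs by auto
    qed
    then show "y \<in> ?R" by (simp flip: poly_mapping_eq_sum_single)
  qed
  then have "?R = section_algebra T m" using sub by blast
  moreover have "finite G" using B(1) \<Gamma>(1) by (simp add: G_def)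
  ultimately show ?thesis unfolding finitely_generated_algebra_def by blast
qed

text \<open>
  This covers a cone that meets the monoid in the origin only, where no order unit need be available.
\<close>

lemma section_algebra_zero_finitely_generated:
  fixes m :: "nat ^ 'r \<Rightarrow> 'a set \<Rightarrow> int"
  assumes m0: "m 0 = (\<lambda>_. 0)"
  shows "finitely_generated_algebra base_constants (section_algebra {0} m)"
proof -
  have eq: "section_algebra {0} m = base_constants"
  proof
    show "base_constants \<subseteq> section_algebra {0} m"
      using m0 global_sections_0 by (auto simp: base_constants_def intro!: section_algebra_single)
    show "section_algebra {0} m \<subseteq> base_constants"
    proof
      fix f assume f: "f \<in> section_algebra {0} m"
      then have "coefficient f 0 \<in> range to_fract"
        using m0 global_sections_0 by (simp add: section_algebra_def)
      moreover have "f = monomial 0 (coefficient f 0)"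
      proof (rule poly_mapping_eqI)
        fix k
        have "k \<noteq> 0 \<Longrightarrow> k \<notin> support f" using f by (auto simp: section_algebra_def)
        then show "coefficient f k = coefficient (monomial 0 (coefficient f 0)) k"
          by (auto simp: lookup_single when_def in_keys_iff)
      qed
      ultimately show "f \<in> base_constants" unfolding base_constants_def by auto
    qed
  qed
  have "is_subring (section_algebra {0} m)"
    by (rule is_subring_section_algebra) (simp_all add: additive_submonoid_def m0)
  then have "is_subring hull (base_constants \<union> {}) = section_algebra {0} m"
    unfolding eq by (simp add: hull_same)
  then show ?thesis unfolding finitely_generated_algebra_def by blast
qed

end

theorem theorem6p1:
  fixes emb :: "'k::{alg_closed_field, field_char_0} \<Rightarrow> 'a::idom"
    and E S :: "(nat ^ 'r) set"
    and F :: "'a set \<Rightarrow> real"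
    and m :: "nat ^ 'r \<Rightarrow> 'a set \<Rightarrow> int"
    and C :: "(real ^ 'r) set"
  assumes "affine_curve emb"
    and "finite E" and "S = nat_span E"
    and "is_divisor F" and "ceil_div F \<ge> (\<lambda>P. 0)"
    and "\<And>s. s \<in> S \<Longrightarrow> is_divisor (m s)"
    and "superadditive_system S m"
    and "bounded_system S m"
    and "saturated_system S m F"
    and "rational_polyhedral_cone C"
    and "C \<subseteq> int_cone (cone_span (real_vec ` E))"
  shows "finitely_generated_algebra base_constants
           (section_algebra {s \<in> S. real_vec s \<in> C} m)"
proof -
  interpret dedekind_ring "TYPE('a)" using affine_curve_dedekind_ring[OF assms(1)] .
  note E = assms(2) and S = assms(3)
  have Sm: "additive_submonoid S" unfolding S by (rule additive_submonoid_nat_span)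
  have super: "m s P + m t P \<le> m (s + t) P" if "s \<in> S" "t \<in> S" for s t P
    using assms(7) that unfolding superadditive_system_def le_fun_def by blast
  have F: "F P > - 1" for P
  proof -
    have "0 \<le> \<lceil>F P\<rceil>" using assms(5) by (simp add: ceil_div_def le_fun_def)
    then show ?thesis by linarith
  qed
  have sat: "real_of_int (m (\<kappa> *s s) P) / real \<kappa> + F P \<le> real_of_int (m s P)"
    if s: "s \<in> S" and \<kappa>: "\<kappa> > 0" for s and \<kappa> :: nat and P
  proof -
    have "real_vec s = (\<Sum>i<1::nat. real_of_rat (1 / of_nat \<kappa>) *\<^sub>R real_vec (\<kappa> *s s))"
      using \<kappa> by (simp add: vec_eq_iff real_vec_def of_rat_divide)
    moreover have "\<kappa> *s s \<in> S" using additive_submonoid_smult[OF Sm s] .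
    ultimately have "ceil_div (\<lambda>P. (\<Sum>i<1::nat. real_of_rat (1 / of_nat \<kappa>) * real_of_int (m (\<kappa> *s s) P)) + F P) \<le> m s"
      using assms(9) s unfolding saturated_system_def
      by (elim allE[of _ "1 :: nat"] allE[of _ "\<lambda>_. 1 / of_nat \<kappa>"] allE[of _ "\<lambda>_. \<kappa> *s s"] allE[of _ s]) simp
    then have "\<lceil>(\<Sum>i<1::nat. real_of_rat (1 / of_nat \<kappa>) * real_of_int (m (\<kappa> *s s) P)) + F P\<rceil> \<le> m s P"
      unfolding ceil_div_def le_fun_def by blast
    then show ?thesis by (simp add: ceiling_le_iff of_rat_divide)
  qed
  have m0: "m 0 = (\<lambda>_. 0)"
  proof
    fix P
    have 0: "0 \<in> S" using Sm by (simp add: additive_submonoid_def)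
    have "m 0 P \<le> 0" using super[OF 0 0, of P] by simp
    moreover have "0 \<le> m 0 P"
    proof -
      \<comment> \<open>The case \<open>n = 0\<close> of saturation, in which the sum over \<open>\<xi>\<close> is empty.\<close>
      have "real_vec (0 :: nat ^ 'r) = 0" by (simp add: real_vec_def vec_eq_iff)
      then have "ceil_div (\<lambda>P. 0 + F P) \<le> m 0"
        using assms(9) 0 unfolding saturated_system_def
        by (elim allE[of _ "0 :: nat"] allE[of _ "\<lambda>_. 0"] allE[of _ "\<lambda>_. 0"] allE[of _ "0 :: nat ^ 'r"]) simp
      then have "\<lceil>F P\<rceil> \<le> m 0 P" by (simp add: ceil_div_def le_fun_def)
      then show ?thesis using F[of P] by linarith
    qed
    ultimately show "m 0 P = 0" by simp
  qed
  define T where "T = {s \<in> S. real_vec s \<in> C}"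
  obtain H where H: "finite H" "\<And>x. x \<in> C \<longleftrightarrow> (\<forall>a\<in>H. 0 \<le> rat_dot a (\<lambda>i. x $ i))"
    using rational_polyhedral_cone_inequalities[OF assms(10)] by blast
  have H_nat: "real_vec s \<in> C \<longleftrightarrow> (\<forall>a\<in>H. 0 \<le> rat_dot a (nat_coords s))" for s :: "nat ^ 'r"
  proof -
    have "rat_dot a (\<lambda>i. real_vec s $ i) = of_rat (rat_dot a (nat_coords s))" for a
      by (simp add: real_vec_eq_rat_vec rat_vec_def rat_dot_of_rat)
    then show ?thesis unfolding H(2) by simp
  qed
  have dot_add: "rat_dot a (nat_coords (s + t)) = rat_dot a (nat_coords s) + rat_dot a (nat_coords t)"
    for a and s t :: "nat ^ 'r"
    by (simp add: rat_dot_def nat_coords_def distrib_left sum.distrib)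
  have dot_0: "rat_dot a (nat_coords (0 :: nat ^ 'r)) = 0" for a
    by (simp add: rat_dot_def nat_coords_def)
  have T: "additive_submonoid T"
    using Sm by (auto simp: T_def additive_submonoid_def H_nat dot_add dot_0)
  have unit: "order_unit S x" if "x \<in> T" "x \<noteq> 0" for x
  proof -
    have "real_vec x \<noteq> 0" using that(2) by (auto simp: real_vec_def vec_eq_iff)
    moreover have "real_vec x \<in> C" "x \<in> S" using that(1) by (simp_all add: T_def)
    ultimately have "real_vec x \<in> interior (cone_span (real_vec ` E))"
      using assms(11) by (auto simp: int_cone_def)
    then show ?thesis using interior_order_unit[OF E] \<open>x \<in> S\<close> unfolding S by blast
  qed
  show ?thesis
  proof (cases "T = {0}")
    case True
    then show ?thesis using section_algebra_zero_finitely_generated[of m, OF m0] unfolding T_def by simp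
  next
    case False
    then obtain x0 where x0: "x0 \<in> T" "x0 \<noteq> 0" using T by (auto simp: additive_submonoid_def)
    obtain G where G: "is_reduced_divisor G" "\<And>s. s \<in> S \<Longrightarrow> supp_div (m s) \<subseteq> supp_div G"
      using assms(8) unfolding bounded_system_def by blast
    define X where "X = supp_div G"
    have X: "finite X" "X \<subseteq> points" using G(1) by (simp_all add: X_def is_reduced_divisor_def is_divisor_def)
    define majorants where "majorants P \<Lambda> \<longleftrightarrow> finite \<Lambda> \<and>
      (\<forall>l\<in>\<Lambda>. \<forall>c. of_int (m (\<Sum>e\<in>E. c e *s e) P) \<le> (\<Sum>e\<in>E. l e * of_nat (c e))) \<and>
      (\<forall>c. order_unit S (\<Sum>e\<in>E. c e *s e) \<longrightarrow>
         (\<exists>l\<in>\<Lambda>. (\<Sum>e\<in>E. l e * of_nat (c e)) < of_int (m (\<Sum>e\<in>E. c e *s e) P) + 1))"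
      for P and \<Lambda> :: "(nat ^ 'r \<Rightarrow> rat) set"
    have "\<exists>\<Lambda>. majorants P \<Lambda>" for P
      unfolding majorants_def
    proof (rule bounded_saturated_majorants[OF E S, of "\<lambda>s. m s P" "F P"])
      fix s assume "s \<in> S"
      then show "\<exists>d. (\<lambda>\<kappa>::nat. real_of_int (m (\<kappa> *s s) P) / real \<kappa>) \<longlonglongrightarrow> d"
        using assms(8) unfolding bounded_system_def by blast
    qed (use super sat F in auto)
    then have "\<forall>P. \<exists>\<Lambda>. majorants P \<Lambda>" by (rule allI)
    from choice[OF this] obtain \<Lambda> where maj: "\<forall>P. majorants P (\<Lambda> P)" ..
    have \<Lambda>: "finite (\<Lambda> P)"
      "l \<in> \<Lambda> P \<Longrightarrow> of_int (m (\<Sum>e\<in>E. c e *s e) P) \<le> (\<Sum>e\<in>E. l e * of_nat (c e))"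
      "order_unit S (\<Sum>e\<in>E. c e *s e) \<Longrightarrow>
         \<exists>l\<in>\<Lambda> P. (\<Sum>e\<in>E. l e * of_nat (c e)) < of_int (m (\<Sum>e\<in>E. c e *s e) P) + 1" for P l c
      using maj[rule_format, of P] unfolding majorants_def by blast+
    have coeff_iff: "n \<le> m (\<Sum>e\<in>E. c e *s e) P \<longleftrightarrow> (\<forall>l\<in>\<Lambda> P. of_int n \<le> (\<Sum>e\<in>E. l e * of_nat (c e)))"
      if cT: "(\<Sum>e\<in>E. c e *s e) \<in> T" for c P n
    proof
      assume "n \<le> m (\<Sum>e\<in>E. c e *s e) P"
      then have "(of_int n :: rat) \<le> of_int (m (\<Sum>e\<in>E. c e *s e) P)" by simp
      then show "\<forall>l\<in>\<Lambda> P. of_int n \<le> (\<Sum>e\<in>E. l e * of_nat (c e))"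
        using \<Lambda>(2) by (meson order_trans)
    next
      assume le: "\<forall>l\<in>\<Lambda> P. of_int n \<le> (\<Sum>e\<in>E. l e * of_nat (c e))"
      have "\<exists>l\<in>\<Lambda> P. (\<Sum>e\<in>E. l e * of_nat (c e)) < of_int (m (\<Sum>e\<in>E. c e *s e) P) + 1"
      proof (cases "(\<Sum>e\<in>E. c e *s e) = 0")
        case False
        then show ?thesis using \<Lambda>(3) unit[OF cT] by blast
      next
        case True
        \<comment> \<open>A representation \<open>c\<close> of \<open>0\<close> may be added to a representation of the order unit
          \<open>x0\<close>; a majorant that exceeds \<open>m\<close> by less than \<open>1\<close> at the sum does so at \<open>c\<close> too.\<close>
        obtain d where "x0 = (\<Sum>e\<in>E. d e *s e)" using x0(1) unfolding T_def S nat_span_def by blast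
        then have d: "(\<Sum>e\<in>E. d e *s e) = x0" "(\<Sum>e\<in>E. (d e + c e) *s e) = x0"
          using True by (simp_all add: vector_sadd_rdistrib sum.distrib)
        have "order_unit S (\<Sum>e\<in>E. (d e + c e) *s e)" using unit[OF x0] d(2) by simp
        from \<Lambda>(3)[OF this, of P] obtain l where l: "l \<in> \<Lambda> P"
          "(\<Sum>e\<in>E. l e * of_nat (d e + c e)) < of_int (m x0 P) + 1" unfolding d(2) by blast
        have "of_int (m x0 P) \<le> (\<Sum>e\<in>E. l e * of_nat (d e))" using \<Lambda>(2)[OF l(1), of d] d(1) by simp
        then have "(\<Sum>e\<in>E. l e * of_nat (c e)) < 1"
          using l(2) by (simp add: distrib_left sum.distrib)
        then show ?thesis using l(1) True m0 by (intro bexI[of _ l]) simp_all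
      qed
      then obtain l where "l \<in> \<Lambda> P" "(\<Sum>e\<in>E. l e * of_nat (c e)) < of_int (m (\<Sum>e\<in>E. c e *s e) P) + 1" by blast
      then have "(of_int n :: rat) < of_int (m (\<Sum>e\<in>E. c e *s e) P + 1)" using le by fastforce
      then have "n < m (\<Sum>e\<in>E. c e *s e) P + 1" by (simp only: of_int_less_iff)
      then show "n \<le> m (\<Sum>e\<in>E. c e *s e) P" by simp
    qed
    define W where "W = degree_weight ` H \<union> (\<Union>P\<in>X. coeff_weight P ` \<Lambda> P)"
    have W: "finite W" using H(1) X(1) \<Lambda>(1) by (simp add: W_def)
    have TS: "T \<subseteq> nat_span E" unfolding T_def S by blast
    have exponent_S: "exponent E f \<in> S" for f :: "nat ^ 'r + 'a set + 'a set \<Rightarrow> nat"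
      unfolding exponent_def S nat_span_def
      by (intro CollectI exI[of _ "\<lambda>e. f (Inl e)"] conjI TrueI refl)
    have supp_m: "supp_div (m s) \<subseteq> X" if "s \<in> T" for s
      using G(2) that by (simp add: X_def T_def)
    have sol: "f \<in> nat_solutions (E <+> X <+> X) W \<longleftrightarrow>
        (\<forall>i. i \<notin> E <+> X <+> X \<longrightarrow> f i = 0) \<and> exponent E f \<in> T \<and> point_coeffs X f \<le> m (exponent E f)" for f
    proof -
      have "(\<forall>w\<in>W. 0 \<le> (\<Sum>i\<in>E <+> X <+> X. w i * of_nat (f i))) \<longleftrightarrow>
          exponent E f \<in> T \<and> (\<forall>P\<in>X. \<forall>l\<in>\<Lambda> P. of_int (point_coeffs X f P) \<le> (\<Sum>e\<in>E. l e * of_nat (f (Inl e))))"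
        using exponent_S[of f]
        by (simp add: W_def ball_Un degree_weight_sum[OF E X(1)] coeff_weight_sum[OF E X(1)] T_def H_nat)
      also have "\<dots> \<longleftrightarrow> exponent E f \<in> T \<and> (\<forall>P\<in>X. point_coeffs X f P \<le> m (exponent E f) P)"
        unfolding exponent_def using coeff_iff[of "\<lambda>e. f (Inl e)"] by blast
      also have "\<dots> \<longleftrightarrow> exponent E f \<in> T \<and> point_coeffs X f \<le> m (exponent E f)"
      proof -
        have "point_coeffs X f P \<le> m (exponent E f) P" if "exponent E f \<in> T" "P \<notin> X" for P
        proof -
          have "m (exponent E f) P = 0" using supp_m[OF that(1)] that(2) by (auto simp: supp_div_def)
          then show ?thesis using that(2) by (simp add: point_coeffs_def)
        qed
        then show ?thesis unfolding le_fun_def by blast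
      qed
      finally show ?thesis unfolding nat_solutions_def by blast
    qed
    have superT: "(\<lambda>P. m s P + m t P) \<le> m (s + t)" if "s \<in> T" "t \<in> T" for s t
      using super that by (auto simp: T_def le_fun_def)
    show ?thesis
      using section_algebra_finitely_generated[of E X W T m, OF E X W T TS m0 superT supp_m sol] unfolding T_def .
  qed
qed

end
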